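(* Let $\mathcal M$ be a restricted hyperbolic convex polygon in the hyperbolic plane. Then there are $\delta_1,\delta_2,\delta_3\in P(\mathcal M)$ (so $\delta_1^2=\delta_2^2=\delta_3^2=-2$) which span $V$, have a connected Gram graph, and satisfy $$(\delta_i,\delta_j)\le 32\left(\mathrm{ch}^3\frac\beta2+\mathrm{ch}^2\frac\beta2\right)-2<83.7706$$ for all $1\le i,j\le3$, where $\beta=0.983986\ldots$ is the solution of the equation $32(\mathrm{ch}^3\frac\eta2+\mathrm{ch}^2\frac\eta2)-2=8\,\mathrm{ch}\frac\eta2+10+\frac{8}{\mathrm{ch}\frac\eta2-1}$ in $\eta$.
   Context: Let $V$ be a $3$-dimensional real vector space with symmetric bilinear form of signature $(1,2)$; the hyperbolic plane is $\mathcal L=V^+/\mathbb R_{>0}$ ($V^+$ a component of $\{x^2>0\}$). For $\delta$ with $\delta^2<0$, $\mathcal H^+_\delta=\{\mathbb R_{>0}x:(x,\delta)\ge0\}$. For a convex, locally finite polygon $\mathcal M\subset\mathcal L$, $P(\mathcal M)$ is the set of vectors $\delta$ with $\delta^2=-2$ orthogonal to sides of $\mathcal M$ with $\mathcal M\subset\mathcal H^+_\delta$. $\mathcal M$ is restricted hyperbolic (with respect to some line $l$, the axis) if: it has nonempty interior; for each isotropic $c\neq0$ only finitely many $\delta\in P(\mathcal M)$ satisfy $(\delta,c)=0$; for every compact segment $N\subset l$, the intersection of $\mathcal M$ with the union of all lines orthogonal to $l$ through points of $N$ is, whenever it has nonempty interior, the convex hull of finitely many points; and the set of angles and distances between $l$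 and the half-planes $\mathcal H^+_\delta$, $\delta\in P(\mathcal M)$, is finite. The Gram graph of a set of vectors has an edge between two vectors iff their inner product is nonzero. *)

theory Defs
  imports "HOL-Analysis.Analysis"
begin

definition lor :: "real^3 \<Rightarrow> real^3 \<Rightarrow> real" where
  "lor x y = x$1 * y$1 - x$2 * y$2 - x$3 * y$3"

text \<open>Hyperbolic plane L = V^+ / R_{>0}, V^+ the component with first coordinate positive.
  Each ray is represented by its unique point with first coordinate 1 (Klein cross-section).\<close>
definition hypL :: "(real^3) set" where
  "hypL = {x. x$1 = 1 \<and> lor x x > 0}"

definition hypL_closure :: "(real^3) set" where
  "hypL_closure = {x. x$1 = 1 \<and> lor x x \<ge> 0}"

definition halfplane :: "real^3 \<Rightarrow> (real^3) set" where
  "halfplane d = {x \<in> hypL. lor x d \<ge> 0}"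

definition hline :: "real^3 \<Rightarrow> (real^3) set" where
  "hline d = {x \<in> hypL. lor x d = 0}"

definition convex_lf_polygon :: "(real^3) set \<Rightarrow> bool" where
  "convex_lf_polygon M \<longleftrightarrow>
     (\<exists>D. (\<forall>d\<in>D. lor d d < 0) \<and>
          M = hypL \<inter> (\<Inter>d\<in>D. halfplane d) \<and>
          (\<forall>K. compact K \<and> K \<subseteq> hypL \<longrightarrow>
               finite {hline d | d. d \<in> D \<and> hline d \<inter> K \<noteq> {}}))"

text \<open>P(M): roots orthogonal to sides of M (the side M \<inter> d^perp is a nondegenerate segment).\<close>
definition Proots :: "(real^3) set \<Rightarrow> (real^3) set" where
  "Proots M = {d. lor d d = -2 \<and> M \<subseteq> halfplane d \<and>
                  (\<exists>x y. x \<noteq> y \<and> x \<in> M \<inter> hline d \<and> y \<in> M \<inter> hline d)}"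

definition nonempty_interior :: "(real^3) set \<Rightarrow> bool" where
  "nonempty_interior M \<longleftrightarrow>
     (\<exists>x\<in>M. \<exists>\<epsilon>>0. \<forall>y\<in>hypL. dist y x < \<epsilon> \<longrightarrow> y \<in> M)"

text \<open>Union of all lines orthogonal to the line e^perp through points of N.\<close>
definition orth_strip :: "real^3 \<Rightarrow> (real^3) set \<Rightarrow> (real^3) set" where
  "orth_strip e N = {x \<in> hypL. \<exists>p\<in>N. \<exists>f. lor f f < 0 \<and> lor f e = 0 \<and> lor f p = 0 \<and> lor f x = 0}"

text \<open>Angle (intersecting/parallel lines) or distance (ultraparallel lines) between the
  axis e^perp and the line d^perp, for e^2 = d^2 = -2.\<close>
definition angle_dist :: "real^3 \<Rightarrow> real^3 \<Rightarrow> real + real" where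
  "angle_dist e d = (let t = \<bar>lor e d\<bar> / 2 in if t \<le> 1 then Inl (arccos t) else Inr (arcosh t))"

definition restricted_hyperbolic :: "(real^3) set \<Rightarrow> real^3 \<Rightarrow> bool" where
  "restricted_hyperbolic M e \<longleftrightarrow>
     lor e e = -2 \<and>
     nonempty_interior M \<and>
     (\<forall>c. c \<noteq> 0 \<and> lor c c = 0 \<longrightarrow> finite {d \<in> Proots M. lor d c = 0}) \<and>
     (\<forall>a b. a \<in> hline e \<and> b \<in> hline e \<longrightarrow>
        nonempty_interior (M \<inter> orth_strip e (closed_segment a b)) \<longrightarrow>
        (\<exists>F. finite F \<and> F \<subseteq> hypL_closure \<and>
             M \<inter> orth_strip e (closed_segment a b) = convex hull F \<inter> hypL)) \<and>
     finite (angle_dist e ` Proots M)"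

definition gram_connected :: "(real^3) set \<Rightarrow> bool" where
  "gram_connected S \<longleftrightarrow>
     (\<forall>x\<in>S. \<forall>y\<in>S. (\<lambda>u v. u \<in> S \<and> v \<in> S \<and> u \<noteq> v \<and> lor u v \<noteq> 0)\<^sup>*\<^sup>* x y)"

definition beta_const :: real where
  "beta_const = (THE \<eta>. \<eta> > 0 \<and>
      32 * (cosh (\<eta>/2) ^ 3 + cosh (\<eta>/2) ^ 2) - 2 = 8 * cosh (\<eta>/2) + 10 + 8 / (cosh (\<eta>/2) - 1))"

definition bound_const :: real where
  "bound_const = 32 * (cosh (beta_const/2) ^ 3 + cosh (beta_const/2) ^ 2) - 2"

end

theory Submission
  imports Defs
begin

text \<open>
  Any three distinct roots of a polygon are linearly independent, because a linear relation between
  them would make one side redundant, so only connectedness and the upper bound matter. Two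
  sides with a common orthogonal root \<open>n\<close> have a nonzero product, and only \<open>n\<close> is orthogonal to
  both; hence a disconnected triple \<open>n, a, b\<close> with \<open>(n, a) = (n, b) = 0\<close> can be repaired by
  replacing \<open>n\<close> with any fourth root.

  Let \<open>w\<close> be an interior point of the polygon if there are finitely many sides, and the vector \<open>e\<close>
  orthogonal to the axis otherwise, and call \<open>\<bar>(d, w)\<bar>\<close> the height of \<open>d\<close>. If \<open>d\<close> has maximal
  height, its two neighbours have bounded product. To keep the triple connected, a root orthogonal
  to both neighbours and strictly higher than them is called isolated and is skipped; the maximum is
  taken over the others, and yields products at most 62.

  With respect to the axis this needs \<open>(d, e)\<^sup>2 \<ge> 20\<close>. If all such roots are isolated and there are
  infinitely many sides, these accumulate at an end of the axis. Far enough towards that end no side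
  crosses the axis, and two sides meeting on one side of the axis (or the two neighbours of an
  isolated one), together with one facing them across the axis, have bounded products.
  All bounds are at most \<open>62 = 32 (1 + 1) - 2\<close>, which is below the constant of the theorem.
\<close>

subsection \<open>The Lorentzian form on the Klein model\<close>

text \<open>With infinitely many sides the heights over a fixed interior point need not have a
  maximum, whereas the heights over \<open>e\<close> take finitely many values:
  \<open>\<bar>lor d e\<bar>\<close> is twice the cosine of the angle with the axis, or twice the
  hyperbolic cosine of the distance to it. The price is that \<open>e\<close> is spacelike: with
  \<open>h = lor d e\<close>, the projection \<open>e + (h/2) d\<close> is timelike only for
  \<open>h^2 > 4\<close>. The product bound depends on the ratio \<open>h^2 / (h^2/2 - 2)\<close>,
  and \<open>h^2 >= 20\<close> is exactly where it is at most 5/2. With 5/2, two roots orthogonal to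
  \<open>d\<close> and at most as high as \<open>d\<close> have product at most 7, and two such
  roots whose products with \<open>d\<close> are at most 7 in absolute value have product at most 7
  + 35 + 49/4 < 62. So skipping an isolated neighbour costs one more use of the same estimate and
  stays below 62. Sides closer to the axis escape this estimate and are compared through their
  coordinates along the two ends of the axis.\<close>

lemma bounded_bilinear_lor: "bounded_bilinear lor"
proof
  show "\<exists>K. \<forall>a b. norm (lor a b) \<le> norm a * norm b * K"
  proof (intro exI allI)
    fix a b :: "real^3"
    have *: "\<bar>a$i * b$i\<bar> \<le> norm a * norm b" for i
      unfolding abs_mult by (intro mult_mono component_le_norm_cart) auto
    show "norm (lor a b) \<le> norm a * norm b * 3"
      unfolding lor_def real_norm_def using *[of 1] *[of 2] *[of 3] by linarith
  qed
qed (simp_all add: lor_def algebra_simps)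

interpretation lor: bounded_bilinear lor
  by (rule bounded_bilinear_lor)

declare lor.zero_left [simp] lor.zero_right [simp]

lemmas lor_simps = lor.add_left lor.add_right lor.diff_left lor.diff_right
  lor.scaleR_left lor.scaleR_right lor.minus_left lor.minus_right

lemma lor_commute: "lor x y = lor y x"
  by (simp add: lor_def mult.commute)

lemma vec3_eq_iff: "(x::real^3) = y \<longleftrightarrow> x$1 = y$1 \<and> x$2 = y$2 \<and> x$3 = y$3"
  by (simp add: vec_eq_iff forall_3)

lemma norm3_squared: "(norm (x::real^3))\<^sup>2 = (x$1)\<^sup>2 + (x$2)\<^sup>2 + (x$3)\<^sup>2"
  by (simp add: power2_norm_eq_inner inner_vec_def sum_3) (simp add: power2_eq_square)

lemma cauchy2: "(a * c + b * d)\<^sup>2 \<le> (a\<^sup>2 + b\<^sup>2) * (c\<^sup>2 + d\<^sup>2)" for a b c d :: real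
proof -
  have "(a\<^sup>2 + b\<^sup>2) * (c\<^sup>2 + d\<^sup>2) = (a * c + b * d)\<^sup>2 + (a * d - b * c)\<^sup>2"
    by (simp add: power2_eq_square algebra_simps)
  then show ?thesis by simp
qed

lemma causal_fst_nonzero:
  assumes "lor z z \<ge> 0" "z \<noteq> 0"
  shows "z$1 \<noteq> 0"
proof
  assume z: "z$1 = 0"
  then have "(z$2)\<^sup>2 + (z$3)\<^sup>2 \<le> 0"
    using assms(1) by (simp add: lor_def power2_eq_square)
  then have "z$2 = 0 \<and> z$3 = 0"
    by (simp add: sum_power2_le_zero_iff)
  with z assms(2) show False by (simp add: vec3_eq_iff)
qed

text \<open>Cauchy-Schwarz in the two negative coordinates. Estimates on products of roots arise by
  applying this to a combination of roots made orthogonal to a causal vector.\<close>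

lemma orth_causal_nonpos:
  assumes "lor z z \<ge> 0" "z \<noteq> 0" "lor s z = 0"
  shows "lor s s \<le> 0"
proof -
  have z1: "(z$1)\<^sup>2 > 0" using causal_fst_nonzero[OF assms(1,2)] by simp
  have "(s$1)\<^sup>2 * (z$1)\<^sup>2 = (s$2 * z$2 + s$3 * z$3)\<^sup>2"
    using assms(3) unfolding lor_def power_mult_distrib[symmetric] by (metis add.commute diff_add_cancel diff_eq_eq eq_iff_diff_eq_0)
  also have "\<dots> \<le> ((s$2)\<^sup>2 + (s$3)\<^sup>2) * ((z$2)\<^sup>2 + (z$3)\<^sup>2)"
    by (rule cauchy2)
  also have "\<dots> \<le> ((s$2)\<^sup>2 + (s$3)\<^sup>2) * (z$1)\<^sup>2"
    using assms(1) by (intro mult_left_mono) (auto simp: lor_def power2_eq_square)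
  finally have "(s$1)\<^sup>2 \<le> (s$2)\<^sup>2 + (s$3)\<^sup>2" using z1 by simp
  then show ?thesis by (simp add: lor_def power2_eq_square)
qed

lemma orth_timelike_neg:
  assumes "lor z z > 0" "lor s z = 0" "s \<noteq> 0"
  shows "lor s s < 0"
proof -
  have z0: "z \<noteq> 0" using assms(1) by (auto simp: lor_def)
  have "lor s s \<le> 0" using orth_causal_nonpos[of z s] assms z0 by simp
  moreover have "lor s s \<noteq> 0"
  proof
    assume "lor s s = 0"
    then have "lor z z \<le> 0"
      using orth_causal_nonpos[of s z] assms by (simp add: lor_commute)
    with assms(1) show False by simp
  qed
  ultimately show ?thesis by simp
qed

lemma hypL_subset_closure: "hypL \<subseteq> hypL_closure"
  by (auto simp: hypL_def hypL_closure_def)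

text \<open>Two vectors of the affine plane \<open>x$1 = 1\<close> differ by a spacelike vector, so polarization
  turns their product into a sum of nonnegative terms.\<close>
lemma lor_polarization:
  assumes "x$1 = 1" "y$1 = 1"
  shows "2 * lor x y = lor x x + lor y y + (norm (x - y))\<^sup>2"
  using assms unfolding lor_def norm3_squared by (simp add: power2_eq_square algebra_simps)

lemma closure_lor_nonneg: "x \<in> hypL_closure \<Longrightarrow> y \<in> hypL_closure \<Longrightarrow> lor x y \<ge> 0"
  using lor_polarization[of x y] zero_le_power2[of "norm (x - y)"]
  unfolding hypL_closure_def mem_Collect_eq by linarith

lemma closure_lor_pos:
  assumes "x \<in> hypL_closure" "y \<in> hypL_closure" "x \<noteq> y"
  shows "lor x y > 0"
proof -
  have "(norm (x - y))\<^sup>2 > 0" using assms(3) by simp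
  then show ?thesis using lor_polarization[of x y] assms(1,2)
    unfolding hypL_closure_def mem_Collect_eq by linarith
qed

lemma hypL_lor_pos: "x \<in> hypL \<Longrightarrow> y \<in> hypL_closure \<Longrightarrow> lor x y > 0"
  using lor_polarization[of x y] zero_le_power2[of "norm (x - y)"]
  unfolding hypL_closure_def hypL_def mem_Collect_eq by linarith

lemma lor_segment:
  "lor ((1 - t) *\<^sub>R x + t *\<^sub>R y) ((1 - t) *\<^sub>R x + t *\<^sub>R y)
    = (1 - t)\<^sup>2 * lor x x + t\<^sup>2 * lor y y + 2 * t * (1 - t) * lor x y"
  by (simp add: lor_simps power2_eq_square lor_commute[of y x] algebra_simps)

text \<open>The disc is strictly convex: the cross term in \<open>lor_segment\<close> is positive
  for distinct endpoints, even when both are ideal.\<close>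

lemma segment_in_hypL:
  assumes "x \<in> hypL_closure" "y \<in> hypL_closure" "x \<noteq> y" "0 < t" "t < 1"
  shows "(1 - t) *\<^sub>R x + t *\<^sub>R y \<in> hypL"
proof -
  have "2 * t * (1 - t) * lor x y > 0"
    using closure_lor_pos[OF assms(1-3)] assms(4,5) by simp
  moreover have "(1 - t)\<^sup>2 * lor x x \<ge> 0" "t\<^sup>2 * lor y y \<ge> 0"
    using assms(1,2) by (auto simp: hypL_closure_def)
  ultimately have "lor ((1 - t) *\<^sub>R x + t *\<^sub>R y) ((1 - t) *\<^sub>R x + t *\<^sub>R y) > 0"
    unfolding lor_segment by linarith
  then show ?thesis using assms(1,2) by (simp add: hypL_def hypL_closure_def)
qed

lemma convex_hypL_closure: "convex hypL_closure"
  unfolding convex_alt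
proof (intro ballI allI impI)
  fix x y :: "real^3" and u :: real
  assume *: "x \<in> hypL_closure" "y \<in> hypL_closure" "0 \<le> u \<and> u \<le> 1"
  show "(1 - u) *\<^sub>R x + u *\<^sub>R y \<in> hypL_closure"
  proof (cases "x = y \<or> u = 0 \<or> u = 1")
    case True
    then show ?thesis using * by (auto simp flip: scaleR_add_left)
  next
    case False
    then show ?thesis using segment_in_hypL[of x y u] * hypL_subset_closure by auto
  qed
qed

lemma closed_hypL_closure: "closed hypL_closure"
proof -
  have 1: "closed {x::real^3. x$1 = 1}"
    using closed_hyperplane[of "axis 1 1 :: real^3" 1] by (simp add: inner_axis')
  have 2: "closed {x. 0 \<le> lor x x}"
    by (intro closed_Collect_le continuous_on_const lor.continuous_on continuous_on_id)
  have "hypL_closure = {x. x$1 = 1} \<inter> {x. 0 \<le> lor x x}"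
    by (auto simp: hypL_closure_def)
  then show ?thesis using closed_Int[OF 1 2] by argo
qed

lemma compact_hypL_closure: "compact hypL_closure"
proof -
  have "norm x \<le> 2" if "x \<in> hypL_closure" for x
  proof -
    have "x$1 = 1" "(x$2)\<^sup>2 + (x$3)\<^sup>2 \<le> 1"
      using that by (auto simp: hypL_closure_def lor_def power2_eq_square)
    then have "(norm x)\<^sup>2 \<le> 2\<^sup>2" unfolding norm3_squared by simp
    then show ?thesis by (rule power2_le_imp_le) simp
  qed
  then have "bounded hypL_closure" by (auto simp: bounded_iff)
  then show ?thesis using closed_hypL_closure compact_eq_bounded_closed by blast
qed

section \<open>Determinants and linear dependence\<close>

definition tri :: "real^3 \<Rightarrow> real^3 \<Rightarrow> real^3 \<Rightarrow> real" where
  "tri a b c = a$1 * (b$2 * c$3 - b$3 * c$2) - a$2 * (b$1 * c$3 - b$3 * c$1)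
     + a$3 * (b$1 * c$2 - b$2 * c$1)"

text \<open>The Gram determinant is the determinant of the form, which is 1 in signature (1,2),
  times the square of the determinant of the vectors. Hence three independent vectors have a
  positive Gram determinant.\<close>

lemma lor_gram_tri:
  "lor a a * (lor b b * lor c c - (lor b c)\<^sup>2) - lor a b * (lor a b * lor c c - lor b c * lor a c)
    + lor a c * (lor a b * lor b c - lor b b * lor a c) = (tri a b c)\<^sup>2"
  unfolding lor_def tri_def by (simp add: algebra_simps power2_eq_square)

lemma tri_cramer:
  "tri a b c *\<^sub>R x = tri x b c *\<^sub>R a + tri a x c *\<^sub>R b + tri a b x *\<^sub>R c"
  unfolding vec3_eq_iff tri_def by (auto simp: algebra_simps)

lemma span_tri:
  assumes "tri a b c \<noteq> 0"
  shows "span {a, b, c} = UNIV"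
proof -
  have "x \<in> span {a, b, c}" for x
  proof -
    have "tri x b c *\<^sub>R a + tri a x c *\<^sub>R b + tri a b x *\<^sub>R c \<in> span {a, b, c}"
      by (intro span_add span_scale span_base) auto
    then have "(1 / tri a b c) *\<^sub>R (tri a b c *\<^sub>R x) \<in> span {a, b, c}"
      unfolding tri_cramer[of a b c x] by (rule span_scale)
    then show ?thesis using assms by simp
  qed
  then show ?thesis by auto
qed

lemma tri_orth_zero:
  assumes "tri a b c \<noteq> 0" "lor s a = 0" "lor s b = 0" "lor s c = 0"
  shows "s = 0"
proof -
  have "lor s x = 0" for x
  proof -
    have "tri a b c * lor s x = lor s (tri a b c *\<^sub>R x)" by (simp add: lor_simps)
    also have "\<dots> = 0" unfolding tri_cramer[of a b c x] using assms by (simp add: lor_simps)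
    finally show ?thesis using assms(1) by simp
  qed
  from this[of "axis 1 1"] this[of "axis 2 1"] this[of "axis 3 1"]
  show ?thesis by (simp add: lor_def vec3_eq_iff axis_def)
qed

text \<open>The cross product of \<open>b\<close> and \<open>c\<close> vanishes: linear dependence
  stated without a choice of factor.\<close>

definition pairwise_minors_zero :: "real^3 \<Rightarrow> real^3 \<Rightarrow> bool" where
  "pairwise_minors_zero b c \<longleftrightarrow> b$2 * c$3 = b$3 * c$2 \<and> b$1 * c$3 = b$3 * c$1 \<and> b$1 * c$2 = b$2 * c$1"

lemma minors_zero_roots:
  assumes "pairwise_minors_zero b c" "lor b b = -2" "lor c c = -2"
  shows "c = b \<or> c = - b"
proof -
  have "b \<noteq> 0" using assms(2) by (auto simp: lor_def)
  then obtain l where l: "c = l *\<^sub>R b"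
  proof -
    assume r: "\<And>l. c = l *\<^sub>R b \<Longrightarrow> thesis"
    consider "b$1 \<noteq> 0" | "b$2 \<noteq> 0" | "b$3 \<noteq> 0"
      using \<open>b \<noteq> 0\<close> by (auto simp: vec3_eq_iff)
    then show thesis
    proof cases
      case 1 then show thesis using assms(1)
        by (intro r[of "c$1 / b$1"]) (auto simp: vec3_eq_iff eq_divide_eq mult.commute pairwise_minors_zero_def)
    next
      case 2 then show thesis using assms(1)
        by (intro r[of "c$2 / b$2"]) (auto simp: vec3_eq_iff eq_divide_eq mult.commute pairwise_minors_zero_def)
    next
      case 3 then show thesis using assms(1)
        by (intro r[of "c$3 / b$3"]) (auto simp: vec3_eq_iff eq_divide_eq mult.commute pairwise_minors_zero_def)
    qed
  qed
  then have "l\<^sup>2 = 1" using assms(2,3) by (simp add: lor_simps power2_eq_square)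
  then have "l = 1 \<or> l = -1" by (simp add: power2_eq_1_iff)
  with l show ?thesis by auto
qed

lemma tri_zero_combination:
  assumes "tri a b c = 0" "\<not> pairwise_minors_zero b c"
  obtains u v where "a = u *\<^sub>R b + v *\<^sub>R c"
proof -
  define n1 n2 n3 where n: "n1 = b$2 * c$3 - b$3 * c$2" "n2 = b$3 * c$1 - b$1 * c$3"
    "n3 = b$1 * c$2 - b$2 * c$1"
  define N where "N = n1\<^sup>2 + n2\<^sup>2 + n3\<^sup>2"
  have "N \<noteq> 0"
  proof
    assume "N = 0"
    then have "n1 = 0 \<and> n2 = 0 \<and> n3 = 0" unfolding N_def
      by (simp add: add_nonneg_eq_0_iff)
    with assms(2) show False by (auto simp: n pairwise_minors_zero_def)
  qed
  \<comment> \<open>If \<open>a = u b + v c\<close> and \<open>n\<close> is the cross product of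
    \<open>b\<close> and \<open>c\<close>, then \<open>a\<close> crossed with \<open>c\<close> is
    \<open>u n\<close> and \<open>b\<close> crossed with \<open>a\<close> is \<open>v n\<close>.
    Pairing both with \<open>n\<close> gives \<open>U = u N\<close> and
    \<open>V = v N\<close>.\<close>
  define U where "U = (a$2 * c$3 - a$3 * c$2) * n1 + (a$3 * c$1 - a$1 * c$3) * n2 + (a$1 * c$2 - a$2 * c$1) * n3"
  define V where "V = (b$2 * a$3 - b$3 * a$2) * n1 + (b$3 * a$1 - b$1 * a$3) * n2 + (b$1 * a$2 - b$2 * a$1) * n3"
  have t: "a$1 * n1 + a$2 * n2 + a$3 * n3 = 0"
    using assms(1) unfolding tri_def n by (simp add: algebra_simps)
  have "N *\<^sub>R a = U *\<^sub>R b + V *\<^sub>R c"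
  proof -
    have "N * a$1 = U * b$1 + V * c$1 + n1 * (a$1 * n1 + a$2 * n2 + a$3 * n3)"
         "N * a$2 = U * b$2 + V * c$2 + n2 * (a$1 * n1 + a$2 * n2 + a$3 * n3)"
         "N * a$3 = U * b$3 + V * c$3 + n3 * (a$1 * n1 + a$2 * n2 + a$3 * n3)"
      unfolding N_def U_def V_def n by (simp_all add: algebra_simps power2_eq_square)
    then show ?thesis unfolding t vec3_eq_iff by simp
  qed
  then have "(1/N) *\<^sub>R (N *\<^sub>R a) = (U/N) *\<^sub>R b + (V/N) *\<^sub>R c"
    by (simp add: scaleR_add_right)
  then show ?thesis using that[of "U/N" "V/N"] \<open>N \<noteq> 0\<close> by simp
qed

text \<open>Two points of the plane \<open>x$1 = 1\<close> determine a line, hence its normal up to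
  a factor, and the square -2 leaves only the sign. Normals independent in coordinates 2 and 3 would
  make \<open>x - y\<close> orthogonal to a basis containing \<open>axis 1 1\<close>.\<close>

lemma roots_orth_two_points:
  assumes "lor d d = -2" "lor d' d' = -2" "x \<noteq> y" "x$1 = 1" "y$1 = 1"
    "lor x d = 0" "lor y d = 0" "lor x d' = 0" "lor y d' = 0"
  shows "d' = d \<or> d' = - d"
proof -
  have d: "d$1 = x$2 * d$2 + x$3 * d$3" "d'$1 = x$2 * d'$2 + x$3 * d'$3"
    using assms(4,6,8) by (simp_all add: lor_def)
  have "pairwise_minors_zero d d'"
  proof (cases "d$2 * d'$3 = d$3 * d'$2")
    case True
    then show ?thesis unfolding pairwise_minors_zero_def d by (intro conjI) algebra+
  next
    case False
    have "tri (axis 1 1) d d' \<noteq> 0" using False by (simp add: tri_def axis_def)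
    moreover have "lor (x - y) (axis 1 1) = 0" using assms(4,5) by (simp add: lor_def axis_def)
    ultimately have "x - y = 0"
      by (rule tri_orth_zero) (use assms in \<open>simp_all add: lor_simps\<close>)
    with assms(3) show ?thesis by simp
  qed
  then show ?thesis by (rule minors_zero_roots[OF _ assms(1,2)])
qed

subsection \<open>Roots of a polygon\<close>

text \<open>Both \<open>d + d'\<close> and \<open>d - d'\<close> are orthogonal to the causal vector
  \<open>z\<close>, so \<open>-4 + 2 (d, d')\<close> and \<open>-4 - 2 (d, d')\<close> are
  nonpositive.\<close>

lemma common_point_le_two:
  assumes "lor d d = -2" "lor d' d' = -2" "z \<noteq> 0" "lor z z \<ge> 0" "lor z d = 0" "lor z d' = 0"
  shows "\<bar>lor d d'\<bar> \<le> 2"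
proof -
  have "lor (d + d') z = 0" "lor (d - d') z = 0"
    using assms(5,6) by (simp_all add: lor_simps lor_commute[of d z] lor_commute[of d' z])
  from this[THEN orth_causal_nonpos[OF assms(4,3)]]
  show ?thesis using assms(1,2) by (simp add: lor_simps lor_commute[of d' d])
qed

text \<open>The component of \<open>x + y\<close> orthogonal to \<open>d\<close> and to the timelike vector \<open>w + (h/2) d\<close> has
  nonpositive square.\<close>
lemma root_product_bound:
  assumes d: "lor d d = -2" and x: "lor x x = -2" and y: "lor y y = -2"
    and W: "0 < lor w w + (lor d w)\<^sup>2 / 2"
    and k: "(lor d w)\<^sup>2 \<le> 5/2 * (lor w w + (lor d w)\<^sup>2 / 2)"
    and hx: "\<bar>lor x w\<bar> \<le> \<bar>lor d w\<bar>" and hy: "\<bar>lor y w\<bar> \<le> \<bar>lor d w\<bar>"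
  shows "lor x y \<le> 7 + 5/2 * \<bar>lor d x + lor d y\<bar> + (lor d x + lor d y)\<^sup>2 / 16"
proof -
  define h where "h = lor d w"
  define V where "V = lor w w + h\<^sup>2 / 2"
  define g where "g = lor d x + lor d y"
  define u where "u = w + (h/2) *\<^sub>R d"
  define p where "p = x + y"
  define m where "m = lor p w + g * h / 2"
  have c: "lor w d = h" "lor d p = g" "lor p d = g"
    unfolding h_def g_def p_def by (simp_all add: lor_simps lor_commute)
  have ud: "lor u d = 0" unfolding u_def by (simp add: lor_simps c d)
  have uu: "lor u u = V"
    unfolding u_def V_def by (simp add: lor_simps c d h_def[symmetric] power2_eq_square)
  have pu: "lor p u = m" unfolding u_def m_def by (simp add: lor_simps c)
  have V0: "V > 0" using W unfolding V_def h_def .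
  define s where "s = p + (g/2) *\<^sub>R d - (m / V) *\<^sub>R u"
  have "lor s u = 0" unfolding s_def
    using V0 by (simp add: lor_simps pu uu lor_commute[of d u] ud)
  moreover have "u \<noteq> 0" using uu V0 by auto
  ultimately have "lor s s \<le> 0" using orth_causal_nonpos[of u s] uu V0 by simp
  moreover have "lor s s = lor p p + g\<^sup>2 / 2 - m\<^sup>2 / V"
    unfolding s_def using V0
    by (simp add: lor_simps pu uu lor_commute[of d u] lor_commute[of u p] ud c d power2_eq_square field_simps)
  ultimately have pp: "lor p p \<le> m\<^sup>2 / V - g\<^sup>2 / 2" by simp
  have "\<bar>lor p w\<bar> \<le> 2 * \<bar>h\<bar>" using hx hy unfolding p_def h_def by (simp add: lor_simps)
  then have "\<bar>m\<bar> \<le> \<bar>h\<bar> * (2 + \<bar>g\<bar> / 2)"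
    unfolding m_def using abs_triangle_ineq[of "lor p w" "g * h / 2"]
    by (simp add: abs_mult algebra_simps)
  then have "m\<^sup>2 \<le> (\<bar>h\<bar> * (2 + \<bar>g\<bar> / 2))\<^sup>2"
    using power_mono[of "\<bar>m\<bar>" "\<bar>h\<bar> * (2 + \<bar>g\<bar> / 2)" 2] by simp
  also have "\<dots> = h\<^sup>2 * (2 + \<bar>g\<bar> / 2)\<^sup>2" by (simp add: power_mult_distrib)
  also have "\<dots> \<le> (5/2 * V) * (2 + \<bar>g\<bar> / 2)\<^sup>2"
    using k unfolding V_def h_def by (intro mult_right_mono) auto
  finally have "m\<^sup>2 / V \<le> 5/2 * (2 + \<bar>g\<bar> / 2)\<^sup>2"
    using V0 by (simp add: field_simps)
  moreover have "(2 + \<bar>g\<bar> / 2)\<^sup>2 = 4 + 2 * \<bar>g\<bar> + g\<^sup>2 / 4"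
    by (simp add: power2_eq_square field_simps)
  ultimately have "lor p p \<le> 10 + 5 * \<bar>g\<bar> + g\<^sup>2 / 8" using pp by simp
  moreover have "lor p p = -4 + 2 * lor x y"
    unfolding p_def by (simp add: lor_simps x y lor_commute[of y x])
  ultimately show ?thesis unfolding g_def by simp
qed

text \<open>A graph on three vertices is connected exactly when every vertex has an edge.\<close>

definition conn3 :: "real^3 \<Rightarrow> real^3 \<Rightarrow> real^3 \<Rightarrow> bool" where
  "conn3 a b c \<longleftrightarrow> \<not> (lor a b = 0 \<and> lor a c = 0) \<and> \<not> (lor b a = 0 \<and> lor b c = 0)
     \<and> \<not> (lor c a = 0 \<and> lor c b = 0)"

definition good_triple :: "(real^3) set \<Rightarrow> bool" where
  "good_triple P \<longleftrightarrow> (\<exists>a\<in>P. \<exists>b\<in>P. \<exists>c\<in>P. a \<noteq> b \<and> a \<noteq> c \<and> b \<noteq> c \<and> conn3 a b c \<and>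
     lor a b \<le> 62 \<and> lor a c \<le> 62 \<and> lor b c \<le> 62)"

text \<open>What the combinatorics of sides uses of a polygon: \<open>p\<close> fixes the signs of
  the roots, and the two points in \<open>side\<close> say that each root supports a nondegenerate
  piece of the boundary. \<open>P\<close> may be infinite.\<close>

locale side_system =
  fixes P :: "(real^3) set" and p :: "real^3"
  assumes root: "d \<in> P \<Longrightarrow> lor d d = -2"
    and p_hypL: "p \<in> hypL"
    and p_pos: "d \<in> P \<Longrightarrow> lor p d > 0"
    and side: "d \<in> P \<Longrightarrow> \<exists>x y. x \<noteq> y \<and> x \<in> hypL \<and> y \<in> hypL \<and> lor x d = 0 \<and> lor y d = 0
      \<and> (\<forall>c\<in>P. lor x c \<ge> 0 \<and> lor y c \<ge> 0)"
begin

lemma neg_notin: "d \<in> P \<Longrightarrow> - d \<notin> P"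
  using p_pos[of d] p_pos[of "- d"] by (auto simp: lor_simps)

lemma two_points_unique:
  assumes "d \<in> P" "d' \<in> P" "x \<noteq> y" "x$1 = 1" "y$1 = 1"
    "lor x d = 0" "lor y d = 0" "lor x d' = 0" "lor y d' = 0"
  shows "d' = d"
  using roots_orth_two_points[OF root root, of d d' x y] neg_notin assms by auto

lemma not_minors_zero: "b \<in> P \<Longrightarrow> c \<in> P \<Longrightarrow> b \<noteq> c \<Longrightarrow> \<not> pairwise_minors_zero b c"
  using minors_zero_roots[OF _ root root, of b c] neg_notin by auto

text \<open>On the side of \<open>a\<close> the roots \<open>b\<close> and \<open>c\<close> are
  nonnegative with a vanishing positive combination. So both vanish at two points, which determine
  the root.\<close>

lemma no_positive_combination:
  assumes "a \<in> P" "b \<in> P" "c \<in> P" "b \<noteq> c" "a = u *\<^sub>R b + v *\<^sub>R c" "u > 0" "v > 0"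
  shows False
proof -
  obtain x y where xy: "x \<noteq> y" "x \<in> hypL" "y \<in> hypL" "lor x a = 0" "lor y a = 0"
    "\<forall>c\<in>P. lor x c \<ge> 0 \<and> lor y c \<ge> 0" using side[OF assms(1)] by blast
  have *: "lor z b = 0 \<and> lor z c = 0" if "lor z a = 0" "lor z b \<ge> 0" "lor z c \<ge> 0" for z
  proof -
    have "u * lor z b + v * lor z c = 0" using that(1) by (simp add: assms(5) lor_simps)
    moreover have "u * lor z b \<ge> 0" "v * lor z c \<ge> 0" using that assms(6,7) by auto
    ultimately have "u * lor z b = 0" "v * lor z c = 0" by linarith+
    then show ?thesis using assms(6,7) by simp
  qed
  have "lor x b = 0 \<and> lor x c = 0" "lor y b = 0 \<and> lor y c = 0"
    using *[of x] *[of y] xy assms(2,3) by auto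
  then have "c = b" using two_points_unique[OF assms(2,3) xy(1)] xy(2,3)
    by (auto simp: hypL_def)
  with assms(4) show False by simp
qed

text \<open>By signs: in a linear relation between three roots, either one of them is a positive
  combination of the other two, or all coefficients have the same sign, which positivity at
  \<open>p\<close> excludes.\<close>

lemma tri_nonzero:
  assumes "a \<in> P" "b \<in> P" "c \<in> P" "a \<noteq> b" "a \<noteq> c" "b \<noteq> c"
  shows "tri a b c \<noteq> 0"
proof
  assume "tri a b c = 0"
  then obtain u v where a: "a = u *\<^sub>R b + v *\<^sub>R c"
    using tri_zero_combination not_minors_zero assms by metis
  have u0: "u \<noteq> 0"
  proof
    assume "u = 0"
    then have "pairwise_minors_zero a c" unfolding a by (simp add: pairwise_minors_zero_def)
    then show False using not_minors_zero assms by blast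
  qed
  have v0: "v \<noteq> 0"
  proof
    assume "v = 0"
    then have "pairwise_minors_zero a b" unfolding a by (simp add: pairwise_minors_zero_def)
    then show False using not_minors_zero assms by blast
  qed
  consider "u > 0" "v > 0" | "u > 0" "v < 0" | "u < 0" "v > 0" | "u < 0" "v < 0"
    using u0 v0 by linarith
  then show False
  proof cases
    case 1 then show ?thesis using no_positive_combination a assms by blast
  next
    case 2
    have "b = (1/u) *\<^sub>R a + (- v/u) *\<^sub>R c" unfolding a using u0 by (simp add: scaleR_add_right)
    then show ?thesis using no_positive_combination[of b a c "1/u" "-v/u"] 2 assms
      by (simp add: divide_neg_pos)
  next
    case 3
    have "c = (1/v) *\<^sub>R a + (- u/v) *\<^sub>R b" unfolding a using v0 by (simp add: scaleR_add_right)
    then show ?thesis using no_positive_combination[of c a b "1/v" "-u/v"] 3 assms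
      by (simp add: divide_neg_pos)
  next
    case 4
    have "lor p a = u * lor p b + v * lor p c" unfolding a by (simp add: lor_simps)
    moreover have "u * lor p b < 0" "v * lor p c < 0"
      using 4 p_pos assms(2,3) by (auto intro: mult_neg_pos)
    ultimately show ?thesis using p_pos[OF assms(1)] by linarith
  qed
qed

lemma three_roots_through_point:
  assumes "a \<in> P" "b \<in> P" "c \<in> P" "a \<noteq> b" "a \<noteq> c" "lor z a = 0" "lor z b = 0" "lor z c = 0" "z \<noteq> 0"
  shows "b = c"
  using tri_orth_zero[of a b c z] tri_nonzero[of a b c] assms by blast

text \<open>Otherwise \<open>d - d'\<close> would be causal, hence of constant sign on the hyperbolic plane.\<close>
lemma roots_gt:
  assumes "d \<in> P" "d' \<in> P" "d \<noteq> d'"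
  shows "lor d d' > -2"
proof (rule ccontr)
  assume le: "\<not> lor d d' > -2"
  define v where "v = d - d'"
  have vv: "lor v v \<ge> 0" unfolding v_def
    using root assms le by (simp add: lor_simps lor_commute[of d' d])
  have "v \<noteq> 0" using assms by (simp add: v_def)
  then have v1: "v$1 \<noteq> 0" using causal_fst_nonzero vv by blast
  obtain x where x: "x \<in> hypL" "lor x d = 0" "lor x d' \<ge> 0" using side[OF assms(1)] assms by blast
  obtain y where y: "y \<in> hypL" "lor y d' = 0" "lor y d \<ge> 0" using side[OF assms(2)] assms by blast
  have c: "(1 / v$1) *\<^sub>R v \<in> hypL_closure"
    using v1 vv by (simp add: hypL_closure_def lor_simps)
  have "lor x v / v$1 > 0" "lor y v / v$1 > 0"
    using hypL_lor_pos[OF x(1) c] hypL_lor_pos[OF y(1) c] by (simp_all add: lor_simps)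
  moreover have "lor x v \<le> 0" "lor y v \<ge> 0" using x y by (simp_all add: v_def lor_simps)
  ultimately show False
    by (smt (verit) divide_nonneg_neg divide_nonpos_pos divide_nonneg_nonpos divide_nonpos_nonneg)
qed

text \<open>With two vanishing entries the Gram determinant is \<open>2 (b, c)^2 - 8\<close>. It is
  positive by independence, and \<open>roots_gt\<close> decides the sign of
  \<open>(b, c)\<close>.\<close>

lemma orth_common_gt:
  assumes "a \<in> P" "b \<in> P" "c \<in> P" "a \<noteq> b" "a \<noteq> c" "b \<noteq> c" "lor a b = 0" "lor a c = 0"
  shows "lor b c > 2"
proof -
  have "(tri a b c)\<^sup>2 > 0" using tri_nonzero assms by simp
  moreover have "2 * (lor b c)\<^sup>2 - 8 = (tri a b c)\<^sup>2"
    using lor_gram_tri[of a b c] assms root by simp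
  ultimately have "4 < (lor b c)\<^sup>2" by linarith
  then have "2\<^sup>2 < (lor b c)\<^sup>2" by simp
  then have "2 < \<bar>lor b c\<bar>" using power2_less_imp_less[of 2 "\<bar>lor b c\<bar>"] by simp
  then show ?thesis using roots_gt[of b c] assms by simp
qed

text \<open>There is no hyperbolic rectangle: \<open>a + b\<close> and \<open>c + d\<close> would be
  timelike and orthogonal to each other.\<close>

lemma no_orth_quadrilateral:
  assumes "a \<in> P" "b \<in> P" "c \<in> P" "d \<in> P" "a \<noteq> b" "c \<noteq> d" "a \<noteq> c" "a \<noteq> d" "b \<noteq> c" "b \<noteq> d"
    "lor a c = 0" "lor a d = 0" "lor b c = 0" "lor b d = 0"
  shows False
proof -
  have ab: "lor a b > 2" using orth_common_gt[of c a b] assms by (simp add: lor_commute)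
  have cd: "lor c d > 2" using orth_common_gt[of a c d] assms by simp
  have "lor (c + d) (c + d) > 0" using root cd assms by (simp add: lor_simps lor_commute[of d c])
  moreover have "lor (a + b) (a + b) > 0" using root ab assms by (simp add: lor_simps lor_commute[of b a])
  moreover have "lor (a + b) (c + d) = 0" using assms by (simp add: lor_simps)
  moreover have "c + d \<noteq> 0" using calculation(1) by auto
  ultimately show False using orth_causal_nonpos[of "c + d" "a + b"] by simp
qed

text \<open>The common orthogonal \<open>n\<close> makes \<open>(a, b)\<close> nonzero, and a root
  \<open>c\<close> orthogonal to both \<open>a\<close> and \<open>b\<close> would complete a
  rectangle with \<open>n\<close>.\<close>

lemma good_triple_orth:
  assumes "n \<in> P" "a \<in> P" "b \<in> P" "c \<in> P" "n \<noteq> a" "n \<noteq> b" "n \<noteq> c" "a \<noteq> b" "a \<noteq> c" "b \<noteq> c"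
    "lor n a = 0" "lor n b = 0" "lor a b \<le> 62" "lor a c \<le> 62" "lor b c \<le> 62"
  shows "good_triple P"
proof -
  have ab: "lor a b > 2" using orth_common_gt[of n a b] assms by simp
  have "\<not> (lor c a = 0 \<and> lor c b = 0)"
    using no_orth_quadrilateral[of n c a b] assms by auto
  then have "conn3 a b c" using ab unfolding conn3_def by (auto simp: lor_commute)
  then show ?thesis unfolding good_triple_def using assms by blast
qed

section \<open>Adjacent sides\<close>

definition Mbar :: "(real^3) set" where
  "Mbar = {z \<in> hypL_closure. \<forall>c\<in>P. lor z c \<ge> 0}"

text \<open>Adjacency is tested in the closed disc, because consecutive sides may meet at an ideal
  point.\<close>

definition nbr :: "real^3 \<Rightarrow> real^3 \<Rightarrow> bool" where
  "nbr d d' \<longleftrightarrow> d \<in> P \<and> d' \<in> P \<and> d \<noteq> d' \<and> (\<exists>z\<in>Mbar. lor z d = 0 \<and> lor z d' = 0)"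

definition two_nbrs :: "real^3 \<Rightarrow> bool" where
  "two_nbrs d \<longleftrightarrow> (\<exists>a b. a \<noteq> b \<and> (\<forall>x. nbr d x \<longleftrightarrow> x = a \<or> x = b))"

lemma nbr_sym: "nbr d d' \<Longrightarrow> nbr d' d"
  unfolding nbr_def by blast

lemma Mbar_nonzero: "z \<in> Mbar \<Longrightarrow> z \<noteq> 0"
  by (auto simp: Mbar_def hypL_closure_def)

lemma nbr_le: "nbr d d' \<Longrightarrow> \<bar>lor d d'\<bar> \<le> 2"
  unfolding nbr_def
  by (metis (no_types, lifting) common_point_le_two root Mbar_nonzero Mbar_def hypL_closure_def mem_Collect_eq)

lemma two_nbrs_other:
  assumes "two_nbrs d" "nbr d x"
  obtains y where "nbr d y" "y \<noteq> x"
  using assms unfolding two_nbrs_def by metis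

text \<open>At most two sides pass through a point, so \<open>n1\<close> and \<open>n2\<close> are
  the only roots met at \<open>z1\<close> and \<open>z2\<close>; it remains to exclude a neighbour
  that meets \<open>d\<close> at a third point.\<close>

lemma two_nbrsI:
  assumes d: "d \<in> P" and z: "z1 \<in> Mbar" "z2 \<in> Mbar" "z1 \<noteq> z2" "lor z1 d = 0" "lor z2 d = 0"
    and n: "n1 \<in> P" "n2 \<in> P" "n1 \<noteq> d" "n2 \<noteq> d" "lor z1 n1 = 0" "lor z2 n2 = 0"
  shows "two_nbrs d"
proof -
  have fst: "z1$1 = 1" "z2$1 = 1" using z by (auto simp: Mbar_def hypL_closure_def)
  have "n1 \<noteq> n2" using two_points_unique[of d n1 z1 z2] assms fst by metis
  moreover have "nbr d n1" "nbr d n2" using assms unfolding nbr_def by blast+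
  moreover have "x = n1 \<or> x = n2" if "nbr d x" for x
  proof -
    obtain y where y: "y \<in> Mbar" "lor y d = 0" "lor y x = 0" and x: "x \<in> P" "x \<noteq> d"
      using \<open>nbr d x\<close> unfolding nbr_def by blast
    have y1: "y$1 = 1" using y by (auto simp: Mbar_def hypL_closure_def)
    consider "y = z1" | "y = z2" | "y \<noteq> z1" "y \<noteq> z2" by blast
    then show ?thesis
    proof cases
      case 1
      then show ?thesis
        using three_roots_through_point[of d x n1 y] assms x y Mbar_nonzero by metis
    next
      case 2
      then show ?thesis
        using three_roots_through_point[of d x n2 y] assms x y Mbar_nonzero by metis
    next
      case 3
      have "\<not> pairwise_minors_zero d x" using not_minors_zero d x by metis
      text \<open>The three points lie on the line of \<open>d\<close>, and a root vanishing at the middle one is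
        nonnegative at the two others, hence vanishes at all of them.\<close>
      have mid: False if "u \<in> Mbar" "v \<in> Mbar" "m = (1 - t) *\<^sub>R u + t *\<^sub>R v" "0 < t" "t < 1" "c \<in> P" "c \<noteq> d"
        "lor u d = 0" "lor v d = 0" "lor m c = 0" "u \<noteq> v" for u v m t c
      proof -
        have uv: "lor u c \<ge> 0" "lor v c \<ge> 0" "u$1 = 1" "v$1 = 1"
          using that(1,2,6) by (auto simp: Mbar_def hypL_closure_def)
        have "(1 - t) * lor u c + t * lor v c = 0" using that(3,10) by (simp add: lor_simps)
        moreover have "(1 - t) * lor u c \<ge> 0" "t * lor v c \<ge> 0" using uv that(4,5) by auto
        ultimately have "(1 - t) * lor u c = 0" "t * lor v c = 0" by linarith+
        then have "lor u c = 0" "lor v c = 0" using that(4,5) by auto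
        then show False using two_points_unique[of d c u v] that uv d by metis
      qed
      obtain t where t: "y = (1 - t) *\<^sub>R z1 + t *\<^sub>R z2"
      proof -
          have nz: "\<not> (lor (axis 1 1) d = 0 \<and> lor (axis 2 1) d = 0 \<and> lor (axis 3 1) d = 0)"
            using root[OF d] by (auto simp: lor_def axis_def)
          have e: "d$1 = z1$2 * d$2 + z1$3 * d$3" "d$1 = z2$2 * d$2 + z2$3 * d$3" "d$1 = y$2 * d$2 + y$3 * d$3"
            using z y fst y1 by (simp_all add: lor_def)
          have d23: "d$2 \<noteq> 0 \<or> d$3 \<noteq> 0" using e(1) nz by (auto simp: lor_def axis_def)
          have "(y$2 - z1$2) * d$2 + (y$3 - z1$3) * d$3 = 0" "(z2$2 - z1$2) * d$2 + (z2$3 - z1$3) * d$3 = 0"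
            using e by (simp_all add: algebra_simps)
          then have "((y$2 - z1$2) * (z2$3 - z1$3) - (y$3 - z1$3) * (z2$2 - z1$2)) * d$2 = 0"
               "((y$2 - z1$2) * (z2$3 - z1$3) - (y$3 - z1$3) * (z2$2 - z1$2)) * d$3 = 0" by algebra+
          then have c0: "(y$2 - z1$2) * (z2$3 - z1$3) = (y$3 - z1$3) * (z2$2 - z1$2)" using d23 by auto
          have "\<exists>t. y - z1 = t *\<^sub>R (z2 - z1)"
          proof (cases "z2$2 = z1$2")
            case True
            then have "z2$3 \<noteq> z1$3" using z(3) fst by (auto simp: vec3_eq_iff)
            then show ?thesis using c0 True fst y1
              by (intro exI[of _ "(y$3 - z1$3) / (z2$3 - z1$3)"]) (auto simp: vec3_eq_iff)
          next
            case False
            then show ?thesis using c0 fst y1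
              by (intro exI[of _ "(y$2 - z1$2) / (z2$2 - z1$2)"]) (auto simp: vec3_eq_iff eq_divide_eq)
          qed
          then obtain t where "y - z1 = t *\<^sub>R (z2 - z1)" by blast
          then have "y = (1 - t) *\<^sub>R z1 + t *\<^sub>R z2" by (simp add: algebra_simps)
          then show ?thesis using that by blast
      qed
      have t01: "t \<noteq> 0" "t \<noteq> 1" using t 3 by auto
      consider "0 < t" "t < 1" | "t < 0" | "t > 1" using t01 by linarith
      then have False
      proof cases
        case 1
        then show False using mid[of z1 z2 y t x] t x y z by blast
      next
        case 2
        \<comment> \<open>Now \<open>z1\<close> lies between \<open>y\<close> and \<open>z2\<close>,
          with parameter \<open>s\<close>, so \<open>n1\<close> is the root vanishing at the middle
          point.\<close>
        define s where "s = - t / (1 - t)"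
        have s: "0 < s" "s < 1" using 2 by (simp_all add: s_def field_simps)
        have "(1 - s) * (1 - t) = 1" "(1 - s) * t + s = 0"
          using 2 by (simp_all add: s_def field_simps)
        moreover have "(1 - s) *\<^sub>R y + s *\<^sub>R z2 = ((1 - s) * (1 - t)) *\<^sub>R z1 + ((1 - s) * t + s) *\<^sub>R z2"
          unfolding t by (simp add: scaleR_add_right scaleR_add_left)
        ultimately have "z1 = (1 - s) *\<^sub>R y + s *\<^sub>R z2" by simp
        then show False using mid[of y z2 z1 s n1] s 3 y z n by blast
      next
        case 3
        define s where "s = (t - 1) / t"
        have s: "0 < s" "s < 1" using 3 by (simp_all add: s_def field_simps)
        have "(1 - s) * (1 - t) + s = 0" "(1 - s) * t = 1"
          using 3 by (simp_all add: s_def field_simps)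
        moreover have "(1 - s) *\<^sub>R y + s *\<^sub>R z1 = ((1 - s) * (1 - t) + s) *\<^sub>R z1 + ((1 - s) * t) *\<^sub>R z2"
          unfolding t by (simp add: scaleR_add_right scaleR_add_left)
        ultimately have "z2 = (1 - s) *\<^sub>R y + s *\<^sub>R z1" by simp
        then show False using mid[of y z1 z2 s n2] s \<open>y \<noteq> z1\<close> y z n by blast
      qed
      then show ?thesis ..
    qed
  qed
  ultimately show ?thesis unfolding two_nbrs_def by blast
qed

end

subsection \<open>The triple around a root of maximal height\<close>

context side_system
begin

text \<open>The strict inequality keeps two adjacent roots from both being isolated, so skipping a
  root never leads to another one that must be skipped.\<close>

definition isolated :: "(real^3 \<Rightarrow> real) \<Rightarrow> real^3 \<Rightarrow> bool" where
  "isolated h d \<longleftrightarrow> (\<forall>x. nbr d x \<longrightarrow> lor d x = 0 \<and> h x < h d)"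

lemma isolated_nbr: "isolated h d \<Longrightarrow> nbr d x \<Longrightarrow> \<not> isolated h x"
  unfolding isolated_def using nbr_sym by (meson less_asym)

text \<open>Each neighbour of \<open>d\<close> is kept or, if isolated, replaced by the side behind
  it. The resulting \<open>m1\<close> and \<open>m2\<close> form a connected triple with
  \<open>d\<close> unless \<open>d\<close> is orthogonal to both; the second half of the proof
  treats that right-angled case.\<close>

lemma good_triple_of_maximal:
  fixes w :: "real^3" and H :: real
  defines "h \<equiv> \<lambda>d. \<bar>lor d w\<bar>"
  assumes nb: "\<And>d. d \<in> P \<Longrightarrow> h d \<ge> H \<Longrightarrow> two_nbrs d"
    and W: "\<And>d. d \<in> P \<Longrightarrow> h d \<ge> H \<Longrightarrow> 0 < lor w w + (lor d w)\<^sup>2 / 2"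
      "\<And>d. d \<in> P \<Longrightarrow> h d \<ge> H \<Longrightarrow> (lor d w)\<^sup>2 \<le> 5/2 * (lor w w + (lor d w)\<^sup>2 / 2)"
    and d: "d \<in> P" "h d \<ge> H" "\<not> isolated h d" "\<And>x. x \<in> P \<Longrightarrow> \<not> isolated h x \<Longrightarrow> h x \<le> h d"
  shows "good_triple P"
proof -
  have bound: "lor x y \<le> 7 + 5/2 * \<bar>lor c x + lor c y\<bar> + (lor c x + lor c y)\<^sup>2 / 16"
    if "c \<in> P" "x \<in> P" "y \<in> P" "h c \<ge> H" "h x \<le> h c" "h y \<le> h c" for c x y
    using root_product_bound[OF root root root W] that unfolding h_def by blast
  have bound7: "lor x y \<le> 62"
    if "c \<in> P" "x \<in> P" "y \<in> P" "h c \<ge> H" "h x \<le> h c" "h y \<le> h c" "\<bar>lor c x\<bar> \<le> 7" "\<bar>lor c y\<bar> \<le> 7" for c x y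
  proof -
    have a: "\<bar>lor c x + lor c y\<bar> \<le> 14" using that(7,8) by linarith
    then have "(lor c x + lor c y)\<^sup>2 \<le> 14\<^sup>2" by (metis abs_le_square_iff abs_numeral)
    with a bound[OF that(1-6)] show ?thesis by simp
  qed
  have bound0: "lor x y \<le> 7"
    if "c \<in> P" "x \<in> P" "y \<in> P" "h c \<ge> H" "h x \<le> h c" "h y \<le> h c" "lor c x = 0" "lor c y = 0" for c x y
    using bound[OF that(1-6)] that(7,8) by simp
  \<comment> \<open>An isolated neighbour \<open>n\<close> of \<open>a\<close> gives way to its
    other neighbour \<open>m\<close>. Both \<open>a\<close> and \<open>m\<close> are orthogonal to
    \<open>n\<close> and lower than \<open>n\<close>, so the estimate at \<open>n\<close> has no
    cross term and yields 7, while the common orthogonal root forces a product above 2.\<close>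
  have replace: "\<exists>m\<in>P. m \<noteq> a \<and> h m \<le> h a \<and> \<bar>lor a m\<bar> \<le> 7 \<and>
      (m = n \<and> \<not> isolated h n \<or>
       isolated h n \<and> lor n a = 0 \<and> lor n m = 0 \<and> m \<noteq> n \<and> lor a m > 2)"
    if a: "a \<in> P" "h a \<ge> H" "\<not> isolated h a" "\<And>x. x \<in> P \<Longrightarrow> \<not> isolated h x \<Longrightarrow> h x \<le> h a" and n: "nbr a n" for a n
  proof (cases "isolated h n")
    case False
    then show ?thesis using a n nbr_le[OF n] unfolding nbr_def by (intro bexI[of _ n]) auto
  next
    case True
    have nP: "n \<in> P" "n \<noteq> a" using n by (auto simp: nbr_def)
    have na: "lor n a = 0" "h a < h n" using True nbr_sym[OF n] unfolding isolated_def by auto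
    then have "h n \<ge> H" using a by simp
    then obtain m where m: "nbr n m" "m \<noteq> a" using two_nbrs_other[OF nb nbr_sym[OF n]] nP by blast
    have mP: "m \<in> P" "m \<noteq> n" using m by (auto simp: nbr_def)
    have nm: "lor n m = 0" "h m < h n" using True m unfolding isolated_def by auto
    have "h m \<le> h a" using a(4) mP isolated_nbr[OF True m(1)] by blast
    moreover have "lor a m \<le> 7" using bound0[of n a m] nP a mP na nm \<open>h n \<ge> H\<close> by simp
    moreover have "lor a m > 2" using orth_common_gt[of n a m] nP a mP m na nm by auto
    ultimately show ?thesis using True mP m na nm by (intro bexI[of _ m]) auto
  qed
  obtain n1 n2 where n: "n1 \<noteq> n2" "\<And>x. nbr d x \<longleftrightarrow> x = n1 \<or> x = n2"
    using nb[OF d(1,2)] unfolding two_nbrs_def by auto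
  have nP: "n1 \<in> P" "n2 \<in> P" "n1 \<noteq> d" "n2 \<noteq> d" using n(2) by (auto simp: nbr_def)
  have nle: "\<bar>lor d n1\<bar> \<le> 2" "\<bar>lor d n2\<bar> \<le> 2" using nbr_le n(2) by auto
  obtain m1 where m1: "m1 \<in> P" "m1 \<noteq> d" "h m1 \<le> h d" "\<bar>lor d m1\<bar> \<le> 7"
    "m1 = n1 \<and> \<not> isolated h n1 \<or>
       isolated h n1 \<and> lor n1 d = 0 \<and> lor n1 m1 = 0 \<and> m1 \<noteq> n1 \<and> lor d m1 > 2"
    using replace[OF d, of n1] n(2) by auto
  obtain m2 where m2: "m2 \<in> P" "m2 \<noteq> d" "h m2 \<le> h d" "\<bar>lor d m2\<bar> \<le> 7"
    "m2 = n2 \<and> \<not> isolated h n2 \<or>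
       isolated h n2 \<and> lor n2 d = 0 \<and> lor n2 m2 = 0 \<and> m2 \<noteq> n2 \<and> lor d m2 > 2"
    using replace[OF d, of n2] n(2) by auto
  \<comment> \<open>If the two coincided, the product with \<open>d\<close> would be both at most 2
    and above 2, or \<open>n1\<close>, \<open>n2\<close>, \<open>d\<close>, \<open>m1\<close> would
    be a rectangle.\<close>
  have m12: "m1 \<noteq> m2"
  proof
    assume eq: "m1 = m2"
    consider "m1 = n1" "m2 = n2" | "m1 = n1" "lor d m2 > 2" | "m2 = n2" "lor d m1 > 2"
      | "lor n1 d = 0" "lor n1 m1 = 0" "m1 \<noteq> n1" "lor n2 d = 0" "lor n2 m1 = 0" "m1 \<noteq> n2"
      using m1(5) m2(5) eq by blast
    then show False
      using n nle eq no_orth_quadrilateral[of n1 n2 d m1] nP m1 m2 d(1) by cases (auto; fail)+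
  qed
  \<comment> \<open>If \<open>a1\<close> were orthogonal to \<open>d\<close> and \<open>a2\<close>,
    then \<open>(d, a2) > 2\<close>, so \<open>a2\<close> stands behind an isolated
    \<open>b2\<close>; \<open>b1\<close>, \<open>b2\<close>, \<open>d\<close>, \<open>a2\<close>
    would then be a rectangle.\<close>
  have case_b: "\<not> (lor a1 d = 0 \<and> lor a1 a2 = 0)"
    if "b1 \<noteq> b2" "b1 \<in> P" "b2 \<in> P" "b1 \<noteq> d" "b2 \<noteq> d" "\<bar>lor d b2\<bar> \<le> 2" "a1 \<in> P" "a2 \<in> P" "a1 \<noteq> d" "a2 \<noteq> d"
     "a1 = b1 \<and> \<not> isolated h b1 \<or> isolated h b1 \<and> lor b1 d = 0 \<and> lor b1 a1 = 0 \<and> a1 \<noteq> b1 \<and> lor d a1 > 2"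
     "a2 = b2 \<and> \<not> isolated h b2 \<or> isolated h b2 \<and> lor b2 d = 0 \<and> lor b2 a2 = 0 \<and> a2 \<noteq> b2 \<and> lor d a2 > 2"
     "a1 \<noteq> a2"
    for a1 a2 b1 b2
  proof
    assume o: "lor a1 d = 0 \<and> lor a1 a2 = 0"
    then have "lor d a2 > 2" using orth_common_gt[of a1 d a2] that d(1) by auto
    then have b2: "isolated h b2" "lor b2 d = 0" "lor b2 a2 = 0" "a2 \<noteq> b2" using that by auto
    have "a1 = b1" using o that(11) by (auto simp: lor_commute)
    then show False using no_orth_quadrilateral[of b1 b2 d a2] that b2 o d(1) by auto
  qed
  have b1: "\<not> (lor m1 d = 0 \<and> lor m1 m2 = 0)"
    using case_b[of n1 n2 m1 m2] n(1) nP nle m1 m2 m12 by blast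
  have b2: "\<not> (lor m2 d = 0 \<and> lor m2 m1 = 0)"
    using case_b[of n2 n1 m2 m1] n(1) nP nle m1 m2 m12 by (metis (no_types))
  have m12le: "lor m1 m2 \<le> 62" using bound7[of d m1 m2] m1 m2 d by simp
  show ?thesis
  proof (cases "lor d m1 = 0 \<and> lor d m2 = 0")
    case False
    then have "conn3 d m1 m2" using b1 b2 unfolding conn3_def by (auto simp: lor_commute)
    then show ?thesis unfolding good_triple_def using m1 m2 m12 d(1) m12le
      by (intro bexI[of _ d] bexI[of _ m1] bexI[of _ m2]) auto
  next
    case True
    then have N: "m1 = n1" "m2 = n2" "\<not> isolated h n1" "\<not> isolated h n2" "lor d n1 = 0" "lor d n2 = 0"
      using m1(5) m2(5) by auto
    \<comment> \<open>Both neighbours are orthogonal to \<open>d\<close>, and \<open>d\<close> is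
      not isolated, so one of them is at least as high. Being non-isolated it has the same maximal
      height, and the argument restarts there.\<close>
    obtain a b where ab: "{a, b} = {n1, n2}" "h a \<ge> h d"
    proof -
      have "h n1 \<ge> h d \<or> h n2 \<ge> h d"
        using d(3) N n(2) unfolding isolated_def by (metis not_le)
      then show ?thesis using that[of n1 n2] that[of n2 n1] by blast
    qed
    have abn: "nbr d a" "nbr d b" "a \<noteq> b" "\<not> isolated h a" "\<not> isolated h b" "lor d a = 0" "lor d b = 0"
      using ab(1) n N by (auto simp: doubleton_eq_iff)
    have abP: "a \<in> P" "b \<in> P" "a \<noteq> d" "b \<noteq> d" using abn by (auto simp: nbr_def)
    have ha: "h a = h d" using ab(2) d(4)[OF abP(1) abn(4)] by simp
    have hb: "h b \<le> h d" using d(4)[OF abP(2) abn(5)] by simp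
    have a_max: "a \<in> P" "h a \<ge> H" "\<not> isolated h a" "\<And>x. x \<in> P \<Longrightarrow> \<not> isolated h x \<Longrightarrow> h x \<le> h a"
      using abP abn d ha by auto
    obtain q where q: "nbr a q" "q \<noteq> d"
      using two_nbrs_other[OF nb[OF a_max(1,2)] nbr_sym[OF abn(1)]] by blast
    have qP: "q \<in> P" "q \<noteq> a" using q by (auto simp: nbr_def)
    obtain m where m: "m \<in> P" "m \<noteq> a" "h m \<le> h a" "\<bar>lor a m\<bar> \<le> 7"
      "m = q \<and> \<not> isolated h q \<or> isolated h q \<and> lor q a = 0 \<and> lor q m = 0 \<and> m \<noteq> q \<and> lor a m > 2"
      using replace[OF a_max q(1)] by auto
    have ad: "lor a d = 0" using abn by (simp add: lor_commute)
    have md: "m \<noteq> d" using m(5) q ad by auto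
    have mdle: "lor m d \<le> 62"
      using bound7[of a m d] a_max m d ha ad by simp
    show ?thesis
    proof (cases "lor a m = 0")
      case False
      have "\<not> (lor d a = 0 \<and> lor d m = 0)"
      proof
        assume o: "lor d a = 0 \<and> lor d m = 0"
        then have "lor a m > 2" using orth_common_gt[of d a m] d(1) abP m md by auto
        then have "isolated h q" "lor q a = 0" "lor q m = 0" "m \<noteq> q" using m(5) nbr_le[OF q(1)] by auto
        then show False using no_orth_quadrilateral[of q d a m] qP q d(1) abP m md o by auto
      qed
      then have "conn3 a d m" using False unfolding conn3_def by (auto simp: lor_commute)
      then show ?thesis unfolding good_triple_def using m md d(1) mdle abP ad
        by (intro bexI[of _ a] bexI[of _ d] bexI[of _ m]) (auto simp: lor_commute)
    next
      case True
      \<comment> \<open>Now \<open>q\<close>, \<open>a\<close>, \<open>d\<close>, \<open>b\<close>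
        are consecutive sides with right angles at \<open>a\<close> and \<open>d\<close>. The triple
        is \<open>q\<close>, \<open>d\<close>, \<open>b\<close>: the root \<open>a\<close> is
        orthogonal to \<open>q\<close> and \<open>d\<close>, and \<open>(q, b)\<close> is estimated
        at \<open>d\<close>.\<close>
      then have mq: "m = q" "\<not> isolated h q" using m(5) by auto
      have qb: "q \<noteq> b"
      proof
        assume "q = b"
        then have "lor a b > 2" using orth_common_gt[of d a b] abn abP d(1) by auto
        with True mq \<open>q = b\<close> show False by simp
      qed
      have qd: "lor q d \<le> 7" using bound0[of a q d] a_max qP d m ha ad True mq by simp
      have "lor q d > -2" using roots_gt[of q d] qP q d(1) by simp
      then have "\<bar>lor d q\<bar> \<le> 7" using qd by (simp add: lor_commute)
      moreover have "h q \<le> h d" using m mq ha by simp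
      ultimately have "lor q b \<le> 62" using bound7[of d q b] qP abP abn d hb by simp
      then show ?thesis
        using good_triple_orth[of a q d b] abP abn qP q qb d(1) True mq ad qd
        by (auto simp: lor_commute)
    qed
  qed
qed

text \<open>The maximum exists because the heights form a finite set, even when there are infinitely
  many roots.\<close>

lemma good_triple_of_not_isolated:
  fixes w :: "real^3" and H :: real
  defines "h \<equiv> \<lambda>d. \<bar>lor d w\<bar>"
  assumes nb: "\<And>d. d \<in> P \<Longrightarrow> h d \<ge> H \<Longrightarrow> two_nbrs d"
    and W: "\<And>d. d \<in> P \<Longrightarrow> h d \<ge> H \<Longrightarrow> 0 < lor w w + (lor d w)\<^sup>2 / 2"
      "\<And>d. d \<in> P \<Longrightarrow> h d \<ge> H \<Longrightarrow> (lor d w)\<^sup>2 \<le> 5/2 * (lor w w + (lor d w)\<^sup>2 / 2)"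
    and fin: "finite (h ` P)"
    and d: "d \<in> P" "h d \<ge> H" "\<not> isolated h d"
  shows "good_triple P"
proof -
  define S where "S = {x \<in> P. \<not> isolated h x}"
  have f: "finite (h ` S)" using fin finite_subset[of "h ` S" "h ` P"] by (auto simp: S_def)
  have ne: "d \<in> S" using d by (simp add: S_def)
  have "Max (h ` S) \<in> h ` S" using f ne by (intro Max_in) auto
  then obtain m where m: "m \<in> S" "h m = Max (h ` S)" by auto
  have max: "h x \<le> h m" if "x \<in> S" for x using f that m by simp
  have mP: "m \<in> P" "\<not> isolated h m" using m by (auto simp: S_def)
  have mH: "h m \<ge> H" using max[OF ne] d by simp
  have mx: "h x \<le> h m" if "x \<in> P" "\<not> isolated h x" for x
    using max that by (simp add: S_def)
  show ?thesis
    by (rule good_triple_of_maximal[of H w m, OF nb[unfolded h_def] W[unfolded h_def]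
          mP(1) mH[unfolded h_def] mP(2)[unfolded h_def] mx[unfolded h_def]])
qed

end

subsection \<open>Polytopes in the closed disc\<close>

text \<open>A side functional cannot vanish at an interior point: push the point in direction \<open>(0, d\<^sub>2, d\<^sub>3)\<close>.\<close>
lemma interior_point_lor_pos:
  assumes p: "p$1 = 1" "\<epsilon> > 0" "\<And>y. y$1 = 1 \<Longrightarrow> dist y p < \<epsilon> \<Longrightarrow> lor y d \<ge> 0" and d: "lor d d < 0"
  shows "lor p d > 0"
proof -
  define v :: "real^3" where "v = (\<chi> i. if i = 1 then 0 else d$i)"
  have v: "v$1 = 0" "v$2 = d$2" "v$3 = d$3" by (simp_all add: v_def)
  have "(d$2)\<^sup>2 + (d$3)\<^sup>2 > 0"
    using d zero_le_power2[of "d$1"] unfolding lor_def power2_eq_square by linarith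
  then have lv: "lor v d < 0" by (simp add: lor_def v power2_eq_square)
  define s where "s = \<epsilon> / (2 * (norm v + 1))"
  have s: "s > 0" "s * norm v < \<epsilon>"
    using p(2) by (auto simp: s_def field_simps add_pos_nonneg intro: add_nonneg_pos)
  have "lor (p + s *\<^sub>R v) d \<ge> 0"
    using s p(1,2) v by (intro p(3)) (auto simp: dist_norm)
  then have "lor p d \<ge> - s * lor v d" by (simp add: lor_simps)
  moreover have "- s * lor v d > 0" using s(1) lv by (simp add: mult_pos_neg)
  ultimately show ?thesis by linarith
qed

text \<open>\<open>Q\<close> lies in the plane \<open>x$1 = 1\<close> of \<open>real^3\<close>, so
  it is two-dimensional and its interior is relative; \<open>ball\<close> makes \<open>p\<close> a
  relative interior point.\<close>

locale disc_polytope =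
  fixes Q :: "(real^3) set" and p :: "real^3" and \<epsilon> :: real
  assumes poly: "polytope Q"
    and sub: "Q \<subseteq> hypL_closure"
    and p1: "p$1 = 1"
    and eps: "\<epsilon> > 0"
    and ball: "\<And>y. y$1 = 1 \<Longrightarrow> dist y p < \<epsilon> \<Longrightarrow> y \<in> Q"
begin

lemma p_in: "p \<in> Q"
  using ball[of p] p1 eps by simp

lemma fst_Q: "x \<in> Q \<Longrightarrow> x$1 = 1"
  using sub by (auto simp: hypL_closure_def)

lemma affine_plane: "affine {x::real^3. x$1 = 1}"
  using affine_hyperplane[of "axis 1 1 :: real^3" 1] by (simp add: inner_axis')

lemma affine_hull_Q: "affine hull Q = {x. x$1 = 1}"
proof
  show "affine hull Q \<subseteq> {x. x$1 = 1}"
    using fst_Q by (intro hull_minimal affine_plane) auto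
  show "{x. x$1 = 1} \<subseteq> affine hull Q"
  proof
    fix x :: "real^3" assume "x \<in> {x. x$1 = 1}"
    then have x: "x$1 = 1" by simp
    define s where "s = \<epsilon> / (2 * (norm (x - p) + 1))"
    have s: "s > 0" "s * norm (x - p) < \<epsilon>"
      using eps by (auto simp: s_def field_simps add_pos_nonneg intro: add_nonneg_pos)
    define y where "y = p + s *\<^sub>R (x - p)"
    have "y \<in> Q" using s x p1 by (intro ball) (auto simp: y_def dist_norm)
    then have "(1 - 1/s) *\<^sub>R p + (1/s) *\<^sub>R y \<in> affine hull Q"
      using p_in by (intro mem_affine[OF affine_affine_hull]) (auto simp: hull_inc)
    moreover have "(1 - 1/s) *\<^sub>R p + (1/s) *\<^sub>R y = x"
      using s by (simp add: y_def algebra_simps)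
    ultimately show "x \<in> affine hull Q" by simp
  qed
qed

lemma p_rel_interior: "p \<in> rel_interior Q"
  unfolding mem_rel_interior_ball affine_hull_Q
  using p_in eps ball by (auto simp: dist_commute intro!: exI[of _ \<epsilon>])

lemma aff_dim_Q: "aff_dim Q = 2"
proof -
  have "aff_dim {x::real^3. axis 1 1 \<bullet> x = 1} = DIM(real^3) - 1"
    by (rule aff_dim_hyperplane) simp
  then have "aff_dim {x::real^3. x$1 = 1} = 2" by (simp add: inner_axis')
  then show ?thesis using aff_dim_affine_hull[of Q] unfolding affine_hull_Q by simp
qed

lemma facet_root:
  assumes c: "c facet_of Q"
  obtains d u v where "lor d d = -2" "\<And>x. x \<in> Q \<Longrightarrow> lor x d \<ge> 0" "c = {x \<in> Q. lor x d = 0}"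
    "u \<in> c" "v \<in> c" "u \<noteq> v"
proof -
  have "c exposed_face_of Q"
    using exposed_face_of_polyhedron[OF polytope_imp_polyhedron[OF poly]] c facet_of_imp_face_of by blast
  then obtain a b where ab: "Q \<subseteq> {x. a \<bullet> x \<le> b}" "c = Q \<inter> {x. a \<bullet> x = b}"
    unfolding exposed_face_of_def by blast
  \<comment> \<open>On the plane \<open>x$1 = 1\<close> the constant \<open>b\<close> can be
    absorbed into the first coordinate, so the affine function \<open>b - a \<bullet> x\<close>
    becomes a product with a vector.\<close>
  define d0 :: "real^3" where "d0 = (\<chi> i. if i = 1 then b - a$1 else a$i)"
  have d0: "lor x d0 = b - a \<bullet> x" if "x \<in> Q" for x
    using fst_Q[OF that] by (simp add: lor_def d0_def inner_vec_def sum_3 algebra_simps)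
  have c0: "c = {x \<in> Q. lor x d0 = 0}" using ab(2) d0 by auto
  have cdim: "aff_dim c = 1" using c aff_dim_Q by (simp add: facet_of_def)
  have "c \<noteq> {}" using c by (simp add: facet_of_def)
  then obtain u where u: "u \<in> c" by blast
  have "c \<noteq> {u}" using cdim by auto
  then obtain v where v: "v \<in> c" "u \<noteq> v" using u by blast
  have "c \<noteq> Q" using cdim aff_dim_Q by auto
  then have "d0 \<noteq> 0" using c0 by auto
  have uvQ: "u \<in> Q" "v \<in> Q" using u v c0 by auto
  \<comment> \<open>The midpoint of \<open>u\<close> and \<open>v\<close> is a timelike vector
    orthogonal to \<open>d0\<close>. Hence \<open>d0\<close> is spacelike and can be rescaled to
    square -2.\<close>
  have "(1 - 1/2) *\<^sub>R u + (1/2) *\<^sub>R v \<in> hypL"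
    using uvQ sub v by (intro segment_in_hypL) auto
  moreover have "lor d0 ((1 - 1/2) *\<^sub>R u + (1/2) *\<^sub>R v) = 0"
    using u v c0 by (simp add: lor_simps lor_commute[of d0])
  ultimately have neg: "lor d0 d0 < 0"
    using orth_timelike_neg[of "(1 - 1/2) *\<^sub>R u + (1/2) *\<^sub>R v" d0] \<open>d0 \<noteq> 0\<close> by (auto simp: hypL_def)
  define k where "k = sqrt (2 / (- lor d0 d0))"
  have k: "k > 0" "k\<^sup>2 = 2 / (- lor d0 d0)" using neg by (simp_all add: k_def divide_pos_neg)
  show ?thesis
  proof (rule that[of "k *\<^sub>R d0" u v])
    show "lor (k *\<^sub>R d0) (k *\<^sub>R d0) = -2"
      using k(2) neg by (simp add: lor_simps power2_eq_square field_simps)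
    show "lor x (k *\<^sub>R d0) \<ge> 0" if "x \<in> Q" for x
      using d0[OF that] ab(1) that k(1) by (auto simp: lor_simps)
    show "c = {x \<in> Q. lor x (k *\<^sub>R d0) = 0}" using c0 k(1) by (simp add: lor_simps)
  qed (use u v in auto)
qed

lemma exit_facet:
  assumes "x$1 = 1" "x \<notin> Q"
  obtains t c where "0 < t" "t < 1" "c facet_of Q" "(1 - t) *\<^sub>R p + t *\<^sub>R x \<in> c"
proof -
  have "bounded Q" using poly polytope_imp_bounded by blast
  moreover have "p + (x - p) \<in> affine hull Q" using assms(1) by (simp add: affine_hull_Q)
  moreover have "x - p \<noteq> 0" using assms(2) p_in by auto
  ultimately obtain t where t: "0 < t" "p + t *\<^sub>R (x - p) \<in> rel_frontier Q"
    "\<And>e. 0 \<le> e \<Longrightarrow> e < t \<Longrightarrow> p + e *\<^sub>R (x - p) \<in> rel_interior Q"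
    using ray_to_rel_frontier[OF _ p_rel_interior] by blast
  have cl: "closed Q" using poly polytope_imp_closed by blast
  have "t < 1"
  proof (rule ccontr)
    assume "\<not> t < 1"
    then consider "t = 1" | "t > 1" by linarith
    then have "x \<in> Q"
    proof cases
      case 1
      then have "x \<in> rel_frontier Q" using t(2) by simp
      then show ?thesis using cl by (simp add: rel_frontier_def)
    next
      case 2
      then have "x \<in> rel_interior Q" using t(3)[of 1] by simp
      then show ?thesis using rel_interior_subset by blast
    qed
    with assms(2) show False by simp
  qed
  moreover obtain c where "c facet_of Q" "p + t *\<^sub>R (x - p) \<in> c"
    using t(2) rel_frontier_of_polyhedron[OF polytope_imp_polyhedron[OF poly]] by auto
  moreover have "p + t *\<^sub>R (x - p) = (1 - t) *\<^sub>R p + t *\<^sub>R x" by (simp add: algebra_simps)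
  ultimately show ?thesis using that t(1) by metis
qed

lemma vertex_facet:
  assumes "z extreme_point_of Q" "v \<in> Q" "v \<noteq> z"
  obtains c where "c facet_of Q" "z \<in> c" "v \<notin> c"
proof -
  have "{z} face_of Q" using assms(1) by (simp add: face_of_singleton)
  moreover have "{z} \<noteq> Q" using assms by auto
  ultimately have "{z} = \<Inter>{F. F facet_of Q \<and> {z} \<subseteq> F}"
    using face_of_polyhedron[OF polytope_imp_polyhedron[OF poly]] by blast
  then have "v \<notin> \<Inter>{F. F facet_of Q \<and> {z} \<subseteq> F}" using assms(3) by auto
  then show ?thesis using that by auto
qed

text \<open>The boundary circle of the disc contains no segment.\<close>

lemma null_extreme_point:
  assumes "z \<in> Q" "lor z z = 0"
  shows "z extreme_point_of Q"
  unfolding extreme_point_of_def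
proof (intro conjI ballI notI)
  fix a b assume ab: "a \<in> Q" "b \<in> Q" "z \<in> open_segment a b"
  then obtain u where "a \<noteq> b" "0 < u" "u < 1" "z = (1 - u) *\<^sub>R a + u *\<^sub>R b"
    by (auto simp: in_segment)
  then have "z \<in> hypL" using segment_in_hypL[of a b u] ab sub by auto
  with assms(2) show False by (simp add: hypL_def)
qed (use assms in auto)

text \<open>A face is the hull of its vertices, so a functional \<open>k\<close> positive at all of
  them would be positive at \<open>x\<close>. The choice of \<open>k\<close> later selects the
  endpoint of a side that stays close to an end of the axis.\<close>

lemma side_vertices:
  assumes "\<And>x. x \<in> Q \<Longrightarrow> lor x d \<ge> 0" "x \<in> Q" "y \<in> Q" "x \<noteq> y" "lor x d = 0" "lor y d = 0"
    and k: "lor x k \<le> 0"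
  obtains z1 z2 where "z1 \<noteq> z2" "z1 extreme_point_of Q" "z2 extreme_point_of Q"
    "lor z1 d = 0" "lor z2 d = 0" "lor z1 k \<le> 0"
proof -
  define a :: "real^3" where "a = (\<chi> i. if i = 1 then d$1 else - d$i)"
  have a: "a \<bullet> x = lor x d" for x
    by (simp add: a_def lor_def inner_vec_def sum_3 algebra_simps)
  define f where "f = Q \<inter> {x. a \<bullet> x = 0}"
  have f: "f face_of Q" unfolding f_def
    using polytope_imp_convex[OF poly] assms(1) by (intro face_of_Int_supporting_hyperplane_ge) (auto simp: a)
  then have "compact f" "convex f"
    using face_of_imp_compact face_of_imp_convex polytope_imp_convex polytope_imp_compact poly by blast+
  then have hull: "f = convex hull {x. x extreme_point_of f}" by (rule Krein_Milman_Minkowski)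
  have xy: "x \<in> f" "y \<in> f" using assms by (auto simp: f_def a)
  obtain z1 where z1: "z1 extreme_point_of f" "lor z1 k \<le> 0"
  proof (rule ccontr)
    assume "\<not> thesis"
    then have "{x. x extreme_point_of f} \<subseteq> {x. lor x k > 0}" using that by force
    moreover have "convex {x. lor x k > 0}"
      unfolding convex_alt
    proof (intro ballI allI impI)
      fix u v :: "real^3" and t :: real
      assume *: "u \<in> {x. lor x k > 0}" "v \<in> {x. lor x k > 0}" "0 \<le> t \<and> t \<le> 1"
      then have "(1 - t) * lor u k \<ge> 0" "t * lor v k \<ge> 0" "(1 - t) * lor u k > 0 \<or> t * lor v k > 0"
        by (auto simp: zero_less_mult_iff)
      then show "(1 - t) *\<^sub>R u + t *\<^sub>R v \<in> {x. lor x k > 0}" by (simp add: lor_simps) linarith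
    qed
    ultimately have "f \<subseteq> {x. lor x k > 0}" using hull hull_minimal by metis
    with xy k show False by auto
  qed
  obtain z2 where z2: "z2 extreme_point_of f" "z2 \<noteq> z1"
  proof (rule ccontr)
    assume "\<not> thesis"
    then have "{x. x extreme_point_of f} = {z1}" using that z1 by blast
    then have "f = {z1}" using hull by (metis convex_hull_singleton)
    with xy assms(4) show False by auto
  qed
  note z = z1(1) z2(1)
  from z have "z1 extreme_point_of Q" "z2 extreme_point_of Q" "z1 \<in> f" "z2 \<in> f"
    using extreme_point_of_face[OF f] by auto
  then show ?thesis using that[of z1 z2] z1 z2 by (auto simp: f_def a)
qed

end

subsection \<open>Coordinates along the axis\<close>

text \<open>The two ends of the axis \<open>e\<^sup>\<bottom>\<close>, rescaled to have product 1.\<close>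
locale axis_frame =
  fixes e c1 c2 :: "real^3"
  assumes ee: "lor e e = -2"
    and null: "lor c1 c1 = 0" "lor c2 c2 = 0"
    and c12: "lor c1 c2 = 1"
    and c_pos: "c1$1 > 0" "c2$1 > 0"
    and c_orth: "lor c1 e = 0" "lor c2 e = 0"

lemma axis_frame_exists:
  assumes "lor e e = -2"
  obtains c1 c2 where "axis_frame e c1 c2"
proof -
  define R where "R = 2 + (e$1)\<^sup>2"
  have R: "R > 0" by (simp add: R_def add_pos_nonneg)
  have eR: "(e$2)\<^sup>2 + (e$3)\<^sup>2 = R" using assms by (simp add: R_def lor_def power2_eq_square)
  \<comment> \<open>\<open>n s\<close> runs through the line of \<open>e\<close> in the plane
    \<open>x$1 = 1\<close>, starting at the point nearest to the centre of the disc. It is null for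
    \<open>s^2 = 2\<close>, and the two null points have product \<open>4 / R\<close>, which
    explains the factor \<open>R/4\<close> below.\<close>
  define n :: "real \<Rightarrow> real^3" where
    "n s = (\<chi> i. if i = 1 then 1 else if i = 2 then (e$1 * e$2 - s * e$3) / R else (e$1 * e$3 + s * e$2) / R)" for s
  have n: "n s $ 1 = 1" "n s $ 2 = (e$1 * e$2 - s * e$3) / R" "n s $ 3 = (e$1 * e$3 + s * e$2) / R" for s
    by (simp_all add: n_def)
  have prod: "R\<^sup>2 * lor (n s) (n t) = R\<^sup>2 - ((e$1)\<^sup>2 + s * t) * R" for s t
  proof -
    have "R\<^sup>2 * lor (n s) (n t) = R\<^sup>2 - (e$1 * e$2 - s * e$3) * (e$1 * e$2 - t * e$3)
       - (e$1 * e$3 + s * e$2) * (e$1 * e$3 + t * e$2)"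
      using R by (simp add: lor_def n power2_eq_square field_simps)
    also have "\<dots> = R\<^sup>2 - ((e$1)\<^sup>2 + s * t) * ((e$2)\<^sup>2 + (e$3)\<^sup>2)"
      by (simp add: power2_eq_square algebra_simps)
    finally show ?thesis by (simp add: eR)
  qed
  have orth: "lor (n s) e = 0" for s
  proof -
    have "R * lor (n s) e = R * e$1 - e$1 * ((e$2)\<^sup>2 + (e$3)\<^sup>2)"
      using R by (simp add: lor_def n power2_eq_square field_simps)
    then show ?thesis using R by (simp add: eR)
  qed
  define q where "q = sqrt 2"
  have q: "q * q = 2" by (simp add: q_def)
  have e1: "(e$1)\<^sup>2 = R - 2" by (simp add: R_def)
  have nn: "lor (n q) (n q) = 0" "lor (n (-q)) (n (-q)) = 0"
  proof -
    have "(e$1)\<^sup>2 + q * q = R" "(e$1)\<^sup>2 + (- q) * (- q) = R" using e1 q by simp_all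
    then have "R\<^sup>2 * lor (n q) (n q) = 0" "R\<^sup>2 * lor (n (-q)) (n (-q)) = 0"
      using prod[of q q] prod[of "-q" "-q"] by (simp_all add: power2_eq_square)
    then show "lor (n q) (n q) = 0" "lor (n (-q)) (n (-q)) = 0" using R by auto
  qed
  have "(e$1)\<^sup>2 + q * (- q) = R - 4" using e1 q by simp
  with prod[of q "-q"] have "R\<^sup>2 * lor (n q) (n (-q)) = R\<^sup>2 - (R - 4) * R" by (simp only:)
  then have "R\<^sup>2 * lor (n q) (n (-q)) = 4 * R" by (simp add: power2_eq_square algebra_simps)
  then have np: "lor (n q) (n (-q)) = 4 / R" using R by (simp add: power2_eq_square field_simps)
  have "axis_frame e (n q) ((R/4) *\<^sub>R n (-q))"
    using assms nn np orth R n(1) by unfold_locales (simp_all add: lor_simps)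
  then show ?thesis by (rule that)
qed

context axis_frame
begin

lemma swap: "axis_frame e c2 c1"
  using ee null c12 c_pos c_orth by unfold_locales (simp_all add: lor_commute)

lemma lor_frame: "lor x y = lor x c1 * lor y c2 + lor x c2 * lor y c1 - lor x e * lor y e / 2"
proof -
  have t: "tri c1 c2 e \<noteq> 0"
    using lor_gram_tri[of c1 c2 e] null c12 c_orth ee by auto
  define s where "s = x - lor x c2 *\<^sub>R c1 - lor x c1 *\<^sub>R c2 + (lor x e / 2) *\<^sub>R e"
  have "s = 0"
    by (rule tri_orth_zero[OF t])
      (simp_all add: s_def lor_simps null c12 c_orth ee lor_commute[of c2 c1] lor_commute[of e c1] lor_commute[of e c2])
  then have "lor s y = 0" by simp
  then show ?thesis unfolding s_def by (simp add: lor_simps lor_commute[of _ y] algebra_simps)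
qed

lemma frame_nonneg:
  assumes "x \<in> hypL_closure"
  shows "lor x c1 \<ge> 0" "lor x c2 \<ge> 0" "(lor x e)\<^sup>2 \<le> 4 * lor x c1 * lor x c2"
proof -
  have "(1 / c1$1) *\<^sub>R c1 \<in> hypL_closure" "(1 / c2$1) *\<^sub>R c2 \<in> hypL_closure"
    using c_pos null by (simp_all add: hypL_closure_def lor_simps)
  from closure_lor_nonneg[OF assms this(1)] closure_lor_nonneg[OF assms this(2)]
  show "lor x c1 \<ge> 0" "lor x c2 \<ge> 0" using c_pos by (simp_all add: lor_simps zero_le_divide_iff)
  show "(lor x e)\<^sup>2 \<le> 4 * lor x c1 * lor x c2"
    using lor_frame[of x x] assms by (simp add: hypL_closure_def power2_eq_square)
qed

lemma frame_pos_if_not_end: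
  assumes "x \<in> hypL_closure" "lor c1 d \<noteq> 0" "lor c2 d \<noteq> 0" "lor x d = 0"
  shows "lor x c1 > 0" "lor x c2 > 0"
proof -
  have n: "(1 / c1$1) *\<^sub>R c1 \<in> hypL_closure" "(1 / c2$1) *\<^sub>R c2 \<in> hypL_closure"
    using c_pos null by (simp_all add: hypL_closure_def lor_simps)
  have "x \<noteq> (1 / c1$1) *\<^sub>R c1" "x \<noteq> (1 / c2$1) *\<^sub>R c2"
    using assms c_pos by (auto simp: lor_simps)
  then have "lor x ((1 / c1$1) *\<^sub>R c1) > 0" "lor x ((1 / c2$1) *\<^sub>R c2) > 0"
    using closure_lor_pos assms(1) n by blast+
  then show "lor x c1 > 0" "lor x c2 > 0" using c_pos by (simp_all add: lor_simps zero_less_divide_iff)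
qed

lemma frame_pos_hypL:
  assumes "x \<in> hypL"
  shows "lor x c1 > 0" "lor x c2 > 0"
proof -
  have n: "(1 / c1$1) *\<^sub>R c1 \<in> hypL_closure" "(1 / c2$1) *\<^sub>R c2 \<in> hypL_closure"
    using c_pos null by (simp_all add: hypL_closure_def lor_simps)
  show "lor x c1 > 0" "lor x c2 > 0"
    using hypL_lor_pos[OF assms n(1)] hypL_lor_pos[OF assms n(2)] c_pos
    by (simp_all add: lor_simps zero_less_divide_iff)
qed

text \<open>The quotient \<open>lor x c1 / lor x c2\<close> is constant along each line orthogonal
  to the axis; it tends to 0 at the end \<open>c1\<close> and to infinity at
  \<open>c2\<close>.\<close>

definition strip :: "real \<Rightarrow> real \<Rightarrow> (real^3) set" where
  "strip r s = {x \<in> hypL. r * lor x c2 \<le> lor x c1 \<and> lor x c1 \<le> s * lor x c2}"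

text \<open>The point of the axis with quotient \<open>r\<close>, for \<open>r > 0\<close>.\<close>

definition foot :: "real \<Rightarrow> real^3" where
  "foot r = (1 / (c1$1 + r * c2$1)) *\<^sub>R (c1 + r *\<^sub>R c2)"

lemma foot_denominator: "r > 0 \<Longrightarrow> c1$1 + r * c2$1 > 0"
  using c_pos by (simp add: add_pos_pos)

lemma foot_frame:
  assumes "r > 0"
  shows "lor (foot r) c1 = r / (c1$1 + r * c2$1)" "lor (foot r) c2 = 1 / (c1$1 + r * c2$1)"
    "lor (foot r) e = 0"
  using null c12 c_orth by (simp_all add: foot_def lor_simps lor_commute[of c2 c1])

lemma foot_hline:
  assumes "r > 0"
  shows "foot r \<in> hline e"
proof -
  have "foot r $ 1 = 1" using foot_denominator[OF assms] by (simp add: foot_def)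
  moreover have "lor (foot r) (foot r) > 0"
    unfolding lor_frame[of "foot r" "foot r"] foot_frame[OF assms]
    using foot_denominator[OF assms] assms by simp
  ultimately show ?thesis using foot_frame[OF assms] by (simp add: hline_def hypL_def)
qed

text \<open>A normal orthogonal to \<open>e\<close> and to a point of the plane is determined up to
  a factor by the quotient of that point, so \<open>x\<close> and \<open>p\<close> lie on a common
  line orthogonal to the axis exactly when their quotients agree.\<close>

lemma strip_eq_orth_strip:
  assumes "0 < r" "r < s"
  shows "orth_strip e (closed_segment (foot r) (foot s)) = strip r s"
proof (rule set_eqI)
  fix x
  have s0: "0 < s" using assms by simp
  define k l where kl: "k = c1$1 + r * c2$1" "l = c1$1 + s * c2$1"
  have kl0: "k > 0" "l > 0" unfolding kl using foot_denominator assms(1) s0 by auto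
  show "x \<in> orth_strip e (closed_segment (foot r) (foot s)) \<longleftrightarrow> x \<in> strip r s"
  proof
    assume "x \<in> orth_strip e (closed_segment (foot r) (foot s))"
    then obtain p f where x: "x \<in> hypL" and p: "p \<in> closed_segment (foot r) (foot s)"
      and f: "lor f f < 0" "lor f e = 0" "lor f p = 0" "lor f x = 0"
      unfolding orth_strip_def by blast
    obtain t where t: "p = (1 - t) *\<^sub>R foot r + t *\<^sub>R foot s" "0 \<le> t" "t \<le> 1"
      using p by (auto simp: in_segment)
    define X1 X2 P1 P2 F1 F2 where D: "X1 = lor x c1" "X2 = lor x c2" "P1 = lor p c1" "P2 = lor p c2"
      "F1 = lor f c1" "F2 = lor f c2"
    have pe: "P1 = (1 - t) * r / k + t * s / l" "P2 = (1 - t) / k + t / l"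
      unfolding D t(1) using foot_frame[OF assms(1)] foot_frame[OF s0] by (simp_all add: lor_simps kl)
    have "(1 - t) / k \<ge> 0" "t / l \<ge> 0" "(1 - t) / k > 0 \<or> t / l > 0"
      using kl0 t by (auto simp: zero_less_divide_iff)
    then have P2: "P2 > 0" unfolding pe by linarith
    have rP: "r * P2 \<le> P1" "P1 \<le> s * P2"
    proof -
      have "r * (t / l) \<le> s * (t / l)" "r * ((1 - t) / k) \<le> s * ((1 - t) / k)"
        using assms t kl0 by (intro mult_right_mono; simp)+
      then show "r * P2 \<le> P1" "P1 \<le> s * P2" unfolding pe by (simp_all add: algebra_simps)
    qed
    have "F1 * P2 + F2 * P1 = 0" "F1 * X2 + F2 * X1 = 0" "2 * F1 * F2 < 0"
      using f lor_frame[of f p] lor_frame[of f x] lor_frame[of f f] by (simp_all add: D)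
    then have F: "F2 \<noteq> 0" and "F2 * (X1 * P2) = F2 * (P1 * X2)" by auto algebra
    then have eq: "X1 * P2 = P1 * X2" by simp
    have X: "X1 > 0" "X2 > 0" using frame_pos_hypL[OF x] by (simp_all add: D)
    have "r * X2 * P2 \<le> X1 * P2" "X1 * P2 \<le> s * X2 * P2"
      using mult_right_mono[OF rP(1), of X2] mult_right_mono[OF rP(2), of X2] X eq
      by (simp_all add: mult_ac)
    then have "r * X2 \<le> X1" "X1 \<le> s * X2" using P2 by simp_all
    then show "x \<in> strip r s" using x by (simp add: strip_def D)
  next
    assume "x \<in> strip r s"
    then have x: "x \<in> hypL" "r * lor x c2 \<le> lor x c1" "lor x c1 \<le> s * lor x c2" by (auto simp: strip_def)
    have X: "lor x c1 > 0" "lor x c2 > 0" using frame_pos_hypL[OF x(1)] .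
    define m where "m = lor x c1 / lor x c2"
    have m: "r \<le> m" "m \<le> s" "lor x c1 = m * lor x c2" using x X by (simp_all add: m_def field_simps)
    have m0: "m > 0" using m assms by simp
    define u where "u = (m - r) / (s - r)"
    have "u * (s - r) = m - r" using assms by (simp add: u_def)
    then have "m = (1 - u) * r + u * s" by (simp add: algebra_simps)
    moreover have "0 \<le> u" "u \<le> 1" using m assms by (simp_all add: u_def)
    ultimately have u: "0 \<le> u" "u \<le> 1" "m = (1 - u) * r + u * s" by simp_all
    define q where "q = c1$1 + m * c2$1"
    have q: "q > 0" "q = (1 - u) * k + u * l" using foot_denominator[OF m0]
      by (simp_all add: q_def kl u(3) algebra_simps)
    \<comment> \<open>The quotient \<open>m\<close> is the mean of \<open>r\<close> and
      \<open>s\<close> with weight \<open>u\<close>; passing to points with first coordinate 1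
      changes the weights by the denominators \<open>k\<close>, \<open>l\<close>,
      \<open>q\<close>.\<close>
    define t where "t = u * l / q"
    have "(1 - u) * k \<ge> 0" using u kl0 by simp
    then have t: "0 \<le> t" "t \<le> 1" using u kl0 q by (simp_all add: t_def)
    have t1: "1 - t = (1 - u) * k / q" using q by (simp add: t_def field_simps)
    have "(1 - t) *\<^sub>R foot r = ((1 - u) / q) *\<^sub>R (c1 + r *\<^sub>R c2)"
      unfolding t1 foot_def kl(1)[symmetric] using kl0 by simp
    moreover have "t *\<^sub>R foot s = (u / q) *\<^sub>R (c1 + s *\<^sub>R c2)"
      unfolding t_def foot_def kl(2)[symmetric] using kl0 by simp
    moreover have "foot m = (1 / q) *\<^sub>R (c1 + m *\<^sub>R c2)" by (simp add: foot_def q_def)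
    moreover have "((1 - u) / q) *\<^sub>R (c1 + r *\<^sub>R c2) + (u / q) *\<^sub>R (c1 + s *\<^sub>R c2)
        = (1 / q) *\<^sub>R (c1 + ((1 - u) * r + u * s) *\<^sub>R c2)"
      by (simp add: algebra_simps add_divide_distrib diff_divide_distrib)
    ultimately have "foot m = (1 - t) *\<^sub>R foot r + t *\<^sub>R foot s"
      using u(3) by metis
    then have "foot m \<in> closed_segment (foot r) (foot s)" using t by (auto simp: in_segment)
    moreover have "lor (c1 - m *\<^sub>R c2) (c1 - m *\<^sub>R c2) < 0"
      using m0 null c12 by (simp add: lor_simps lor_commute[of c2 c1])
    moreover have "lor (c1 - m *\<^sub>R c2) e = 0" using c_orth by (simp add: lor_simps)
    moreover have "lor (c1 - m *\<^sub>R c2) x = 0" using m(3) by (simp add: lor_simps lor_commute[of _ x])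
    moreover have "lor (c1 - m *\<^sub>R c2) (foot m) = 0"
      using null c12 by (simp add: foot_def lor_simps lor_commute[of c2 c1])
    ultimately show "x \<in> orth_strip e (closed_segment (foot r) (foot s))"
      using x(1) unfolding orth_strip_def by blast
  qed
qed

end

subsection \<open>Strips orthogonal to the axis\<close>

lemma linear_pos_near_start:
  fixes a b :: real
  assumes "a > 0"
  obtains \<tau> where "0 < \<tau>" "\<tau> < 1" "\<And>t. 0 \<le> t \<Longrightarrow> t \<le> \<tau> \<Longrightarrow> (1 - t) * a + t * b > 0"
proof -
  define S where "S = a + \<bar>b\<bar>"
  define \<tau> where "\<tau> = a / (2 * S)"
  have s: "S > 0" "a \<le> S" using assms by (auto simp: S_def)
  have 1: "0 < \<tau>" "\<tau> < 1" using assms s by (simp_all add: \<tau>_def field_simps)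
  have "(1 - t) * a + t * b > 0" if "0 \<le> t" "t \<le> \<tau>" for t
  proof -
    have "t * S \<le> \<tau> * S" using that s by (intro mult_right_mono) auto
    also have "\<dots> = a / 2" using s by (simp add: \<tau>_def)
    finally have "t * a + t * \<bar>b\<bar> < a" using assms by (simp add: S_def algebra_simps)
    moreover have "t * b \<ge> - (t * \<bar>b\<bar>)" using that(1) by (metis abs_le_D2 abs_mult abs_of_nonneg minus_le_iff order_refl)
    ultimately show ?thesis by (simp add: algebra_simps)
  qed
  with 1 that show ?thesis by blast
qed

lemma linear_nonneg_start:
  fixes a b :: real
  assumes "\<And>t. 0 < t \<Longrightarrow> t < 1 \<Longrightarrow> (1 - t) * a + t * b \<ge> 0"
  shows "a \<ge> 0"
proof (rule ccontr)
  assume "\<not> a \<ge> 0"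
  then obtain \<tau> where "0 < \<tau>" "\<tau> < 1" "(1 - \<tau>) * (- a) + \<tau> * (- b) > 0"
    using linear_pos_near_start[of "- a" "- b"] by (metis less_eq_real_def neg_0_less_iff_less not_le)
  with assms[of \<tau>] show False by (simp add: algebra_simps)
qed

text \<open>The restricted hyperbolic conditions in axis coordinates: segments of the axis become
  pairs \<open>r < s\<close>, angles and distances become heights, and the interior point comes with
  a ball in the plane \<open>x$1 = 1\<close>.\<close>

locale polygon = axis_frame e c1 c2 for e c1 c2 +
  fixes M :: "(real^3) set" and p :: "real^3" and \<epsilon> :: real
  assumes M_sub: "M \<subseteq> hypL"
    and M_convex: "convex M"
    and p_hyp: "p \<in> hypL"
    and eps: "\<epsilon> > 0"
    and ball: "\<And>y. y$1 = 1 \<Longrightarrow> dist y p < \<epsilon> \<Longrightarrow> y \<in> M"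
    and strip_hull: "\<And>r s. 0 < r \<Longrightarrow> r < s \<Longrightarrow> nonempty_interior (M \<inter> strip r s) \<Longrightarrow>
      \<exists>F. finite F \<and> F \<subseteq> hypL_closure \<and> M \<inter> strip r s = convex hull F \<inter> hypL"
    and finite_h: "finite ((\<lambda>d. \<bar>lor d e\<bar>) ` Proots M)"
begin

text \<open>Exchanging the ends inverts the quotient that defines strips, so results about the end
  \<open>c1\<close> hold at both ends.\<close>

lemma polygon_swap: "polygon e c2 c1 M p \<epsilon>"
proof -
  interpret sw: axis_frame e c2 c1 by (rule swap)
  show ?thesis
  proof
    fix r s :: real assume *: "0 < r" "r < s" "nonempty_interior (M \<inter> sw.strip r s)"
    have "sw.strip r s = strip (1/s) (1/r)"
      using * by (auto simp: sw.strip_def strip_def field_simps)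
    then show "\<exists>F. finite F \<and> F \<subseteq> hypL_closure \<and> M \<inter> sw.strip r s = convex hull F \<inter> hypL"
      using strip_hull[of "1/s" "1/r"] * by (simp add: frac_less2)
  qed (use M_sub M_convex p_hyp eps ball finite_h in auto)
qed

lemma p1: "p$1 = 1"
  using p_hyp by (simp add: hypL_def)

lemma p_M: "p \<in> M"
  using ball[of p] p1 eps by simp

sublocale side_system "Proots M" p
proof
  fix d assume d: "d \<in> Proots M"
  then show r: "lor d d = -2" by (simp add: Proots_def)
  show "lor p d > 0"
    using d r ball by (intro interior_point_lor_pos[OF p1 eps]) (auto simp: Proots_def halfplane_def)
  obtain x y where "x \<noteq> y" "x \<in> M \<inter> hline d" "y \<in> M \<inter> hline d"
    using d by (auto simp: Proots_def)
  moreover have "lor z c \<ge> 0" if "z \<in> M" "c \<in> Proots M" for z c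
    using that by (auto simp: Proots_def halfplane_def)
  ultimately show "\<exists>x y. x \<noteq> y \<and> x \<in> hypL \<and> y \<in> hypL \<and> lor x d = 0 \<and> lor y d = 0
      \<and> (\<forall>c\<in>Proots M. lor x c \<ge> 0 \<and> lor y c \<ge> 0)"
    by (intro exI[of _ x] exI[of _ y]) (auto simp: hline_def)
qed (rule p_hyp)

lemma M_lor_nonneg: "x \<in> M \<Longrightarrow> d \<in> Proots M \<Longrightarrow> lor x d \<ge> 0"
  by (auto simp: Proots_def halfplane_def)

lemma ProotsI:
  assumes "lor d d = -2" "\<And>x. x \<in> M \<Longrightarrow> lor x d \<ge> 0" "x \<noteq> y" "x \<in> M" "y \<in> M" "lor x d = 0" "lor y d = 0"
  shows "d \<in> Proots M"
  using assms M_sub unfolding Proots_def halfplane_def hline_def by blast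

text \<open>The open counterpart of \<open>strip\<close>, given by two strict linear inequalities,
  so that membership survives small moves in any direction.\<close>

definition inside :: "real \<Rightarrow> real \<Rightarrow> real^3 \<Rightarrow> bool" where
  "inside r s x \<longleftrightarrow> r * lor x c2 < lor x c1 \<and> lor x c1 < s * lor x c2"

lemma inside_strip: "inside r s x \<Longrightarrow> x \<in> hypL \<Longrightarrow> x \<in> strip r s"
  by (auto simp: inside_def strip_def)

lemma inside_iff: "inside r s x \<longleftrightarrow> lor x (c1 - r *\<^sub>R c2) > 0 \<and> lor x (s *\<^sub>R c2 - c1) > 0"
  by (auto simp: inside_def lor_simps)

lemma inside_near:
  assumes "inside r s y"
  obtains \<tau> where "0 < \<tau>" "\<tau> < 1" "\<And>t. 0 \<le> t \<Longrightarrow> t \<le> \<tau> \<Longrightarrow> inside r s ((1 - t) *\<^sub>R y + t *\<^sub>R w)"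
proof -
  obtain t1 where t1: "0 < t1" "t1 < 1"
    "\<And>t. 0 \<le> t \<Longrightarrow> t \<le> t1 \<Longrightarrow> (1 - t) * lor y (c1 - r *\<^sub>R c2) + t * lor w (c1 - r *\<^sub>R c2) > 0"
    using linear_pos_near_start assms unfolding inside_iff by blast
  obtain t2 where t2: "0 < t2" "t2 < 1"
    "\<And>t. 0 \<le> t \<Longrightarrow> t \<le> t2 \<Longrightarrow> (1 - t) * lor y (s *\<^sub>R c2 - c1) + t * lor w (s *\<^sub>R c2 - c1) > 0"
    using linear_pos_near_start assms unfolding inside_iff by blast
  show ?thesis
  proof (rule that[of "min t1 t2"])
    fix t assume t: "0 \<le> t" "t \<le> min t1 t2"
    show "inside r s ((1 - t) *\<^sub>R y + t *\<^sub>R w)"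
      unfolding inside_iff using t1(3)[of t] t2(3)[of t] t
      by (simp add: lor.add_left lor.scaleR_left)
  qed (use t1 t2 in auto)
qed

lemma strip_polytope:
  assumes "0 < r" "inside r s p"
  obtains Q \<epsilon>' where "disc_polytope Q p \<epsilon>'" "M \<inter> strip r s = Q \<inter> hypL"
proof -
  have "r * lor p c2 < s * lor p c2" using assms(2) by (simp add: inside_def)
  then have rs: "r < s" using frame_pos_hypL[OF p_hyp] by simp
  have "open {x. inside r s x}" unfolding inside_iff
    by (intro open_Collect_conj open_Collect_less continuous_intros lor.continuous_on)
  then obtain \<eta> where \<eta>: "\<eta> > 0" "\<And>y. dist y p < \<eta> \<Longrightarrow> inside r s y"
    using assms(2) unfolding open_dist by blast
  define \<epsilon>' where "\<epsilon>' = min \<epsilon> \<eta>"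
  have near: "y \<in> M \<inter> strip r s" if "y$1 = 1" "dist y p < \<epsilon>'" for y
    using that ball[of y] \<eta>(2)[of y] M_sub inside_strip by (auto simp: \<epsilon>'_def)
  have \<epsilon>': "\<epsilon>' > 0" using eps \<eta> by (simp add: \<epsilon>'_def)
  have "nonempty_interior (M \<inter> strip r s)"
    unfolding nonempty_interior_def
    using near p1 \<epsilon>' by (intro bexI[of _ p] exI[of _ \<epsilon>']) (auto simp: hypL_def)
  then obtain F where F: "finite F" "F \<subseteq> hypL_closure" "M \<inter> strip r s = convex hull F \<inter> hypL"
    using strip_hull[OF assms(1) rs] by blast
  have "disc_polytope (convex hull F) p \<epsilon>'"
  proof
    show "polytope (convex hull F)" using F(1) by (rule polytope_convex_hull)
    show "convex hull F \<subseteq> hypL_closure" using F(2) convex_hypL_closure by (rule hull_minimal)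
    show "y \<in> convex hull F" if "y$1 = 1" "dist y p < \<epsilon>'" for y
      using near[OF that] F(3) by blast
  qed (use p1 \<epsilon>' in auto)
  then show ?thesis using that F(3) by blast
qed

text \<open>\<open>Q\<close> may contain ideal points. There the sign of \<open>d\<close> is
  obtained as a limit along the segment to \<open>p\<close>, whose interior lies in
  \<open>M\<close>.\<close>

lemma Q_nonneg:
  assumes Q: "Q \<subseteq> hypL_closure" "convex Q" "p \<in> Q" "Q \<inter> hypL \<subseteq> M" and "q \<in> Q" and d: "\<And>x. x \<in> M \<Longrightarrow> lor x d \<ge> 0"
  shows "lor q d \<ge> 0"
proof (cases "q = p")
  case True then show ?thesis using d p_M by simp
next
  case False
  show ?thesis
  proof (rule linear_nonneg_start)
    fix t :: real assume t: "0 < t" "t < 1"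
    have "(1 - t) *\<^sub>R q + t *\<^sub>R p \<in> Q" using assms t by (intro convexD) auto
    moreover have "(1 - t) *\<^sub>R q + t *\<^sub>R p \<in> hypL"
      using assms t False by (intro segment_in_hypL) auto
    ultimately have "(1 - t) *\<^sub>R q + t *\<^sub>R p \<in> M" using Q(4) by blast
    from d[OF this] show "(1 - t) * lor q d + t * lor p d \<ge> 0" by (simp add: lor_simps)
  qed
qed

context
  fixes r s Q \<epsilon>'
  assumes DP: "disc_polytope Q p \<epsilon>'" and QM: "M \<inter> strip r s = Q \<inter> hypL"
begin

interpretation DQ: disc_polytope Q p \<epsilon>' by (rule DP)

lemma Q_convex: "convex Q"
  using DQ.poly polytope_imp_convex by blast

lemma Q_Mbar: "q \<in> Q \<Longrightarrow> q \<in> Mbar"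
  unfolding Mbar_def using Q_nonneg[OF DQ.sub Q_convex DQ.p_in _ _ M_lor_nonneg] QM DQ.sub by blast

text \<open>Strictly inside the strip \<open>Q\<close> and \<open>M\<close> agree, so such a facet
  comes from a side of \<open>M\<close> and not from the lines bounding the strip. Its root is
  nonnegative at every \<open>x\<close> of \<open>M\<close>, since an initial piece of a segment
  from the facet to \<open>x\<close> stays in \<open>Q\<close>.\<close>

lemma facet_Proots:
  assumes c: "c facet_of Q" and y: "y \<in> c" "inside r s y"
  shows "\<exists>d\<in>Proots M. c = {x \<in> Q. lor x d = 0}"
proof -
  obtain d u v where d: "lor d d = -2" "\<And>x. x \<in> Q \<Longrightarrow> lor x d \<ge> 0" "c = {x \<in> Q. lor x d = 0}"
    "u \<in> c" "v \<in> c" "u \<noteq> v" using DQ.facet_root[OF c] by blast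
  then obtain w where w: "w \<in> c" "w \<noteq> y" by metis
  obtain \<tau> where \<tau>: "0 < \<tau>" "\<tau> < 1" "\<And>t. 0 \<le> t \<Longrightarrow> t \<le> \<tau> \<Longrightarrow> inside r s ((1 - t) *\<^sub>R y + t *\<^sub>R w)"
    using inside_near[OF y(2)] by blast
  define z where "z t = (1 - t) *\<^sub>R y + t *\<^sub>R w" for t
  have z: "z t \<in> M" "lor (z t) d = 0" "inside r s (z t)" if "0 < t" "t \<le> \<tau>" for t
  proof -
    have yw: "y \<in> Q" "w \<in> Q" "lor y d = 0" "lor w d = 0" using y w d(3) by auto
    show 0: "lor (z t) d = 0" using yw by (simp add: z_def lor_simps)
    show 1: "inside r s (z t)" using \<tau>(3) that by (simp add: z_def)
    have "z t \<in> hypL" unfolding z_def using yw DQ.sub w \<tau> that by (intro segment_in_hypL) auto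
    moreover have "z t \<in> Q" unfolding z_def using yw that \<tau> by (intro convexD[OF Q_convex]) auto
    ultimately show "z t \<in> M" using QM by blast
  qed
  have "d \<in> Proots M"
  proof (rule ProotsI[OF d(1), of "z \<tau>" "z (\<tau>/2)"])
    show "lor x d \<ge> 0" if x: "x \<in> M" for x
    proof -
      obtain \<sigma> where \<sigma>: "0 < \<sigma>" "\<sigma> < 1" "\<And>t. 0 \<le> t \<Longrightarrow> t \<le> \<sigma> \<Longrightarrow> inside r s ((1 - t) *\<^sub>R z \<tau> + t *\<^sub>R x)"
        using inside_near[OF z(3)[of \<tau>]] \<tau> by auto
      define q where "q = (1 - \<sigma>) *\<^sub>R z \<tau> + \<sigma> *\<^sub>R x"
      have "q \<in> M" unfolding q_def using z(1)[of \<tau>] x \<sigma> \<tau> by (intro convexD[OF M_convex]) auto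
      moreover have "inside r s q" using \<sigma> by (simp add: q_def)
      ultimately have "q \<in> Q" using QM M_sub inside_strip by blast
      then have "lor q d \<ge> 0" by (rule d(2))
      then have "\<sigma> * lor x d \<ge> 0" using z(2)[of \<tau>] \<tau> by (simp add: q_def lor_simps)
      then show ?thesis using \<sigma> by (simp add: zero_le_mult_iff)
    qed
    have "z \<tau> - z (\<tau>/2) = (\<tau>/2) *\<^sub>R (w - y)" by (simp add: z_def algebra_simps flip: scaleR_add_left)
    then show "z \<tau> \<noteq> z (\<tau>/2)" using w \<tau> by auto
  qed (use z[of \<tau>] z[of "\<tau>/2"] \<tau> in auto)
  with d(3) show ?thesis by blast
qed

lemma vertex_root:
  assumes "z extreme_point_of Q" "v \<in> Q" "v \<noteq> z" "inside r s z"
  obtains d where "d \<in> Proots M" "lor z d = 0" "lor v d \<noteq> 0"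
proof -
  obtain c where c: "c facet_of Q" "z \<in> c" "v \<notin> c" using DQ.vertex_facet assms by metis
  then obtain d where "d \<in> Proots M" "c = {x \<in> Q. lor x d = 0}" using facet_Proots assms(4) by blast
  then show ?thesis using that c assms by blast
qed

text \<open>The root of the facet where the segment from \<open>p\<close> to \<open>x\<close> leaves
  \<open>Q\<close> is positive at \<open>p\<close> and zero at the exit point, hence negative at
  \<open>x\<close>.\<close>

lemma exit_root:
  assumes "x \<in> hypL_closure" "x \<notin> Q" "inside r s x" "inside r s p"
  obtains d where "d \<in> Proots M" "lor x d < 0"
proof -
  have "x$1 = 1" using assms(1) by (simp add: hypL_closure_def)
  then obtain t c where t: "0 < t" "t < 1" "c facet_of Q" "(1 - t) *\<^sub>R p + t *\<^sub>R x \<in> c"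
    using DQ.exit_facet assms(2) by metis
  define y where "y = (1 - t) *\<^sub>R p + t *\<^sub>R x"
  have "inside r s y"
  proof -
    have "lor y k > 0" if "lor p k > 0" "lor x k > 0" for k
      unfolding y_def using that t by (simp add: lor_simps add_pos_pos)
    then show ?thesis using assms(3,4) unfolding inside_iff by blast
  qed
  then obtain d where d: "d \<in> Proots M" "c = {x \<in> Q. lor x d = 0}"
    using facet_Proots[OF t(3)] t(4) y_def by blast
  have "lor y d = 0" using t(4) d(2) by (simp add: y_def)
  then have "(1 - t) * lor p d + t * lor x d = 0" by (simp add: y_def lor_simps)
  moreover have "(1 - t) * lor p d > 0" using p_pos[OF d(1)] t by simp
  ultimately have "t * lor x d < 0" by linarith
  then have "lor x d < 0" using t by (simp add: mult_less_0_iff)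
  then show ?thesis using that d by blast
qed

end

section \<open>From strips to the whole polygon\<close>

lemma strip_around_compact:
  assumes K: "compact K" "\<And>z. z \<in> K \<Longrightarrow> lor z c1 > 0 \<and> lor z c2 > 0"
  obtains r s where "0 < r" "inside r s p" "\<And>z. z \<in> K \<Longrightarrow> inside r s z"
proof -
  define K' where "K' = insert p K"
  have K': "compact K'" "K' \<noteq> {}" "\<And>z. z \<in> K' \<Longrightarrow> lor z c1 > 0 \<and> lor z c2 > 0"
    using assms frame_pos_hypL[OF p_hyp] by (auto simp: K'_def)
  define g where "g z = lor z c1 / lor z c2" for z
  have cont: "continuous_on K' g"
    unfolding g_def using K'(3) by (intro continuous_on_divide lor.continuous_on continuous_on_id continuous_on_const) force
  obtain a where a: "a \<in> K'" "\<And>z. z \<in> K' \<Longrightarrow> g a \<le> g z"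
    using continuous_attains_inf[OF K'(1,2) cont] by blast
  obtain b where b: "b \<in> K'" "\<And>z. z \<in> K' \<Longrightarrow> g z \<le> g b"
    using continuous_attains_sup[OF K'(1,2) cont] by blast
  have pos: "g a > 0" "g b > 0" using K'(3) a(1) b(1) by (auto simp: g_def)
  define r s where rs: "r = g a / 2" "s = 2 * g b"
  have "inside r s z" if "z \<in> K'" for z
  proof -
    have "r < g z" "g z < s"
      using a(2)[OF that] b(2)[OF that] pos unfolding rs by linarith+
    then show ?thesis using K'(3)[OF that] by (simp add: inside_def g_def field_simps)
  qed
  then show ?thesis using that[of r s] pos by (auto simp: K'_def rs)
qed

text \<open>A line avoiding both ends of the axis is compact in the closed disc and fits inside one
  strip, so both endpoints of the side are vertices coming from other sides of \<open>M\<close>. The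
  functional \<open>k\<close> passes closeness to an end of the axis from \<open>x\<close> to the
  vertex \<open>z\<close>.\<close>

lemma side_neighbours:
  assumes \<delta>: "\<delta> \<in> Proots M" "lor c1 \<delta> \<noteq> 0" "lor c2 \<delta> \<noteq> 0"
    and x: "x \<in> M" "lor x \<delta> = 0" "lor x k \<le> 0"
  obtains z n where "two_nbrs \<delta>" "nbr \<delta> n" "z \<in> Mbar" "lor z \<delta> = 0" "lor z n = 0" "lor z k \<le> 0"
    "lor z c1 > 0" "lor z c2 > 0"
proof -
  define K where "K = {z \<in> hypL_closure. lor z \<delta> = 0}"
  have K0: "lor z c1 > 0 \<and> lor z c2 > 0" if "z \<in> K" for z
    using frame_pos_if_not_end[OF _ \<delta>(2,3)] that by (auto simp: K_def)
  have "closed {z. lor z \<delta> = 0}"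
    by (intro closed_Collect_eq lor.continuous_on continuous_on_id continuous_on_const)
  moreover have "K = hypL_closure \<inter> {z. lor z \<delta> = 0}" by (auto simp: K_def)
  ultimately have "compact K" using compact_Int_closed[OF compact_hypL_closure] by metis
  then obtain r s where rs: "0 < r" "inside r s p" "\<And>z. z \<in> K \<Longrightarrow> inside r s z"
    using strip_around_compact K0 by metis
  obtain Q \<epsilon>' where Q: "disc_polytope Q p \<epsilon>'" "M \<inter> strip r s = Q \<inter> hypL"
    using strip_polytope[OF rs(1,2)] by metis
  interpret DQ: disc_polytope Q p \<epsilon>' by (rule Q(1))
  have inQ: "z \<in> Q" if "z \<in> M" "lor z \<delta> = 0" for z
  proof -
    have "z \<in> K" using that M_sub hypL_subset_closure by (auto simp: K_def)
    then show ?thesis using rs(3) inside_strip that Q(2) M_sub by blast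
  qed
  obtain a b where ab: "a \<noteq> b" "a \<in> M" "b \<in> M" "lor a \<delta> = 0" "lor b \<delta> = 0"
    using \<delta>(1) by (auto simp: Proots_def hline_def)
  obtain y where y: "y \<in> M" "y \<noteq> x" "lor y \<delta> = 0"
  proof (cases "a = x")
    case True then show ?thesis using ab that[of b] by auto
  next
    case False then show ?thesis using ab that[of a] by auto
  qed
  have Q0: "lor q \<delta> \<ge> 0" if "q \<in> Q" for q using Q_Mbar[OF Q that] \<delta>(1) by (simp add: Mbar_def)
  obtain z1 z2 where z: "z1 \<noteq> z2" "z1 extreme_point_of Q" "z2 extreme_point_of Q"
    "lor z1 \<delta> = 0" "lor z2 \<delta> = 0" "lor z1 k \<le> 0"
    using DQ.side_vertices[OF Q0 inQ[OF x(1,2)] inQ[OF y(1,3)] y(2)[symmetric] x(2) y(3) x(3)] by metis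
  have zQ: "z1 \<in> Q" "z2 \<in> Q" using z by (auto simp: extreme_point_of_def)
  then have zK: "z1 \<in> K" "z2 \<in> K" using DQ.sub z by (auto simp: K_def)
  obtain n1 where n1: "n1 \<in> Proots M" "lor z1 n1 = 0" "lor z2 n1 \<noteq> 0"
    using vertex_root[OF Q z(2) zQ(2)] z(1) rs(3)[OF zK(1)] by metis
  obtain n2 where n2: "n2 \<in> Proots M" "lor z2 n2 = 0" "lor z1 n2 \<noteq> 0"
    using vertex_root[OF Q z(3) zQ(1)] z(1) rs(3)[OF zK(2)] by metis
  have zM: "z1 \<in> Mbar" "z2 \<in> Mbar" using Q_Mbar[OF Q] zQ by auto
  have nd: "n1 \<noteq> \<delta>" "n2 \<noteq> \<delta>" using n1 n2 z by auto
  have "two_nbrs \<delta>" using two_nbrsI[OF \<delta>(1) zM z(1,4,5) n1(1) n2(1) nd n1(2) n2(2)] .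
  moreover have "nbr \<delta> n1" unfolding nbr_def using \<delta>(1) n1 nd zM z by blast
  ultimately show ?thesis using that zM z n1 K0 zK by blast
qed

lemma two_nbrs_of_not_end:
  assumes "\<delta> \<in> Proots M" "lor c1 \<delta> \<noteq> 0" "lor c2 \<delta> \<noteq> 0"
  shows "two_nbrs \<delta>"
proof -
  obtain x where "x \<in> M" "lor x \<delta> = 0" using assms(1) by (auto simp: Proots_def hline_def)
  then show ?thesis using side_neighbours[OF assms, of x 0] by auto
qed

lemma root_beyond:
  assumes "x \<in> hypL" "x \<notin> M"
  obtains d where "d \<in> Proots M" "lor x d < 0"
proof -
  obtain r s where rs: "0 < r" "inside r s p" "inside r s x"
    using strip_around_compact[of "{x}"] frame_pos_hypL[OF assms(1)] by auto
  obtain Q \<epsilon>' where Q: "disc_polytope Q p \<epsilon>'" "M \<inter> strip r s = Q \<inter> hypL"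
    using strip_polytope[OF rs(1,2)] by metis
  have "x \<notin> Q" using Q(2) assms by blast
  then show ?thesis using exit_root[OF Q _ _ rs(3,2)] assms(1) hypL_subset_closure that by blast
qed

text \<open>An ideal point in a strip polytope is a vertex of it, hence lies on a side; an ideal
  point outside is cut off by a side. This is how the finiteness of the strips enters.\<close>

lemma ideal_point_covered:
  assumes "z \<in> hypL_closure" "lor z z = 0" "lor z c1 > 0" "lor z c2 > 0"
  obtains d where "d \<in> Proots M" "lor z d \<le> 0"
proof -
  obtain r s where rs: "0 < r" "inside r s p" "inside r s z"
    using strip_around_compact[of "{z}"] assms by auto
  obtain Q \<epsilon>' where Q: "disc_polytope Q p \<epsilon>'" "M \<inter> strip r s = Q \<inter> hypL"
    using strip_polytope[OF rs(1,2)] by metis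
  interpret DQ: disc_polytope Q p \<epsilon>' by (rule Q(1))
  show ?thesis
  proof (cases "z \<in> Q")
    case True
    have "p \<noteq> z" using assms(2) p_hyp by (auto simp: hypL_def)
    then show ?thesis
      using vertex_root[OF Q DQ.null_extreme_point[OF True assms(2)] DQ.p_in _ rs(3)] that by (metis order_refl)
  next
    case False
    then show ?thesis using exit_root[OF Q assms(1) _ rs(3,2)] that by (metis less_imp_le)
  qed
qed

text \<open>Each such side meets the strip in a nondegenerate segment, which spans a face of the
  strip polytope and determines the root; a polytope has finitely many faces.\<close>

lemma finite_sides_in_strip:
  assumes "0 < r" "inside r s p"
  shows "finite {d \<in> Proots M. \<exists>x\<in>M. lor x d = 0 \<and> inside r s x}" (is "finite ?S")
proof -
  obtain Q \<epsilon>' where Q: "disc_polytope Q p \<epsilon>'" "M \<inter> strip r s = Q \<inter> hypL"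
    using strip_polytope[OF assms] by metis
  interpret DQ: disc_polytope Q p \<epsilon>' by (rule Q(1))
  define f where "f d = {x \<in> Q. lor x d = 0}" for d
  have two: "\<exists>a b. a \<in> Q \<and> b \<in> Q \<and> a \<noteq> b \<and> lor a d = 0 \<and> lor b d = 0" if "d \<in> ?S" for d
  proof -
    obtain x where x: "d \<in> Proots M" "x \<in> M" "lor x d = 0" "inside r s x" using \<open>d \<in> ?S\<close> by blast
    obtain a b where ab: "a \<noteq> b" "a \<in> M" "b \<in> M" "lor a d = 0" "lor b d = 0"
      using x(1) by (auto simp: Proots_def hline_def)
    then obtain y where y: "y \<in> M" "y \<noteq> x" "lor y d = 0" by metis
    obtain \<tau> where \<tau>: "0 < \<tau>" "\<tau> < 1" "\<And>t. 0 \<le> t \<Longrightarrow> t \<le> \<tau> \<Longrightarrow> inside r s ((1 - t) *\<^sub>R x + t *\<^sub>R y)"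
      using inside_near[OF x(4)] by blast
    define w where "w = (1 - \<tau>) *\<^sub>R x + \<tau> *\<^sub>R y"
    have "w \<in> M" unfolding w_def using x y \<tau> by (intro convexD[OF M_convex]) auto
    moreover have "inside r s w" using \<tau> by (simp add: w_def)
    moreover have "lor w d = 0" using x y by (simp add: w_def lor_simps)
    moreover have "w \<noteq> x"
    proof
      assume "w = x"
      then have "\<tau> *\<^sub>R (y - x) = 0" by (simp add: w_def algebra_simps)
      then show False using \<tau> y by simp
    qed
    moreover have "u \<in> Q" if "u \<in> M" "inside r s u" for u
      using that Q(2) M_sub inside_strip by blast
    ultimately show ?thesis using x by blast
  qed
  have "f ` ?S \<subseteq> {F. F face_of Q}"
  proof clarify
    fix d assume d: "d \<in> Proots M"
    define a :: "real^3" where "a = (\<chi> i. if i = 1 then d$1 else - d$i)"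
    have a: "a \<bullet> x = lor x d" for x
      by (simp add: a_def lor_def inner_vec_def sum_3 algebra_simps)
    have "f d = Q \<inter> {x. a \<bullet> x = 0}" by (auto simp: f_def a)
    moreover have "lor x d \<ge> 0" if "x \<in> Q" for x using Q_Mbar[OF Q that] d by (simp add: Mbar_def)
    ultimately show "f d face_of Q"
      using face_of_Int_supporting_hyperplane_ge[OF Q_convex[OF Q], of 0 a] by (simp add: a)
  qed
  then have "finite (f ` ?S)" using finite_polytope_faces[OF DQ.poly] finite_subset by blast
  moreover have "inj_on f ?S"
  proof (rule inj_onI)
    fix d d' assume d: "d \<in> ?S" "d' \<in> ?S" "f d = f d'"
    obtain a b where ab: "a \<in> Q" "b \<in> Q" "a \<noteq> b" "lor a d = 0" "lor b d = 0" using two[OF d(1)] by blast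
    then have "lor a d' = 0" "lor b d' = 0" using d(3) by (auto simp: f_def set_eq_iff)
    then show "d = d'" using two_points_unique[of d' d a b] d ab DQ.fst_Q by auto
  qed
  ultimately show ?thesis using finite_imageD by blast
qed

end

subsection \<open>Finitely many sides\<close>

context polygon
begin

text \<open>The ideal points other than the two ends of the axis are the rays of these null vectors;
  the sign of \<open>s\<close> tells the side of the axis.\<close>
lemma row_covered:
  assumes "s \<noteq> 0"
  obtains d where "d \<in> Proots M" "lor d c1 + s\<^sup>2 * lor d c2 + s * lor d e \<le> 0"
proof -
  define v where "v = c1 + s\<^sup>2 *\<^sub>R c2 + s *\<^sub>R e"
  have vc: "lor v c1 = s\<^sup>2" "lor v c2 = 1" "lor v e = - 2 * s"
    using null c12 c_orth ee by (simp_all add: v_def lor_simps lor_commute[of c2 c1] lor_commute[of e c1] lor_commute[of e c2])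
  have vv: "lor v v = 0" unfolding lor_frame[of v v] vc by (simp add: power2_eq_square)
  have "v \<noteq> 0" using vc by auto
  then have v0: "v$1 \<noteq> 0" using causal_fst_nonzero vv by simp
  define z where "z = (1 / v$1) *\<^sub>R v"
  have z: "z \<in> hypL_closure" "lor z z = 0" using v0 vv by (simp_all add: z_def hypL_closure_def lor_simps)
  have "lor z c2 \<ge> 0" using frame_nonneg z by blast
  then have v1: "v$1 > 0" using vc v0 by (simp add: z_def lor_simps zero_le_divide_iff)
  have "lor z c1 > 0" "lor z c2 > 0" using assms v1 vc by (simp_all add: z_def lor_simps)
  then obtain d where d: "d \<in> Proots M" "lor z d \<le> 0" using ideal_point_covered z by blast
  then have "lor v d \<le> 0" using v1 by (simp add: z_def lor_simps divide_le_0_iff)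
  then show ?thesis using that d(1)
    by (simp add: v_def lor_simps lor_commute[of c1 d] lor_commute[of c2 d] lor_commute[of e d])
qed

text \<open>As \<open>s\<close> tends to 0 the null vectors of \<open>row_covered\<close> tend to
  \<open>c1\<close>, and finitely many roots positive at \<open>c1\<close> would be positive at all
  of them for small \<open>s\<close>.\<close>

lemma end_covered_finite:
  assumes "finite (Proots M)"
  shows "\<exists>d\<in>Proots M. lor d c1 \<le> 0"
proof (rule ccontr)
  assume "\<not> ?thesis"
  then have A: "lor d c1 > 0" if "d \<in> Proots M" for d using that by force
  have "eventually (\<lambda>s. lor d c1 + s\<^sup>2 * lor d c2 + s * lor d e > 0) (at_right 0)" if "d \<in> Proots M" for d
  proof (rule order_tendstoD(1)[OF _ A[OF that]])
    have "((\<lambda>s. lor d c1 + s\<^sup>2 * lor d c2 + s * lor d e) \<longlongrightarrow> lor d c1 + 0\<^sup>2 * lor d c2 + 0 * lor d e) (at_right 0)"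
      by (intro tendsto_intros)
    then show "((\<lambda>s. lor d c1 + s\<^sup>2 * lor d c2 + s * lor d e) \<longlongrightarrow> lor d c1) (at_right 0)" by simp
  qed
  then have "eventually (\<lambda>s. \<forall>d\<in>Proots M. lor d c1 + s\<^sup>2 * lor d c2 + s * lor d e > 0) (at_right 0)"
    using assms by (intro eventually_ball_finite) auto
  moreover have "eventually (\<lambda>s::real. s > 0) (at_right 0)" by (rule eventually_at_right_less)
  ultimately have "eventually (\<lambda>s. s > 0 \<and> (\<forall>d\<in>Proots M. lor d c1 + s\<^sup>2 * lor d c2 + s * lor d e > 0)) (at_right 0)"
    by (rule eventually_conj[rotated])
  then obtain s where "s > 0" "\<forall>d\<in>Proots M. lor d c1 + s\<^sup>2 * lor d c2 + s * lor d e > 0"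
    using eventually_happens'[OF trivial_limit_at_right_real] by blast
  then show False using row_covered[of s] by (metis less_irrefl not_le)
qed

lemma null_point_covered_finite:
  assumes fin: "finite (Proots M)" and z: "z \<in> hypL_closure" "lor z z = 0"
  obtains d where "d \<in> Proots M" "lor z d \<le> 0"
proof -
  have n: "(1 / c1$1) *\<^sub>R c1 \<in> hypL_closure" "(1 / c2$1) *\<^sub>R c2 \<in> hypL_closure"
    using c_pos null by (simp_all add: hypL_closure_def lor_simps)
  consider "z = (1 / c1$1) *\<^sub>R c1" | "z = (1 / c2$1) *\<^sub>R c2" | "lor z c1 > 0" "lor z c2 > 0"
  proof (cases "z = (1 / c1$1) *\<^sub>R c1 \<or> z = (1 / c2$1) *\<^sub>R c2")
    case False
    then have "lor z ((1 / c1$1) *\<^sub>R c1) > 0" "lor z ((1 / c2$1) *\<^sub>R c2) > 0"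
      using closure_lor_pos z(1) n by blast+
    then have "lor z c1 > 0" "lor z c2 > 0" using c_pos by (simp_all add: lor_simps zero_less_divide_iff)
    then show ?thesis using that by blast
  qed (use that in blast)
  then show ?thesis
  proof cases
    case 1
    obtain d where "d \<in> Proots M" "lor d c1 \<le> 0" using end_covered_finite[OF fin] by blast
    then show ?thesis using that[of d] 1 c_pos by (simp add: lor_simps lor_commute[of c1] divide_le_0_iff)
  next
    case 2
    interpret sw: polygon e c2 c1 M p \<epsilon> by (rule polygon_swap)
    obtain d where "d \<in> Proots M" "lor d c2 \<le> 0" using sw.end_covered_finite[OF fin] by blast
    then show ?thesis using that[of d] 2 c_pos by (simp add: lor_simps lor_commute[of c2] divide_le_0_iff)
  next
    case 3
    then show ?thesis using ideal_point_covered[OF z] that by blast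
  qed
qed

text \<open>If the set cut out by the roots left the disc, a segment from \<open>p\<close> would
  cross the circle at an ideal point where every root is positive, although each ideal point is
  covered by a root.\<close>

lemma dual_polytope:
  assumes fin: "finite (Proots M)"
  shows "disc_polytope {x. x$1 = 1 \<and> (\<forall>d\<in>Proots M. lor x d \<ge> 0)} p \<epsilon>" (is "disc_polytope ?Q p \<epsilon>")
proof
  show sub: "?Q \<subseteq> hypL_closure"
  proof
    fix z assume z: "z \<in> ?Q"
    show "z \<in> hypL_closure"
    proof (rule ccontr)
      assume "z \<notin> hypL_closure"
      then have neg: "lor z z < 0" using z by (simp add: hypL_closure_def)
      define f where "f t = (1 - t) *\<^sub>R p + t *\<^sub>R z" for t
      have "continuous_on {0..1} (\<lambda>t. lor (f t) (f t))"
        unfolding f_def by (intro lor.continuous_on continuous_intros)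
      moreover have "lor (f 0) (f 0) > 0" using p_hyp by (simp add: f_def hypL_def)
      moreover have "lor (f 1) (f 1) < 0" using neg by (simp add: f_def)
      ultimately obtain t where t: "0 \<le> t" "t \<le> 1" "lor (f t) (f t) = 0"
        using IVT2'[of "\<lambda>t. lor (f t) (f t)" 1 0 0] by auto
      have "t \<noteq> 1" using t(3) neg by (auto simp: f_def)
      have "f t $ 1 = 1" using p1 z by (simp add: f_def)
      then have "f t \<in> hypL_closure" using t by (simp add: hypL_closure_def)
      then obtain d where d: "d \<in> Proots M" "lor (f t) d \<le> 0"
        using null_point_covered_finite[OF fin] t(3) by blast
      have "(1 - t) * lor p d > 0" "t * lor z d \<ge> 0" using p_pos[OF d(1)] z d(1) t \<open>t \<noteq> 1\<close> by auto
      then show False using d(2) by (simp add: f_def lor_simps)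
    qed
  qed
  define a :: "real^3 \<Rightarrow> real^3" where "a d = (\<chi> i. if i = 1 then d$1 else - d$i)" for d
  have a: "a d \<bullet> x = lor x d" for x d
    by (simp add: a_def lor_def inner_vec_def sum_3 algebra_simps)
  have "?Q = {x. axis 1 1 \<bullet> x = 1} \<inter> \<Inter>((\<lambda>d. {x. a d \<bullet> x \<ge> 0}) ` Proots M)"
    by (auto simp: a inner_axis')
  moreover have "polyhedron ({x. axis 1 1 \<bullet> x = 1} \<inter> \<Inter>((\<lambda>d. {x. a d \<bullet> x \<ge> 0}) ` Proots M))"
    using fin by (intro polyhedron_Int polyhedron_Inter) (auto simp: polyhedron_hyperplane polyhedron_halfspace_ge)
  ultimately have "polyhedron ?Q" by simp
  moreover have "bounded ?Q" using sub compact_hypL_closure compact_imp_bounded bounded_subset by blast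
  ultimately show "polytope ?Q" by (simp add: polytope_eq_bounded_polyhedron)
  show "y \<in> ?Q" if "y$1 = 1" "dist y p < \<epsilon>" for y
    using ball[OF that] that M_lor_nonneg by auto
qed (use p1 eps in auto)

text \<open>This includes sides that reach an end of the axis, which no strip contains; the polytope
  of all roots takes the place of the strip polytope.\<close>

lemma two_nbrs_finite:
  assumes fin: "finite (Proots M)" and \<delta>: "\<delta> \<in> Proots M"
  shows "two_nbrs \<delta>"
proof -
  define Q where "Q = {x. x$1 = 1 \<and> (\<forall>d\<in>Proots M. lor x d \<ge> 0)}"
  interpret DQ: disc_polytope Q p \<epsilon> unfolding Q_def by (rule dual_polytope[OF fin])
  have MQ: "M \<subseteq> Q" using M_sub M_lor_nonneg by (auto simp: Q_def hypL_def)
  have QM: "x \<in> M" if x: "x \<in> Q" "x \<in> hypL" for x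
  proof (rule ccontr)
    assume "x \<notin> M"
    then obtain d where "d \<in> Proots M" "lor x d < 0" using root_beyond[OF x(2)] by blast
    then show False using x(1) by (force simp: Q_def)
  qed
  have Qconv: "convex Q" using DQ.poly polytope_imp_convex by blast
  have facet: "\<exists>d\<in>Proots M. c = {x \<in> Q. lor x d = 0}" if c: "c facet_of Q" for c
  proof -
    obtain d u v where d: "lor d d = -2" "\<And>x. x \<in> Q \<Longrightarrow> lor x d \<ge> 0" "c = {x \<in> Q. lor x d = 0}"
      "u \<in> c" "v \<in> c" "u \<noteq> v" using DQ.facet_root[OF c] by blast
    define f where "f t = (1 - t) *\<^sub>R u + t *\<^sub>R v" for t
    have f: "f t \<in> M" "lor (f t) d = 0" if "0 < t" "t < 1" for t
    proof -
      have uv: "u \<in> Q" "v \<in> Q" "lor u d = 0" "lor v d = 0" using d by auto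
      have "f t \<in> Q" unfolding f_def using uv that by (intro convexD[OF Qconv]) auto
      moreover have "f t \<in> hypL" unfolding f_def using uv DQ.sub d that by (intro segment_in_hypL) auto
      ultimately show "f t \<in> M" by (rule QM)
      show "lor (f t) d = 0" using uv by (simp add: f_def lor_simps)
    qed
    have "f (1/2) - f (1/4) = (1/4) *\<^sub>R (v - u)" by (simp add: f_def vec_eq_iff field_simps)
    then have "f (1/2) \<noteq> f (1/4)" using d by auto
    then have "d \<in> Proots M" using f[of "1/2"] f[of "1/4"] d MQ by (intro ProotsI[of d "f (1/2)" "f (1/4)"]) auto
    then show ?thesis using d(3) by blast
  qed
  have vertex: "\<exists>d\<in>Proots M. lor z d = 0 \<and> lor v d \<noteq> 0"
    if zv: "z extreme_point_of Q" "v \<in> Q" "v \<noteq> z" for z v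
  proof -
    obtain c where c: "c facet_of Q" "z \<in> c" "v \<notin> c" using DQ.vertex_facet[OF zv] by blast
    then show ?thesis using facet zv by blast
  qed
  obtain x y where xy: "x \<noteq> y" "x \<in> M" "y \<in> M" "lor x \<delta> = 0" "lor y \<delta> = 0"
    using \<delta> by (auto simp: Proots_def hline_def)
  have Q0: "lor q \<delta> \<ge> 0" if "q \<in> Q" for q using that \<delta> by (simp add: Q_def)
  obtain z1 z2 where z: "z1 \<noteq> z2" "z1 extreme_point_of Q" "z2 extreme_point_of Q"
    "lor z1 \<delta> = 0" "lor z2 \<delta> = 0"
    using DQ.side_vertices[OF Q0 _ _ xy(1,4,5), of 0] xy MQ by auto
  have zQ: "z1 \<in> Q" "z2 \<in> Q" using z by (auto simp: extreme_point_of_def)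
  obtain n1 where n1: "n1 \<in> Proots M" "lor z1 n1 = 0" "lor z2 n1 \<noteq> 0"
    using vertex[OF z(2) zQ(2)] z(1) by metis
  obtain n2 where n2: "n2 \<in> Proots M" "lor z2 n2 = 0" "lor z1 n2 \<noteq> 0"
    using vertex[OF z(3) zQ(1)] z(1) by metis
  have zM: "z1 \<in> Mbar" "z2 \<in> Mbar" using zQ DQ.sub by (auto simp: Mbar_def Q_def)
  have nd: "n1 \<noteq> \<delta>" "n2 \<noteq> \<delta>" using n1 n2 z by auto
  show ?thesis using two_nbrsI[OF \<delta> zM z(1,4,5) n1(1) n2(1) nd n1(2) n2(2)] .
qed

lemma good_triple_finite:
  assumes fin: "finite (Proots M)"
  shows "good_triple (Proots M)"
proof -
  obtain d where d: "d \<in> Proots M" using row_covered[of 1] by auto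
  define h where "h = (\<lambda>d. \<bar>lor d p\<bar>)"
  obtain x where x: "x \<in> Proots M" "\<not> isolated h x"
  proof (cases "isolated h d")
    case True
    obtain n where "nbr d n" using two_nbrs_finite[OF fin d] unfolding two_nbrs_def by blast
    then show ?thesis using that[of n] isolated_nbr[OF True] by (auto simp: nbr_def)
  qed (use that d in blast)
  have pp: "lor p p > 0" using p_hyp by (simp add: hypL_def)
  show ?thesis
  proof (rule good_triple_of_not_isolated[of 0 p x])
    \<comment> \<open>As \<open>p\<close> is timelike, both height conditions hold at every root, so
      the threshold is 0.\<close>
    show "0 < lor p p + (lor c p)\<^sup>2 / 2" for c using pp by (simp add: add_pos_nonneg)
    show "(lor c p)\<^sup>2 \<le> 5/2 * (lor p p + (lor c p)\<^sup>2 / 2)" for c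
    proof -
      define q where "q = (lor c p)\<^sup>2"
      have "q \<ge> 0" by (simp add: q_def)
      then show ?thesis unfolding q_def[symmetric] using pp by (simp add: field_simps)
    qed
  qed (use two_nbrs_finite[OF fin] fin x in \<open>auto simp: h_def\<close>)
qed

end

subsection \<open>Infinitely many sides\<close>

context polygon
begin

text \<open>The sign of \<open>(d, e)^2 - 4\<close> is that of the product of the values of
  \<open>d\<close> at the two ends: negative if the line of \<open>d\<close> crosses the axis, zero
  if it passes through an end, positive if the lines are ultraparallel.\<close>

lemma root_frame: "d \<in> Proots M \<Longrightarrow> 4 * lor d c1 * lor d c2 = (lor d e)\<^sup>2 - 4"
  using lor_frame[of d d] root[of d] by (simp add: power2_eq_square)

lemma finite_roots_through:
  assumes "z \<noteq> 0"
  shows "finite {d \<in> Proots M. lor d z = 0}" (is "finite ?S")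
proof (rule ccontr)
  assume inf: "infinite ?S"
  then obtain a where a: "a \<in> ?S" using infinite_imp_nonempty by blast
  have "infinite (?S - {a})" using inf by simp
  then obtain b where b: "b \<in> ?S - {a}" using infinite_imp_nonempty by blast
  have "infinite (?S - {a} - {b})" using inf by simp
  then obtain c where c: "c \<in> ?S - {a} - {b}" using infinite_imp_nonempty by blast
  show False using three_roots_through_point[of a b c z] a b c assms by (auto simp: lor_commute)
qed

text \<open>Sides come arbitrarily close to the end \<open>c1\<close>. The roots through an end of
  the axis are left out because \<open>side_neighbours\<close> does not control their neighbours;
  they are finitely many.\<close>

definition accumulates :: bool where
  "accumulates \<longleftrightarrow> (\<forall>\<rho>>0. \<exists>d\<in>Proots M. lor d c1 \<noteq> 0 \<and> lor d c2 \<noteq> 0 \<and>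
     (\<exists>x\<in>M. lor x d = 0 \<and> lor x c1 \<le> \<rho> * lor x c2))"

text \<open>Points of \<open>M\<close> converge to the end \<open>c1\<close>. Quantitatively, a
  quotient at most \<open>\<sigma>^2\<close> forces \<open>\<bar>Z\<bar> <= 2 \<sigma> Y\<close> by
  \<open>frame_nonneg\<close>, so \<open>Y * lor d c1\<close> dominates the product with
  \<open>d\<close>.\<close>

lemma accumulates_root_nonneg:
  assumes acc: accumulates and d: "d \<in> Proots M"
  shows "lor d c1 \<ge> 0"
proof -
  define C where "C = \<bar>lor d c2\<bar> + \<bar>lor d e\<bar>"
  have C: "C \<ge> 0" by (simp add: C_def)
  have bound: "lor d c1 \<ge> - \<sigma> * C" if s: "0 < \<sigma>" "\<sigma> \<le> 1" for \<sigma>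
  proof -
    obtain x where x: "x \<in> M" "lor x c1 \<le> \<sigma>\<^sup>2 * lor x c2"
      using acc s unfolding accumulates_def by (metis zero_less_power)
    have xh: "x \<in> hypL" using x M_sub by blast
    define X Y Z where D: "X = lor x c1" "Y = lor x c2" "Z = lor x e"
    have Y: "Y > 0" "X > 0" using frame_pos_hypL[OF xh] by (simp_all add: D)
    have "Z\<^sup>2 \<le> 4 * X * Y" using frame_nonneg(3)[of x] xh hypL_subset_closure by (auto simp: D)
    also have "\<dots> \<le> 4 * (\<sigma>\<^sup>2 * Y) * Y" using x Y by (intro mult_right_mono mult_left_mono) (auto simp: D)
    finally have "Z\<^sup>2 \<le> (2 * \<sigma> * Y)\<^sup>2" by (simp add: power2_eq_square mult_ac)
    then have Z: "\<bar>Z\<bar> \<le> 2 * \<sigma> * Y" using s Y by (simp add: abs_le_square_iff[symmetric])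
    have "0 \<le> X * lor d c2 + Y * lor d c1 - Z * lor d e / 2"
      using M_lor_nonneg[OF x(1) d] lor_frame[of x d] by (simp add: D)
    moreover have "X * lor d c2 \<le> \<sigma> * Y * \<bar>lor d c2\<bar>"
    proof -
      have "X * lor d c2 \<le> X * \<bar>lor d c2\<bar>" using Y by (intro mult_left_mono) auto
      also have "X \<le> \<sigma> * Y"
      proof -
        have "\<sigma>\<^sup>2 * Y \<le> \<sigma> * Y" using s Y by (intro mult_right_mono) (auto simp: power2_eq_square)
        then show ?thesis using x by (simp add: D)
      qed
      then have "X * \<bar>lor d c2\<bar> \<le> \<sigma> * Y * \<bar>lor d c2\<bar>" by (intro mult_right_mono) auto
      finally show ?thesis .
    qed
    moreover have "- Z * lor d e / 2 \<le> \<sigma> * Y * \<bar>lor d e\<bar>"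
    proof -
      have "- Z * lor d e \<le> \<bar>Z\<bar> * \<bar>lor d e\<bar>" by (metis abs_ge_self abs_minus_cancel abs_mult)
      also have "\<dots> \<le> 2 * \<sigma> * Y * \<bar>lor d e\<bar>" using Z by (intro mult_right_mono) auto
      finally show ?thesis by simp
    qed
    ultimately have "0 \<le> Y * (lor d c1 + \<sigma> * C)" by (simp add: C_def algebra_simps)
    then show ?thesis using Y by (simp add: zero_le_mult_iff)
  qed
  show ?thesis
  proof (rule ccontr)
    assume n: "\<not> lor d c1 \<ge> 0"
    define D where "D = C + 1"
    have D: "D > 0" "C \<le> D" using C by (simp_all add: D_def)
    define \<sigma> where "\<sigma> = min 1 (- lor d c1 / (2 * D))"
    have "0 < \<sigma>" "\<sigma> \<le> 1" using n D by (auto simp: \<sigma>_def divide_neg_pos)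
    moreover have "\<sigma> * C \<le> - lor d c1 / 2"
    proof -
      have "\<sigma> * C \<le> \<sigma> * D" using \<open>0 < \<sigma>\<close> D by simp
      also have "\<dots> \<le> (- lor d c1 / (2 * D)) * D" using D by (intro mult_right_mono) (auto simp: \<sigma>_def)
      also have "\<dots> = - lor d c1 / 2" using D by simp
      finally show ?thesis .
    qed
    ultimately show False using bound[of \<sigma>] n by simp
  qed
qed

text \<open>Finitely many heights keep \<open>lor d c1 * lor d c2\<close> away from 0 unless it
  vanishes. The inserted 1 covers the case of an empty set.\<close>

lemma height_gap:
  obtains \<theta> where "0 < \<theta>" "\<And>d. d \<in> Proots M \<Longrightarrow> (lor d e)\<^sup>2 \<noteq> 4 \<Longrightarrow> \<theta> \<le> \<bar>(lor d e)\<^sup>2 - 4\<bar>"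
proof -
  define S where "S = (\<lambda>h. \<bar>h\<^sup>2 - 4\<bar>) ` ((\<lambda>d. \<bar>lor d e\<bar>) ` Proots M) - {0}"
  have fin: "finite S" unfolding S_def using finite_h by simp
  define \<theta> where "\<theta> = Min (insert 1 S)"
  have "\<theta> \<in> insert 1 S" unfolding \<theta>_def using fin by (intro Min_in) auto
  then have "\<theta> > 0" by (auto simp: S_def)
  moreover have "\<theta> \<le> \<bar>(lor d e)\<^sup>2 - 4\<bar>" if "d \<in> Proots M" "(lor d e)\<^sup>2 \<noteq> 4" for d
  proof -
    have "\<bar>(lor d e)\<^sup>2 - 4\<bar> \<in> S" using that by (auto simp: S_def image_iff)
    then show ?thesis unfolding \<theta>_def using fin by (intro Min_le) auto
  qed
  ultimately show ?thesis using that by blast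
qed

text \<open>A root close to the end \<open>c1\<close> of the axis does not cross the axis.\<close>
lemma tail_roots:
  assumes A0: "\<And>d. d \<in> Proots M \<Longrightarrow> lor d c1 \<ge> 0" and \<eta>: "\<eta> > 0"
  obtains \<sigma>1 where "\<sigma>1 > 0" "\<And>\<sigma> d. 0 < \<sigma> \<Longrightarrow> \<sigma> \<le> \<sigma>1 \<Longrightarrow> d \<in> Proots M \<Longrightarrow>
    lor d c1 + \<sigma>\<^sup>2 * lor d c2 \<le> 2 * \<sigma> * \<bar>lor d e\<bar> \<Longrightarrow>
    lor d c1 > 0 \<and> lor d c2 \<ge> 0 \<or> lor d c1 = 0 \<and> \<bar>\<sigma> * lor d c2\<bar> \<le> \<eta>"
proof -
  obtain \<theta> where \<theta>: "0 < \<theta>" "\<And>d. d \<in> Proots M \<Longrightarrow> (lor d e)\<^sup>2 \<noteq> 4 \<Longrightarrow> \<theta> \<le> \<bar>(lor d e)\<^sup>2 - 4\<bar>"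
    using height_gap by blast
  define E where "E = {d \<in> Proots M. lor d c1 = 0}"
  have "c1 \<noteq> 0" using c_pos by auto
  then have finE: "finite E" unfolding E_def by (rule finite_roots_through)
  define Bm where "Bm = (\<Sum>d\<in>E. \<bar>lor d c2\<bar>)"
  have Bm: "Bm \<ge> 0" "\<And>d. d \<in> E \<Longrightarrow> \<bar>lor d c2\<bar> \<le> Bm"
    unfolding Bm_def using finE by (auto intro: sum_nonneg member_le_sum)
  define X Y Z where D: "X = lor p c1" "Y = lor p c2" "Z = \<bar>lor p e\<bar>"
  have XY: "X > 0" "Y > 0" using frame_pos_hypL[OF p_hyp] by (simp_all add: D)
  \<comment> \<open>For a root with \<open>lor d c2 < 0\<close>, positivity at \<open>p\<close>
    bounds \<open>- lor d c2\<close> by \<open>\<beta>\<close>. Then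
    \<open>lor d c1 <= \<sigma> * (\<beta> + 4)\<close>, and a small \<open>\<sigma>\<close> pushes
    the product of the two below the gap \<open>\<theta>\<close>.\<close>
  define \<beta> where "\<beta> = 2 * (4 * Y + Z + 1) / X"
  have \<beta>: "\<beta> > 0" using XY by (simp add: \<beta>_def D add_pos_nonneg add_nonneg_pos)
  define Dn where "Dn = (\<beta> + 4) * \<beta>"
  have Dn: "Dn > 0" using \<beta> by (simp add: Dn_def)
  define \<sigma>1 where "\<sigma>1 = Min {1, \<eta> / (Bm + 1), X / (2 * Y), \<theta> / (8 * Dn)}"
  have \<sigma>1: "\<sigma>1 > 0" "\<sigma>1 \<le> 1" "\<sigma>1 \<le> \<eta> / (Bm + 1)" "\<sigma>1 \<le> X / (2 * Y)" "\<sigma>1 \<le> \<theta> / (8 * Dn)"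
    using \<eta> Bm(1) XY \<theta>(1) Dn by (auto simp: \<sigma>1_def add_pos_pos)
  show ?thesis
  proof (rule that[OF \<sigma>1(1)])
    fix \<sigma> d assume s: "0 < \<sigma>" "\<sigma> \<le> \<sigma>1" and d: "d \<in> Proots M"
      and le: "lor d c1 + \<sigma>\<^sup>2 * lor d c2 \<le> 2 * \<sigma> * \<bar>lor d e\<bar>"
    have sb: "\<sigma> \<le> 1" "\<sigma> \<le> \<eta> / (Bm + 1)" "\<sigma> \<le> X / (2 * Y)" "\<sigma> \<le> \<theta> / (8 * Dn)"
      using s \<sigma>1 by linarith+
    show "lor d c1 > 0 \<and> lor d c2 \<ge> 0 \<or> lor d c1 = 0 \<and> \<bar>\<sigma> * lor d c2\<bar> \<le> \<eta>"
    proof (cases "lor d c1 = 0")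
      case True
      then have "\<bar>lor d c2\<bar> \<le> Bm" using Bm(2) d by (simp add: E_def)
      then have "\<bar>\<sigma> * lor d c2\<bar> \<le> \<sigma> * (Bm + 1)" using s by (simp add: abs_mult)
      also have "\<dots> \<le> \<eta> / (Bm + 1) * (Bm + 1)" using sb Bm by (intro mult_right_mono) auto
      also have "\<dots> = \<eta>" using Bm by simp
      finally show ?thesis using True by simp
    next
      case False
      then have A: "lor d c1 > 0" using A0[OF d] by simp
      have "lor d c2 \<ge> 0"
      proof (rule ccontr)
        assume "\<not> lor d c2 \<ge> 0"
        define a b h where abh: "a = lor d c1" "b = - lor d c2" "h = lor d e"
        have ab: "a > 0" "b > 0" using A \<open>\<not> lor d c2 \<ge> 0\<close> by (simp_all add: abh)
        have r: "4 * a * b = 4 - h\<^sup>2" using root_frame[OF d] by (simp add: abh)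
        have "a * b > 0" using ab by simp
        then have h2: "h\<^sup>2 < 4" using r by linarith
        then have "\<bar>h\<bar> < 2" using abs_square_less_1[of "h/2"] by (simp add: power_divide)
        have gap: "\<theta> \<le> 4 * a * b" using \<theta>(2)[OF d] h2 r by (simp add: abh)
        have "\<sigma> * \<bar>h\<bar> \<le> \<sigma> * 2" using s \<open>\<bar>h\<bar> < 2\<close> by (intro mult_left_mono) auto
        then have a1: "a \<le> \<sigma>\<^sup>2 * b + 4 * \<sigma>" using le by (simp add: abh)
        have "\<sigma>\<^sup>2 \<le> \<sigma>" using s sb by (simp add: power2_eq_square)
        have "lor p d = Y * a - X * b - lor p e * h / 2"
          using lor_frame[of p d] by (simp add: D abh)
        moreover have "- lor p e * h \<le> Z * 2"
        proof -
          have "- lor p e * h \<le> Z * \<bar>h\<bar>" by (metis D(3) abs_ge_self abs_minus_cancel abs_mult)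
          also have "\<dots> \<le> Z * 2" using \<open>\<bar>h\<bar> < 2\<close> by (intro mult_left_mono) (auto simp: D)
          finally show ?thesis .
        qed
        ultimately have "X * b < Y * a + Z" using p_pos[OF d] by linarith
        also have "Y * a \<le> Y * (\<sigma>\<^sup>2 * b + 4 * \<sigma>)" using a1 XY by simp
        also have "\<dots> \<le> (X / 2) * b + 4 * Y"
        proof -
          have "Y * \<sigma>\<^sup>2 \<le> Y * \<sigma>" using \<open>\<sigma>\<^sup>2 \<le> \<sigma>\<close> XY by simp
          also have "\<dots> \<le> Y * (X / (2 * Y))" using sb XY by (intro mult_left_mono) auto
          also have "\<dots> = X / 2" using XY by simp
          finally have "Y * \<sigma>\<^sup>2 * b \<le> (X / 2) * b" using ab by (intro mult_right_mono) auto
          moreover have "Y * (4 * \<sigma>) \<le> 4 * Y" using sb XY by simp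
          ultimately show ?thesis by (simp add: algebra_simps)
        qed
        finally have "X * b < 2 * (4 * Y + Z)" by simp
        then have "X * b < X * \<beta>" using XY by (simp add: \<beta>_def)
        then have b: "b < \<beta>" using XY by simp
        have "a \<le> \<sigma> * (\<beta> + 4)"
        proof -
          have "\<sigma>\<^sup>2 * b \<le> \<sigma> * \<beta>" using \<open>\<sigma>\<^sup>2 \<le> \<sigma>\<close> b ab s by (intro mult_mono) auto
          then show ?thesis using a1 by (simp add: algebra_simps)
        qed
        then have "4 * a * b \<le> 4 * (\<sigma> * (\<beta> + 4)) * \<beta>" using ab b s \<beta> by (intro mult_mono) auto
        also have "\<dots> = \<sigma> * (4 * Dn)" by (simp add: Dn_def)
        also have "\<dots> \<le> \<theta> / (8 * Dn) * (4 * Dn)"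
          using sb Dn by (intro mult_right_mono) auto
        also have "\<dots> = \<theta> / 2" using Dn by simp
        finally show False using gap \<theta>(1) by simp
      qed
      then show ?thesis using A by simp
    qed
  qed
qed

end

text \<open>Below, \<open>a\<close> and \<open>b\<close> are the coordinates of a root along the two ends of the axis, normalized at
  a point of the axis.\<close>
lemma mixed_product_le:
  fixes a b a' b' :: real
  assumes "a \<ge> 0 \<and> b \<ge> 0 \<or> a = 0 \<and> \<bar>b\<bar> \<le> 1/4" "a' \<ge> 0 \<and> b' \<ge> 0 \<or> a' = 0 \<and> \<bar>b'\<bar> \<le> 1/4"
    "a + b \<le> S" "a' + b' \<le> T" "0 \<le> S" "0 \<le> T"
  shows "a * b' + b * a' \<le> S * T"
proof -
  have ST: "S * T \<ge> 0" using assms by simp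
  consider "a \<ge> 0" "b \<ge> 0" "a' \<ge> 0" "b' \<ge> 0" | "a = 0" "b < 0" "a' \<ge> 0" | "a' = 0" "b' < 0" "a \<ge> 0"
    using assms(1,2) by linarith
  then show ?thesis
  proof cases
    case 1
    have "a * b' + b * a' \<le> (a + b) * (a' + b')" using 1 by (simp add: algebra_simps)
    also have "\<dots> \<le> S * T" using 1 assms by (intro mult_mono) auto
    finally show ?thesis .
  next
    case 2
    then have "b * a' \<le> 0" by (simp add: mult_nonpos_nonneg)
    then show ?thesis using 2 ST by simp
  next
    case 3
    then have "a * b' \<le> 0" by (simp add: mult_nonneg_nonpos)
    then show ?thesis using 3 ST by simp
  qed
qed

section \<open>Roots near a point of the axis\<close>

context polygon
begin

text \<open>\<open>lor d c1 + \<sigma>^2 * lor d c2\<close> is the value of \<open>d\<close> at the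
  axis vector \<open>c1 + \<sigma>^2 c2\<close>; divided by \<open>\<sigma>\<close> it is the sum of
  the normalized coordinates. The second alternative admits a root through the end
  \<open>c1\<close>, whose other coordinate may be negative but is small.\<close>

definition near_axis :: "real \<Rightarrow> real^3 \<Rightarrow> real \<Rightarrow> bool" where
  "near_axis \<sigma> d S \<longleftrightarrow> d \<in> Proots M \<and> (lor d e)\<^sup>2 < 20 \<and>
     (lor d c1 \<ge> 0 \<and> lor d c2 \<ge> 0 \<or> lor d c1 = 0 \<and> \<bar>\<sigma> * lor d c2\<bar> \<le> 1/4) \<and>
     lor d c1 + \<sigma>\<^sup>2 * lor d c2 \<le> S * \<sigma>"

text \<open>The \<open>e\<close>-part contributes at most
  \<open>((d, e)^2 + (d', e)^2) / 4 < 10\<close>; the rest is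
  \<open>mixed_product_le\<close>.\<close>

lemma near_axis_product_le:
  assumes s: "\<sigma> > 0" and d: "near_axis \<sigma> d S" "near_axis \<sigma> d' T" and ST: "0 \<le> S" "0 \<le> T"
  shows "lor d d' \<le> S * T + 10"
proof -
  have n: "lor c c1 / \<sigma> \<ge> 0 \<and> \<sigma> * lor c c2 \<ge> 0 \<or> lor c c1 / \<sigma> = 0 \<and> \<bar>\<sigma> * lor c c2\<bar> \<le> 1/4"
    "lor c c1 / \<sigma> + \<sigma> * lor c c2 \<le> R" if "near_axis \<sigma> c R" for c R
    using that s by (auto simp: near_axis_def field_simps power2_eq_square)
  have "lor d c1 / \<sigma> * (\<sigma> * lor d' c2) + \<sigma> * lor d c2 * (lor d' c1 / \<sigma>) \<le> S * T"
    by (rule mixed_product_le[OF n(1)[OF d(1)] n(1)[OF d(2)] n(2)[OF d(1)] n(2)[OF d(2)] ST])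
  then have "lor d c1 * lor d' c2 + lor d c2 * lor d' c1 \<le> S * T" using s by simp
  moreover have "- (lor d e * lor d' e / 2) \<le> 10"
  proof -
    have "0 \<le> (lor d e + lor d' e)\<^sup>2" by simp
    then have "- (2 * lor d e * lor d' e) \<le> (lor d e)\<^sup>2 + (lor d' e)\<^sup>2" by (simp add: power2_sum)
    then show ?thesis using d by (simp add: near_axis_def)
  qed
  ultimately show ?thesis using lor_frame[of d d'] by simp
qed

text \<open>Opposite signs make \<open>- (d, e) (d', e) / 2\<close> positive. Only a
  \<open>d'\<close> through \<open>c1\<close> can make the remaining terms negative; it has height
  2, so the positive term is at least 2 and the others are at least -5/4.\<close>

lemma near_axis_opposite_pos:
  assumes s: "\<sigma> > 0" and d: "near_axis \<sigma> d S" "lor d c1 > 0" "lor d c2 \<ge> 0" "S \<le> 5"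
    and d': "near_axis \<sigma> d' T" and sg: "lor d e * lor d' e < 0"
  shows "lor d d' > 0"
proof -
  have h: "(lor d e)\<^sup>2 \<ge> 4"
    using root_frame[of d] d by (simp add: near_axis_def) (smt (verit) mult_nonneg_nonneg)
  show ?thesis
  proof (cases "lor d' c1 \<ge> 0 \<and> lor d' c2 \<ge> 0")
    case True
    then have "lor d c1 * lor d' c2 + lor d c2 * lor d' c1 \<ge> 0" using d by simp
    then show ?thesis using lor_frame[of d d'] sg by simp
  next
    case False
    then have A': "lor d' c1 = 0" "\<bar>\<sigma> * lor d' c2\<bar> \<le> 1/4" using d' by (auto simp: near_axis_def)
    then have "(lor d' e)\<^sup>2 = 4" using root_frame[of d'] d' by (simp add: near_axis_def)
    then have "2\<^sup>2 * 2\<^sup>2 \<le> (lor d e * lor d' e)\<^sup>2" using h by (simp add: power_mult_distrib)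
    then have "4\<^sup>2 \<le> (- (lor d e * lor d' e))\<^sup>2" by simp
    then have "4 \<le> - (lor d e * lor d' e)" by (rule power2_le_imp_le) (use sg in simp)
    moreover have "lor d c1 * lor d' c2 > -2"
    proof -
      have "lor d c1 / \<sigma> \<le> 5"
      proof -
        have "lor d c1 \<le> lor d c1 + \<sigma>\<^sup>2 * lor d c2" using d by simp
        also have "\<dots> \<le> S * \<sigma>" using d by (simp add: near_axis_def)
        also have "\<dots> \<le> 5 * \<sigma>" using d s by simp
        finally show ?thesis using s by (simp add: field_simps)
      qed
      moreover have "lor d c1 / \<sigma> > 0" using d s by simp
      ultimately have "(lor d c1 / \<sigma>) * \<bar>\<sigma> * lor d' c2\<bar> \<le> 5 * (1/4)"
        using A' by (intro mult_mono) auto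
      moreover have "- (lor d c1 * lor d' c2) \<le> (lor d c1 / \<sigma>) * \<bar>\<sigma> * lor d' c2\<bar>"
      proof -
        have "- (lor d c1 * lor d' c2) = (lor d c1 / \<sigma>) * (- (\<sigma> * lor d' c2))" using s by simp
        also have "\<dots> \<le> (lor d c1 / \<sigma>) * \<bar>\<sigma> * lor d' c2\<bar>"
          using \<open>lor d c1 / \<sigma> > 0\<close> by (intro mult_left_mono) auto
        finally show ?thesis .
      qed
      ultimately have "- (lor d c1 * lor d' c2) \<le> 5 * (1/4)" by (rule order_trans[rotated])
      then show ?thesis by simp
    qed
    ultimately show ?thesis using lor_frame[of d d'] A' by simp
  qed
qed

context
  fixes \<sigma>1 \<eta> :: real
  assumes sigma1: "\<sigma>1 > 0"
    and eta: "\<eta> > 0" "\<eta> \<le> 1/4" "\<And>d. d \<in> Proots M \<Longrightarrow> (lor d e)\<^sup>2 \<noteq> 4 \<Longrightarrow> 5 * \<eta>\<^sup>2 \<le> \<bar>(lor d e)\<^sup>2 - 4\<bar>"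
    and tail: "\<And>\<sigma> d. 0 < \<sigma> \<Longrightarrow> \<sigma> \<le> \<sigma>1 \<Longrightarrow> d \<in> Proots M \<Longrightarrow>
      lor d c1 + \<sigma>\<^sup>2 * lor d c2 \<le> 2 * \<sigma> * \<bar>lor d e\<bar> \<Longrightarrow>
      lor d c1 > 0 \<and> lor d c2 \<ge> 0 \<or> lor d c1 = 0 \<and> \<bar>\<sigma> * lor d c2\<bar> \<le> \<eta>"
    and big: "\<And>d. d \<in> Proots M \<Longrightarrow> (lor d e)\<^sup>2 \<ge> 20 \<Longrightarrow> isolated (\<lambda>d. \<bar>lor d e\<bar>) d"
begin

text \<open>Normalized at its own foot on the axis, \<open>T\<close> has two equal coordinates
  \<open>q\<close>, so orthogonality determines the coordinate sum \<open>S\<close> of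
  \<open>d\<close>: \<open>2 q S = (T, e) (d, e)\<close>. Since
  \<open>4 q^2 = (T, e)^2 - 4 >= (4/5) (T, e)^2\<close>, it follows that
  \<open>S^2 <= (5/4) (d, e)^2 < 25\<close>, the origin of the constant 5.\<close>

lemma big_neighbour:
  assumes T: "T \<in> Proots M" "(lor T e)\<^sup>2 \<ge> 20" "lor T c1 = \<sigma>\<^sup>2 * lor T c2" "lor T c1 > 0"
    and s: "0 < \<sigma>" "\<sigma> \<le> \<sigma>1" and d: "nbr T d"
  shows "near_axis \<sigma> d 5" "lor d c1 > 0" "lor d c2 \<ge> 0" "lor d e * lor T e > 0" "lor T d = 0"
proof -
  have dP: "d \<in> Proots M" using d by (simp add: nbr_def)
  have iso: "isolated (\<lambda>d. \<bar>lor d e\<bar>) T" using big T by blast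
  then show o: "lor T d = 0" using d by (auto simp: isolated_def)
  have h20: "(lor d e)\<^sup>2 < 20" using isolated_nbr[OF iso d] big[OF dP] by (meson not_le)
  define q where "q = \<sigma> * lor T c2"
  have A: "lor T c1 = \<sigma> * q" using T(3) by (simp add: q_def power2_eq_square)
  have q: "q > 0" using T(4) s A by (simp add: zero_less_mult_iff)
  have q2: "4 * q\<^sup>2 = (lor T e)\<^sup>2 - 4"
    using root_frame[OF T(1)] A s by (simp add: q_def power2_eq_square mult_ac)
  define S where "S = lor d c1 / \<sigma> + \<sigma> * lor d c2"
  have S: "lor d c1 + \<sigma>\<^sup>2 * lor d c2 = \<sigma> * S" using s by (simp add: S_def power2_eq_square field_simps)
  have "lor T d = q * S - lor T e * lor d e / 2"
  proof -
    have "lor T c2 = q / \<sigma>" using s by (simp add: q_def)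
    then show ?thesis unfolding lor_frame[of T d] A S_def using s by (simp add: field_simps)
  qed
  then have qS: "2 * q * S = lor T e * lor d e" using o by simp
  then have "(2 * q * S)\<^sup>2 = (lor T e * lor d e)\<^sup>2" by simp
  then have S2: "S\<^sup>2 * ((lor T e)\<^sup>2 - 4) = (lor T e)\<^sup>2 * (lor d e)\<^sup>2"
    using q2 by (simp add: power_mult_distrib mult_ac)
  have "S\<^sup>2 * ((4/5) * (lor T e)\<^sup>2) \<le> S\<^sup>2 * ((lor T e)\<^sup>2 - 4)"
    using T(2) by (intro mult_left_mono) auto
  then have "(lor T e)\<^sup>2 * ((4/5) * S\<^sup>2) \<le> (lor T e)\<^sup>2 * (lor d e)\<^sup>2" using S2 by (simp add: mult_ac)
  then have S2h: "(4/5) * S\<^sup>2 \<le> (lor d e)\<^sup>2" using T(2) by (smt (verit) mult_le_cancel_left_pos)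
  then have "S\<^sup>2 \<le> 5\<^sup>2" using h20 by simp
  then have S5: "S \<le> 5" using power2_le_imp_le[of S 5] by simp
  have "S\<^sup>2 \<le> 4 * (lor d e)\<^sup>2" using S2h zero_le_power2[of "lor d e"] by linarith
  then have "S\<^sup>2 \<le> (2 * \<bar>lor d e\<bar>)\<^sup>2" by (simp add: power_mult_distrib)
  then have "S \<le> 2 * \<bar>lor d e\<bar>" by (rule power2_le_imp_le) simp
  then have "\<sigma> * S \<le> \<sigma> * (2 * \<bar>lor d e\<bar>)" using s by (intro mult_left_mono) auto
  then have "lor d c1 > 0 \<and> lor d c2 \<ge> 0 \<or> lor d c1 = 0 \<and> \<bar>\<sigma> * lor d c2\<bar> \<le> \<eta>"
    using tail[OF s dP] S by (simp add: mult_ac)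
  \<comment> \<open>A root through \<open>c1\<close> has height 2, which forces
    \<open>S^2 > 4\<close>, against the small bound on \<open>S\<close>.\<close>
  moreover have "\<not> (lor d c1 = 0 \<and> \<bar>\<sigma> * lor d c2\<bar> \<le> \<eta>)"
  proof
    assume a: "lor d c1 = 0 \<and> \<bar>\<sigma> * lor d c2\<bar> \<le> \<eta>"
    then have "(lor d e)\<^sup>2 = 4" using root_frame[OF dP] by simp
    then have "S\<^sup>2 * ((lor T e)\<^sup>2 - 4) = 4 * (lor T e)\<^sup>2" using S2 by simp
    moreover have "\<bar>S\<bar> \<le> 1" using a eta by (simp add: S_def)
    then have "S\<^sup>2 \<le> 1" by (simp add: abs_square_le_1)
    then have "S\<^sup>2 * ((lor T e)\<^sup>2 - 4) \<le> 1 * ((lor T e)\<^sup>2 - 4)" using T(2) by (intro mult_right_mono) auto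
    ultimately show False using T(2) by simp
  qed
  ultimately show AB: "lor d c1 > 0" "lor d c2 \<ge> 0" by auto
  then show "near_axis \<sigma> d 5"
    using dP h20 S S5 s by (simp add: near_axis_def mult_ac)
  have "S > 0" using AB s by (simp add: S_def add_pos_nonneg)
  then have "lor T e * lor d e > 0" using qS q by (metis mult_pos_pos zero_less_numeral)
  then show "lor d e * lor T e > 0" by (simp add: mult.commute)
qed

text \<open>An ideal point across the axis with quotient \<open>\<sigma>^2\<close> is covered by a
  root \<open>d\<close>. If \<open>d\<close> is too high it is isolated by \<open>big\<close>, and a
  neighbour of \<open>d\<close>, which lies on the same side of the axis, takes its place.\<close>

lemma opposite_side:
  assumes t: "t = 1 \<or> t = -1" and s: "0 < \<sigma>" "\<sigma> \<le> \<sigma>1 / 2"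
  shows "\<exists>d. near_axis \<sigma> d (81/10) \<and> t * lor d e < 0"
proof -
  have "t * \<sigma> \<noteq> 0" using t s by auto
  have tt: "t\<^sup>2 = 1" "t * t = 1" using t by auto
  obtain d where d: "d \<in> Proots M" "lor d c1 + (t * \<sigma>)\<^sup>2 * lor d c2 + t * \<sigma> * lor d e \<le> 0"
    using row_covered[OF \<open>t * \<sigma> \<noteq> 0\<close>] by blast
  define h where "h = - t * lor d e"
  have h2: "h\<^sup>2 = (lor d e)\<^sup>2" using tt by (simp add: h_def power_mult_distrib)
  have habs: "\<bar>h\<bar> = \<bar>lor d e\<bar>" using t by (auto simp: h_def)
  have le: "lor d c1 + \<sigma>\<^sup>2 * lor d c2 \<le> \<sigma> * h"
    using d(2) tt by (simp add: h_def power_mult_distrib mult_ac)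
  also have "\<sigma> * h \<le> \<sigma> * (2 * \<bar>lor d e\<bar>)" using s habs by (intro mult_left_mono) auto
  finally have tl: "lor d c1 > 0 \<and> lor d c2 \<ge> 0 \<or> lor d c1 = 0 \<and> \<bar>\<sigma> * lor d c2\<bar> \<le> \<eta>"
    using tail[of \<sigma> d] s d(1) sigma1 by (simp add: mult_ac)
  have hpos: "h > 0"
  proof (cases "lor d c1 > 0 \<and> lor d c2 \<ge> 0")
    case True
    then have "lor d c1 + \<sigma>\<^sup>2 * lor d c2 > 0" by (simp add: add_pos_nonneg)
    then have "\<sigma> * h > 0" using le by linarith
    then show ?thesis using s by (simp add: zero_less_mult_iff)
  next
    case False
    then have a: "lor d c1 = 0" "\<bar>\<sigma> * lor d c2\<bar> \<le> \<eta>" using tl by auto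
    then have "h\<^sup>2 = 2\<^sup>2" using root_frame[OF d(1)] h2 by simp
    then have "h = 2 \<or> h = -2" using power2_eq_iff by blast
    moreover have "h \<noteq> -2"
    proof
      assume "h = -2"
      then have "\<sigma> * (\<sigma> * lor d c2) \<le> \<sigma> * (-2)" using le a by (simp add: power2_eq_square)
      then have "\<sigma> * lor d c2 \<le> -2" using s by (simp only: mult_le_cancel_left_pos)
      then show False using a eta by linarith
    qed
    ultimately show ?thesis by auto
  qed
  then have sg: "t * lor d e < 0" by (simp add: h_def)
  show ?thesis
  proof (cases "h\<^sup>2 < 20")
    case True
    then have "h\<^sup>2 \<le> 5\<^sup>2" by simp
    then have "h \<le> 5" by (rule power2_le_imp_le) simp
    then have "\<sigma> * h \<le> \<sigma> * (81/10)" using s by (intro mult_left_mono) auto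
    then have "near_axis \<sigma> d (81/10)"
      using d(1) True h2 tl le eta by (auto simp: near_axis_def mult_ac)
    then show ?thesis using sg by blast
  next
    case False
    then have h20: "h\<^sup>2 \<ge> 20" by simp
    have prod: "4 * (lor d c1 * lor d c2) = h\<^sup>2 - 4" using root_frame[OF d(1)] h2 by simp
    then have "lor d c1 \<noteq> 0" "lor d c2 \<noteq> 0" using h20 by auto
    then have AB: "lor d c1 > 0" "lor d c2 > 0" using tl by auto
    \<comment> \<open>The foot of \<open>d\<close> on the axis has quotient
      \<open>(\<sigma> v)^2\<close>. Together \<open>q (v + 1/v) <= h\<close>,
      \<open>4 q^2 = h^2 - 4\<close> and \<open>h^2 >= 20\<close> give
      \<open>v + 1/v <= sqrt 5\<close>, so \<open>v\<close> and \<open>1/v\<close> are at most the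
      golden ratio.\<close>
    define v where "v = sqrt (lor d c1 / lor d c2) / \<sigma>"
    have v: "v > 0" using AB s by (simp add: v_def)
    have sv: "(\<sigma> * v)\<^sup>2 = lor d c1 / lor d c2" using AB s by (simp add: v_def)
    define q where "q = \<sigma> * v * lor d c2"
    have q: "q > 0" using v s AB by (simp add: q_def)
    have A: "lor d c1 = (\<sigma> * v)\<^sup>2 * lor d c2" using sv AB by simp
    have B: "lor d c2 = q / (\<sigma> * v)" using s v by (simp add: q_def)
    have A': "lor d c1 = \<sigma> * v * q" unfolding A by (simp add: q_def power2_eq_square)
    have q2: "4 * q\<^sup>2 = h\<^sup>2 - 4" using prod unfolding A' B using s v by (simp add: power2_eq_square)
    have "q * (v + 1 / v) \<le> h"
    proof -
      have "lor d c1 + \<sigma>\<^sup>2 * lor d c2 = \<sigma> * (q * (v + 1 / v))"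
        unfolding A' B using s v by (simp add: power2_eq_square field_simps)
      then show ?thesis using le s by simp
    qed
    then have "(q * (v + 1 / v))\<^sup>2 \<le> h\<^sup>2" using q v by (intro power_mono) auto
    also have "\<dots> \<le> 5 * q\<^sup>2" using q2 h20 by simp
    finally have "q\<^sup>2 * (v + 1 / v)\<^sup>2 \<le> q\<^sup>2 * 5" by (simp add: power_mult_distrib)
    then have "(v + 1 / v)\<^sup>2 \<le> 5" using q by simp
    also have "5 \<le> (2237/1000 :: real)\<^sup>2" by (simp add: power2_eq_square)
    finally have vv: "v + 1 / v \<le> 2237/1000" by (rule power2_le_imp_le) simp
    \<comment> \<open>2.237 exceeds \<open>sqrt 5\<close> and is 1.62 + 0.617, a sum of two numbers
      with product below 1; so 1.62 is a rational bound above the golden ratio.\<close>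
    have bound: "u \<le> 162/100" if "u > 0" "u + 1 / u \<le> 2237/1000" for u :: real
    proof (rule ccontr)
      assume "\<not> u \<le> 162/100"
      then have u: "u > 162/100" by simp
      have "u * u + 1 \<le> 2237/1000 * u" using that by (simp add: field_simps)
      moreover have "(u - 162/100) * (u - 617/1000) > 0" using u by simp
      moreover have "(u - 162/100) * (u - 617/1000) = u * u - 2237/1000 * u + 99954/100000"
        by (simp add: field_simps)
      ultimately show False by linarith
    qed
    have v1: "v \<le> 162/100" using bound[OF v vv] .
    have v2: "1 / v \<le> 162/100" using bound[of "1/v"] v vv by (simp add: add.commute)
    have sv1: "0 < \<sigma> * v" "\<sigma> * v \<le> \<sigma>1"
    proof -
      show "0 < \<sigma> * v" using s v by simp
      have "\<sigma> * v \<le> (\<sigma>1 / 2) * 2" using s v v1 by (intro mult_mono) auto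
      then show "\<sigma> * v \<le> \<sigma>1" by simp
    qed
    have "lor c1 d \<noteq> 0" "lor c2 d \<noteq> 0" using AB by (simp_all add: lor_commute)
    then obtain n where n: "nbr d n" using two_nbrs_of_not_end[OF d(1)] unfolding two_nbrs_def by blast
    have N: "near_axis (\<sigma> * v) n 5" "lor n c1 > 0" "lor n c2 \<ge> 0" "lor n e * lor d e > 0"
      using big_neighbour[OF d(1) _ A AB(1) sv1 n] h20 h2 by auto
    \<comment> \<open>Moving the base point from \<open>\<sigma> v\<close> to
      \<open>\<sigma>\<close> multiplies the normalized coordinates by \<open>v\<close> and
      \<open>1/v\<close>, which turns 5 into 5 * 1.62 = 8.1.\<close>
    have "lor n c1 + \<sigma>\<^sup>2 * lor n c2 \<le> 81/10 * \<sigma>"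
    proof -
      define a b where "a = lor n c1 / (\<sigma> * v)" "b = (\<sigma> * v) * lor n c2"
      have ab: "a \<ge> 0" "b \<ge> 0" using N s v by (simp_all add: a_b_def)
      have "lor n c1 + (\<sigma> * v)\<^sup>2 * lor n c2 = (\<sigma> * v) * (a + b)"
        using s v by (simp add: a_b_def power2_eq_square field_simps)
      then have "(\<sigma> * v) * (a + b) \<le> (\<sigma> * v) * 5" using N(1) by (simp add: near_axis_def mult_ac)
      then have ab5: "a + b \<le> 5" using sv1(1) by (simp only: mult_le_cancel_left_pos)
      have "a * v \<le> a * (162/100)" "b * (1 / v) \<le> b * (162/100)"
        using ab v1 v2 by (intro mult_left_mono; simp)+
      then have "a * v + b * (1 / v) \<le> 81/10" using ab5 by linarith
      then have "\<sigma> * (a * v + b * (1 / v)) \<le> \<sigma> * (81/10)" using s by (intro mult_left_mono) auto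
      moreover have "\<sigma> * (a * v + b * (1 / v)) = lor n c1 + \<sigma>\<^sup>2 * lor n c2"
        using s v by (simp add: a_b_def power2_eq_square field_simps)
      ultimately show ?thesis by simp
    qed
    then have "near_axis \<sigma> n (81/10)" using N by (auto simp: near_axis_def)
    moreover have "t * lor n e < 0"
    proof -
      have "(t * lor n e) * (t * lor d e) = (t * t) * (lor n e * lor d e)" by (simp only: mult_ac)
      then have "(t * lor n e) * (t * lor d e) > 0" using N(4) by (simp only: tt(2) mult_1_left)
      from zero_less_mult_iff[THEN iffD1, OF this] show ?thesis using sg by linarith
    qed
    ultimately show ?thesis by blast
  qed
qed

text \<open>\<open>T\<close> plays the part of the common orthogonal root in
  \<open>good_triple_orth\<close>. Its neighbours lie on its side of the axis, so the root across
  the axis differs from all three.\<close>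

lemma good_triple_big:
  assumes T: "T \<in> Proots M" "(lor T e)\<^sup>2 \<ge> 20" "lor T c1 = \<sigma>\<^sup>2 * lor T c2" "lor T c1 > 0"
    and s: "0 < \<sigma>" "\<sigma> \<le> \<sigma>1 / 2"
  shows "good_triple (Proots M)"
proof -
  have s1: "\<sigma> \<le> \<sigma>1" using s sigma1 by simp
  have c2: "lor T c2 > 0" using T(3,4) s by (simp add: zero_less_mult_iff)
  then have "lor c1 T \<noteq> 0" "lor c2 T \<noteq> 0" using T(4) by (simp_all add: lor_commute)
  then obtain a b where ab: "a \<noteq> b" "nbr T a" "nbr T b"
    using two_nbrs_of_not_end[OF T(1)] unfolding two_nbrs_def by blast
  note A = big_neighbour[OF T s(1) s1 ab(2)] and B = big_neighbour[OF T s(1) s1 ab(3)]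
  define t :: real where "t = sgn (lor T e)"
  have "lor T e \<noteq> 0" using T(2) by auto
  then have t: "t = 1 \<or> t = -1" "t * lor T e > 0" by (auto simp: t_def sgn_if)
  obtain c where c: "near_axis \<sigma> c (81/10)" "t * lor c e < 0" using opposite_side[OF t(1) s] by blast
  have ta: "t * lor a e > 0" "t * lor b e > 0"
    using A(4) B(4) t by (auto simp: zero_less_mult_iff)
  have ne: "c \<noteq> T" "c \<noteq> a" "c \<noteq> b" using c(2) ta t(2) by auto
  have P: "a \<in> Proots M" "b \<in> Proots M" "c \<in> Proots M" "a \<noteq> T" "b \<noteq> T"
    using ab c by (auto simp: nbr_def near_axis_def)
  have iso: "isolated (\<lambda>d. \<bar>lor d e\<bar>) T" using big T by blast
  have "lor a b \<le> 7"
  proof -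
    have "\<bar>lor a e\<bar> \<le> \<bar>lor T e\<bar>" "\<bar>lor b e\<bar> \<le> \<bar>lor T e\<bar>"
      using iso ab unfolding isolated_def by fastforce+
    then show ?thesis
      using root_product_bound[of T a b e] root P T(1,2) A(5) B(5) ee by simp
  qed
  moreover have "lor a c \<le> 5 * (81/10) + 10" "lor b c \<le> 5 * (81/10) + 10"
    using near_axis_product_le[OF s(1) A(1) c(1)] near_axis_product_le[OF s(1) B(1) c(1)] by simp_all
  ultimately show ?thesis
    using good_triple_orth[of T a b c] T(1) P ne ab(1) A(5) B(5) by auto
qed

text \<open>The root \<open>c\<close> across the axis has positive products with \<open>d\<close>
  and \<open>n\<close>, which makes the triple connected even if \<open>d\<close> and
  \<open>n\<close> are orthogonal.\<close>

lemma good_triple_small: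
  assumes d: "d \<in> Proots M" "(lor d e)\<^sup>2 < 20" "lor d c1 > 0" "lor d c2 > 0"
    and n: "nbr d n" "(lor n e)\<^sup>2 < 20"
    and z: "z \<in> hypL_closure" "lor z d = 0" "lor z n = 0" "lor z c1 = \<sigma>\<^sup>2 * lor z c2" "lor z c2 > 0"
    and s: "0 < \<sigma>" "\<sigma> \<le> \<sigma>1 / 2"
  shows "good_triple (Proots M)"
proof -
  have s1: "\<sigma> \<le> \<sigma>1" using s sigma1 by simp
  have nP: "n \<in> Proots M" "n \<noteq> d" using n by (auto simp: nbr_def)
  \<comment> \<open>\<open>\<zeta>\<close> is the signed position of \<open>z\<close> on its line
    orthogonal to the axis, with 1 and -1 at the ideal ends. A root \<open>c\<close> vanishing at
    \<open>z\<close> satisfies \<open>lor c c1 + \<sigma>^2 * lor c c2 = \<sigma> * \<zeta> * lor c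
    e\<close>, so the sign of \<open>\<zeta>\<close> decides its side of the axis.\<close>
  define \<zeta> where "\<zeta> = lor z e / (2 * \<sigma> * lor z c2)"
  have ze: "lor z e = 2 * \<sigma> * lor z c2 * \<zeta>" using s z by (simp add: \<zeta>_def)
  have "(lor z e)\<^sup>2 \<le> 4 * lor z c1 * lor z c2" using frame_nonneg(3)[OF z(1)] .
  then have "(2 * \<sigma> * lor z c2)\<^sup>2 * \<zeta>\<^sup>2 \<le> (2 * \<sigma> * lor z c2)\<^sup>2 * 1"
    unfolding ze z(4) by (simp add: power2_eq_square mult_ac)
  moreover have "(2 * \<sigma> * lor z c2)\<^sup>2 > 0" using s z by simp
  ultimately have z2: "\<zeta>\<^sup>2 \<le> 1" by (simp only: mult_le_cancel_left_pos)
  have pos: "lor c c1 + \<sigma>\<^sup>2 * lor c c2 = \<sigma> * (\<zeta> * lor c e)" if "lor z c = 0" for c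
  proof -
    have "lor z c2 * (lor c c1 + \<sigma>\<^sup>2 * lor c c2) = lor z c2 * (\<sigma> * (\<zeta> * lor c e))"
      using that lor_frame[of z c] unfolding z(4) ze by (simp add: algebra_simps)
    then show ?thesis using z(5) by simp
  qed
  have \<zeta>le: "\<zeta> * x \<le> \<bar>x\<bar>" for x
  proof -
    have "\<bar>\<zeta>\<bar> \<le> 1" using z2 by (simp add: abs_square_le_1)
    then have "\<bar>\<zeta>\<bar> * \<bar>x\<bar> \<le> 1 * \<bar>x\<bar>" by (intro mult_right_mono) auto
    then show ?thesis by (metis abs_ge_self abs_mult mult_1 order_trans)
  qed
  have h5: "\<bar>lor c e\<bar> \<le> 5" if "(lor c e)\<^sup>2 < 20" for c
  proof -
    have "\<bar>lor c e\<bar>\<^sup>2 \<le> 5\<^sup>2" using that by simp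
    then show ?thesis by (rule power2_le_imp_le) simp
  qed
  have n_tail: "lor n c1 > 0 \<and> lor n c2 \<ge> 0 \<or> lor n c1 = 0 \<and> \<bar>\<sigma> * lor n c2\<bar> \<le> \<eta>"
  proof (rule tail[OF s(1) s1 nP(1)])
    have "\<zeta> * lor n e \<le> 2 * \<bar>lor n e\<bar>" using \<zeta>le[of "lor n e"] by linarith
    then have "\<sigma> * (\<zeta> * lor n e) \<le> \<sigma> * (2 * \<bar>lor n e\<bar>)" using s by (intro mult_left_mono) auto
    then show "lor n c1 + \<sigma>\<^sup>2 * lor n c2 \<le> 2 * \<sigma> * \<bar>lor n e\<bar>" using pos[OF z(3)] by (simp add: mult_ac)
  qed
  have dpos: "\<zeta> * lor d e > 0"
  proof -
    have "lor d c1 + \<sigma>\<^sup>2 * lor d c2 > 0" using d by (simp add: add_pos_nonneg)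
    then show ?thesis using pos[OF z(2)] s by (simp add: zero_less_mult_iff)
  qed
  \<comment> \<open>If \<open>n\<close> passed through \<open>c1\<close>, its height would be 2 and
    \<open>4 \<zeta>^2 <= \<eta>^2\<close>. The gap and the arithmetic-geometric mean inequality
    give \<open>5 \<eta>^2 <= (d, e)^2 - 4 <= (\<zeta> (d, e))^2\<close>, against
    \<open>(d, e)^2 < 20\<close>.\<close>
  have n_not: "\<not> (lor n c1 = 0 \<and> \<bar>\<sigma> * lor n c2\<bar> \<le> \<eta>)"
  proof
    assume a: "lor n c1 = 0 \<and> \<bar>\<sigma> * lor n c2\<bar> \<le> \<eta>"
    then have hn: "(lor n e)\<^sup>2 = 4" using root_frame[OF nP(1)] by simp
    have "\<sigma> * (\<sigma> * lor n c2) = \<sigma> * (\<zeta> * lor n e)" using pos[OF z(3)] a by (simp add: power2_eq_square)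
    then have "\<zeta> * lor n e = \<sigma> * lor n c2" using s by simp
    then have "\<bar>\<zeta> * lor n e\<bar> \<le> \<eta>" using a by simp
    then have "\<bar>\<zeta> * lor n e\<bar>\<^sup>2 \<le> \<eta>\<^sup>2" by (intro power_mono) auto
    then have zz: "4 * \<zeta>\<^sup>2 \<le> \<eta>\<^sup>2" using hn by (simp add: power_mult_distrib mult.commute)
    have prod: "4 * (lor d c1 * lor d c2) = (lor d e)\<^sup>2 - 4" using root_frame[OF d(1)] by simp
    moreover have "lor d c1 * lor d c2 > 0" using d by simp
    ultimately have "(lor d e)\<^sup>2 > 4" by linarith
    then have "5 * \<eta>\<^sup>2 \<le> (lor d e)\<^sup>2 - 4" using eta(3)[OF d(1)] by simp
    also have "\<dots> \<le> (\<zeta> * lor d e)\<^sup>2"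
    proof -
      define a b where "a = lor d c1 / \<sigma>" "b = \<sigma> * lor d c2"
      have "\<sigma> * (a + b) = lor d c1 + \<sigma>\<^sup>2 * lor d c2"
        using s by (simp add: a_b_def power2_eq_square field_simps)
      then have "\<zeta> * lor d e = a + b" using pos[OF z(2)] s by simp
      moreover have "4 * (a * b) = (lor d e)\<^sup>2 - 4" using prod s by (simp add: a_b_def)
      moreover have "4 * (a * b) \<le> (a + b)\<^sup>2" using zero_le_power2[of "a - b"] by (simp add: power2_eq_square algebra_simps)
      ultimately show ?thesis by simp
    qed
    also have "\<dots> \<le> \<zeta>\<^sup>2 * 20" unfolding power_mult_distrib using d(2) by (intro mult_left_mono) auto
    also have "\<dots> \<le> 5 * \<eta>\<^sup>2" using zz by simp
    finally have "(\<zeta> * lor d e)\<^sup>2 = \<zeta>\<^sup>2 * 20" using \<open>5 * \<eta>\<^sup>2 \<le> (lor d e)\<^sup>2 - 4\<close> zz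
      using \<open>(lor d e)\<^sup>2 - 4 \<le> (\<zeta> * lor d e)\<^sup>2\<close> \<open>(\<zeta> * lor d e)\<^sup>2 \<le> \<zeta>\<^sup>2 * 20\<close> by linarith
    then have "\<zeta>\<^sup>2 * ((lor d e)\<^sup>2 - 20) = 0" by (simp add: power_mult_distrib right_diff_distrib)
    then show False using d(2) dpos by auto
  qed
  then have nAB: "lor n c1 > 0" "lor n c2 \<ge> 0" using n_tail by auto
  have npos: "\<zeta> * lor n e > 0"
  proof -
    have "lor n c1 + \<sigma>\<^sup>2 * lor n c2 > 0" using nAB by (simp add: add_pos_nonneg)
    then show ?thesis using pos[OF z(3)] s by (simp add: zero_less_mult_iff)
  qed
  have near: "near_axis \<sigma> c 5" if "c \<in> Proots M" "(lor c e)\<^sup>2 < 20" "lor z c = 0" "lor c c1 > 0" "lor c c2 \<ge> 0" for c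
  proof -
    have "\<zeta> * lor c e \<le> 5" using \<zeta>le[of "lor c e"] h5[OF that(2)] by linarith
    then have "\<sigma> * (\<zeta> * lor c e) \<le> \<sigma> * 5" using s by (intro mult_left_mono) auto
    then show ?thesis using that pos[OF that(3)] by (simp add: near_axis_def mult_ac)
  qed
  have D: "near_axis \<sigma> d 5" and N: "near_axis \<sigma> n 5" using near d z n nP nAB by auto
  define t :: real where "t = sgn \<zeta>"
  have "\<zeta> \<noteq> 0" using dpos by auto
  then have t: "t = 1 \<or> t = -1" "t * \<zeta> > 0" by (auto simp: t_def sgn_if)
  have th: "t * lor d e > 0" "t * lor n e > 0"
    using t(2) dpos npos by (auto simp: zero_less_mult_iff)
  obtain c where c: "near_axis \<sigma> c (81/10)" "t * lor c e < 0" using opposite_side[OF t(1) s] by blast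
  have ne: "c \<noteq> d" "c \<noteq> n" using c(2) th by auto
  have sg: "lor d e * lor c e < 0" "lor n e * lor c e < 0"
    using th c(2) by (auto simp: zero_less_mult_iff mult_less_0_iff)
  have pc: "lor d c > 0" "lor n c > 0"
    using near_axis_opposite_pos[OF s(1) D _ _ _ c(1) sg(1)] near_axis_opposite_pos[OF s(1) N _ _ _ c(1) sg(2)] d nAB by auto
  have "lor d c \<le> 5 * (81/10) + 10" "lor n c \<le> 5 * (81/10) + 10"
    using near_axis_product_le[OF s(1) D c(1)] near_axis_product_le[OF s(1) N c(1)] by simp_all
  moreover have "lor d n \<le> 2" using nbr_le[OF n(1)] by simp
  moreover have "conn3 d n c" using pc unfolding conn3_def by (auto simp: lor_commute)
  ultimately show ?thesis unfolding good_triple_def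
    using d(1) nP ne c(1) by (intro bexI[of _ d] bexI[of _ n] bexI[of _ c]) (auto simp: near_axis_def)
qed

end

end

context polygon
begin

lemma side_point_tail:
  assumes z: "z \<in> hypL_closure" "lor z c = 0" "lor z c1 = \<sigma>\<^sup>2 * lor z c2" "lor z c2 > 0" "\<sigma> > 0"
  shows "lor c c1 + \<sigma>\<^sup>2 * lor c c2 \<le> \<sigma> * \<bar>lor c e\<bar>"
proof -
  have "(lor z e)\<^sup>2 \<le> (2 * \<sigma> * lor z c2)\<^sup>2"
    using frame_nonneg(3)[OF z(1)] by (simp add: z(3) power2_eq_square mult_ac)
  then have "\<bar>lor z e\<bar>\<^sup>2 \<le> (2 * \<sigma> * lor z c2)\<^sup>2" by simp
  then have ze: "\<bar>lor z e\<bar> \<le> 2 * \<sigma> * lor z c2" by (rule power2_le_imp_le) (use z in simp)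
  have "lor z c2 * (lor c c1 + \<sigma>\<^sup>2 * lor c c2) = lor z e * lor c e / 2"
    using lor_frame[of z c] z(2) by (simp add: z(3) algebra_simps)
  also have "\<dots> \<le> \<bar>lor z e\<bar> * \<bar>lor c e\<bar> / 2" by (simp add: abs_mult[symmetric])
  also have "\<dots> \<le> 2 * \<sigma> * lor z c2 * \<bar>lor c e\<bar> / 2"
    using ze by (intro divide_right_mono mult_right_mono) auto
  finally have "lor z c2 * (lor c c1 + \<sigma>\<^sup>2 * lor c c2) \<le> lor z c2 * (\<sigma> * \<bar>lor c e\<bar>)" by (simp add: mult_ac)
  then show ?thesis using z(4) by simp
qed

lemma good_triple_accumulating:
  assumes acc: accumulates
    and big: "\<And>d. d \<in> Proots M \<Longrightarrow> (lor d e)\<^sup>2 \<ge> 20 \<Longrightarrow> isolated (\<lambda>d. \<bar>lor d e\<bar>) d"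
  shows "good_triple (Proots M)"
proof -
  obtain \<theta> where \<theta>: "0 < \<theta>" "\<And>d. d \<in> Proots M \<Longrightarrow> (lor d e)\<^sup>2 \<noteq> 4 \<Longrightarrow> \<theta> \<le> \<bar>(lor d e)\<^sup>2 - 4\<bar>"
    using height_gap by blast
  \<comment> \<open>The 5 is the quotient of the bound 20 on squared heights and the squared height
    4 of a root through \<open>c1\<close>.\<close>
  define \<eta> where "\<eta> = min (1/4) (sqrt (\<theta> / 5))"
  have \<eta>: "\<eta> > 0" "\<eta> \<le> 1/4" using \<theta>(1) by (auto simp: \<eta>_def)
  have "\<eta>\<^sup>2 \<le> (sqrt (\<theta> / 5))\<^sup>2" using \<eta> by (intro power_mono) (auto simp: \<eta>_def)
  then have "5 * \<eta>\<^sup>2 \<le> \<theta>" using \<theta>(1) by simp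
  then have gap: "5 * \<eta>\<^sup>2 \<le> \<bar>(lor d e)\<^sup>2 - 4\<bar>" if "d \<in> Proots M" "(lor d e)\<^sup>2 \<noteq> 4" for d
    using \<theta>(2)[OF that] by linarith
  obtain \<sigma>1 where \<sigma>1: "\<sigma>1 > 0" and tail: "\<And>\<sigma> d. 0 < \<sigma> \<Longrightarrow> \<sigma> \<le> \<sigma>1 \<Longrightarrow> d \<in> Proots M \<Longrightarrow>
    lor d c1 + \<sigma>\<^sup>2 * lor d c2 \<le> 2 * \<sigma> * \<bar>lor d e\<bar> \<Longrightarrow>
    lor d c1 > 0 \<and> lor d c2 \<ge> 0 \<or> lor d c1 = 0 \<and> \<bar>\<sigma> * lor d c2\<bar> \<le> \<eta>"
    using tail_roots[OF accumulates_root_nonneg[OF acc] \<eta>(1)] by blast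
  have tail1: "lor d c1 > 0 \<and> lor d c2 \<ge> 0 \<or> lor d c1 = 0"
    if "0 < \<sigma>" "\<sigma> \<le> \<sigma>1 / 8" "d \<in> Proots M" "lor d c1 + \<sigma>\<^sup>2 * lor d c2 \<le> \<sigma> * \<bar>lor d e\<bar>" for \<sigma> d
  proof -
    have "\<sigma> * \<bar>lor d e\<bar> \<le> 2 * \<sigma> * \<bar>lor d e\<bar>" using that by simp
    then show ?thesis using tail[of \<sigma> d] that \<sigma>1 by linarith
  qed
  \<comment> \<open>For a high root \<open>T\<close> the foot has quotient
    \<open>\<tau>^2 <= 5 \<sigma>^2\<close>, since \<open>(T, e)^2 <= 5 (T, c1) (T, c2)\<close>. The
    factor 8 leaves room for this shift:
    \<open>\<tau> <= 4 \<sigma> <= \<sigma>1 / 2\<close>.\<close>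
  have from_big: "good_triple (Proots M)"
    if s: "0 < \<sigma>" "\<sigma> \<le> \<sigma>1 / 8" and T: "T \<in> Proots M" "(lor T e)\<^sup>2 \<ge> 20"
      "lor T c1 + \<sigma>\<^sup>2 * lor T c2 \<le> \<sigma> * \<bar>lor T e\<bar>" for \<sigma> T
  proof -
    have r: "4 * (lor T c1 * lor T c2) = (lor T e)\<^sup>2 - 4" using root_frame[OF T(1)] by simp
    then have "lor T c1 \<noteq> 0" "lor T c2 \<noteq> 0" using T(2) by auto
    then have AB: "lor T c1 > 0" "lor T c2 > 0" using tail1[OF s T(1,3)] by auto
    define \<tau> where "\<tau> = sqrt (lor T c1 / lor T c2)"
    have \<tau>: "\<tau> > 0" "\<tau>\<^sup>2 = lor T c1 / lor T c2" using AB by (simp_all add: \<tau>_def)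
    have c: "lor T c1 = \<tau>\<^sup>2 * lor T c2" using \<tau> AB by simp
    have "lor T c1 \<le> \<sigma> * \<bar>lor T e\<bar>" using T(3) AB by (smt (verit) mult_nonneg_nonneg zero_le_power2)
    then have "(lor T c1)\<^sup>2 \<le> (\<sigma> * \<bar>lor T e\<bar>)\<^sup>2" using AB by (intro power_mono) auto
    also have "\<dots> = \<sigma>\<^sup>2 * (lor T e)\<^sup>2" by (simp add: power_mult_distrib)
    also have "\<dots> \<le> \<sigma>\<^sup>2 * (5 * (lor T c1 * lor T c2))"
      using r T(2) by (intro mult_left_mono) auto
    finally have "lor T c1 * lor T c1 \<le> lor T c1 * (5 * \<sigma>\<^sup>2 * lor T c2)" by (simp add: power2_eq_square mult_ac)
    then have "lor T c1 \<le> 5 * \<sigma>\<^sup>2 * lor T c2" using AB by simp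
    then have "\<tau>\<^sup>2 \<le> 5 * \<sigma>\<^sup>2" using AB c by simp
    also have "\<dots> \<le> (4 * \<sigma>)\<^sup>2" by (simp add: power_mult_distrib)
    finally have "\<tau> \<le> 4 * \<sigma>" by (rule power2_le_imp_le) (use s in simp)
    then have "\<tau> \<le> \<sigma>1 / 2" using s by simp
    then show ?thesis using good_triple_big[OF \<sigma>1 \<eta> gap tail big T(1,2) c AB(1) \<tau>(1)] by blast
  qed
  have "(\<sigma>1 / 8)\<^sup>2 > 0" using \<sigma>1 by simp
  then obtain d x where d: "d \<in> Proots M" "lor d c1 \<noteq> 0" "lor d c2 \<noteq> 0"
    and x: "x \<in> M" "lor x d = 0" "lor x c1 \<le> (\<sigma>1 / 8)\<^sup>2 * lor x c2"
    using acc unfolding accumulates_def by meson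
  have scale: "\<exists>\<sigma>. 0 < \<sigma> \<and> \<sigma> \<le> \<sigma>1 / 8 \<and> lor z c1 = \<sigma>\<^sup>2 * lor z c2"
    if "lor z c1 > 0" "lor z c2 > 0" "lor z c1 \<le> (\<sigma>1 / 8)\<^sup>2 * lor z c2" for z
  proof (intro exI[of _ "sqrt (lor z c1 / lor z c2)"] conjI)
    have "lor z c1 / lor z c2 \<le> (\<sigma>1 / 8)\<^sup>2" using that by (simp add: divide_le_eq)
    then have "sqrt (lor z c1 / lor z c2) \<le> sqrt ((\<sigma>1 / 8)\<^sup>2)" by (rule real_sqrt_le_mono)
    then show "sqrt (lor z c1 / lor z c2) \<le> \<sigma>1 / 8" using \<sigma>1 by simp
  qed (use that in simp_all)
  have xh: "x \<in> hypL" using x M_sub by blast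
  have xc: "x \<in> hypL_closure" using xh hypL_subset_closure by blast
  obtain \<sigma> where \<sigma>: "0 < \<sigma>" "\<sigma> \<le> \<sigma>1 / 8" "lor x c1 = \<sigma>\<^sup>2 * lor x c2"
    using scale[OF frame_pos_hypL[OF xh] x(3)] by blast
  have dt: "lor d c1 + \<sigma>\<^sup>2 * lor d c2 \<le> \<sigma> * \<bar>lor d e\<bar>"
    using side_point_tail[OF xc x(2) \<sigma>(3) frame_pos_hypL(2)[OF xh] \<sigma>(1)] .
  have dAB: "lor d c1 > 0" "lor d c2 > 0" using tail1[OF \<sigma>(1,2) d(1) dt] d by auto
  show ?thesis
  proof (cases "(lor d e)\<^sup>2 \<ge> 20")
    case True
    then show ?thesis using from_big[OF \<sigma>(1,2) d(1) _ dt] by blast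
  next
    case False
    \<comment> \<open>This functional is nonpositive exactly where the quotient is at most
      \<open>(\<sigma>1 / 8)^2\<close>, so the vertex obtained from it is still close to the end
      \<open>c1\<close>.\<close>
    have k: "lor x (c1 - (\<sigma>1 / 8)\<^sup>2 *\<^sub>R c2) \<le> 0" using x(3) by (simp add: lor_simps)
    have cd: "lor c1 d \<noteq> 0" "lor c2 d \<noteq> 0"
      using d by (simp_all add: lor_commute[of c1 d] lor_commute[of c2 d])
    obtain z n where zn: "nbr d n" "z \<in> Mbar" "lor z d = 0" "lor z n = 0"
      "lor z (c1 - (\<sigma>1 / 8)\<^sup>2 *\<^sub>R c2) \<le> 0" "lor z c1 > 0" "lor z c2 > 0"
      using side_neighbours[OF d(1) cd x(1,2) k] by blast
    have zc: "z \<in> hypL_closure" using zn by (simp add: Mbar_def)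
    obtain \<tau> where \<tau>: "0 < \<tau>" "\<tau> \<le> \<sigma>1 / 8" "lor z c1 = \<tau>\<^sup>2 * lor z c2"
      using scale[OF zn(6,7)] zn(5) by (auto simp: lor_simps)
    have nP: "n \<in> Proots M" using zn by (simp add: nbr_def)
    show ?thesis
    proof (cases "(lor n e)\<^sup>2 \<ge> 20")
      case True
      then show ?thesis
        using from_big[OF \<tau>(1,2) nP True side_point_tail[OF zc zn(4) \<tau>(3) zn(7) \<tau>(1)]] by blast
    next
      case n_small: False
      have "\<tau> \<le> \<sigma>1 / 2" using \<tau> \<sigma>1 by simp
      then show ?thesis
        using good_triple_small[OF \<sigma>1 \<eta> gap tail big d(1) _ dAB zn(1) _ zc zn(3,4) \<tau>(3) zn(7) \<tau>(1)]
          False n_small by auto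
    qed
  qed
qed

text \<open>Otherwise all sides except those through the ends of the axis have points inside one
  fixed strip, where there are finitely many.\<close>

lemma accumulates_at_some_end:
  assumes inf: "infinite (Proots M)"
  shows "polygon.accumulates c1 c2 M \<or> polygon.accumulates c2 c1 M"
proof (rule ccontr)
  interpret sw: polygon e c2 c1 M p \<epsilon> by (rule polygon_swap)
  assume "\<not> ?thesis"
  then have na: "\<not> accumulates" "\<not> sw.accumulates" by simp_all
  obtain r1 where r1: "r1 > 0" "\<not> (\<exists>d\<in>Proots M. lor d c1 \<noteq> 0 \<and> lor d c2 \<noteq> 0 \<and>
     (\<exists>x\<in>M. lor x d = 0 \<and> lor x c1 \<le> r1 * lor x c2))"
    using na(1) unfolding accumulates_def by blast
  obtain r2 where r2: "r2 > 0" "\<not> (\<exists>d\<in>Proots M. lor d c2 \<noteq> 0 \<and> lor d c1 \<noteq> 0 \<and>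
     (\<exists>x\<in>M. lor x d = 0 \<and> lor x c2 \<le> r2 * lor x c1))"
    using na(2) unfolding sw.accumulates_def by blast
  note r = r1(1) r2(1)
  have n1: "lor x c1 > r1 * lor x c2" and n2: "lor x c2 > r2 * lor x c1"
    if "d \<in> Proots M" "lor d c1 \<noteq> 0" "lor d c2 \<noteq> 0" "x \<in> M" "lor x d = 0" for d x
    using that r1(2) r2(2) not_le by blast+
  define m where "m = lor p c1 / lor p c2"
  have pp: "lor p c1 > 0" "lor p c2 > 0" using frame_pos_hypL[OF p_hyp] .
  have m: "m > 0" "lor p c1 = m * lor p c2" using pp by (simp_all add: m_def)
  define r s where "r = min r1 (m / 2)" and "s = max (1 / r2) (2 * m)"
  have ins: "inside r s p"
  proof -
    have "r < m" "m < s" using m by (auto simp: r_def s_def)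
    then show ?thesis using pp m by (simp add: inside_def)
  qed
  have "r > 0" using r m by (simp add: r_def)
  then have f1: "finite {d \<in> Proots M. \<exists>x\<in>M. lor x d = 0 \<and> inside r s x}"
    using finite_sides_in_strip ins by blast
  have "c1 \<noteq> 0" "c2 \<noteq> 0" using c_pos by auto
  then have f2: "finite {d \<in> Proots M. lor d c1 = 0}" "finite {d \<in> Proots M. lor d c2 = 0}"
    using finite_roots_through by blast+
  have sub: "Proots M \<subseteq> {d \<in> Proots M. \<exists>x\<in>M. lor x d = 0 \<and> inside r s x}
      \<union> {d \<in> Proots M. lor d c1 = 0} \<union> {d \<in> Proots M. lor d c2 = 0}"
  proof
    fix d assume d: "d \<in> Proots M"
    obtain x where x: "x \<in> M" "lor x d = 0" using d by (auto simp: Proots_def hline_def)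
    have X: "lor x c1 > 0" "lor x c2 > 0" using frame_pos_hypL x(1) M_sub by blast+
    have "inside r s x" if "lor d c1 \<noteq> 0" "lor d c2 \<noteq> 0"
    proof -
      have "r * lor x c2 \<le> r1 * lor x c2" using X by (intro mult_right_mono) (auto simp: r_def)
      then have 1: "r * lor x c2 < lor x c1" using n1[OF d that x] by linarith
      have "lor x c1 < (1 / r2) * lor x c2" using n2[OF d that x] r by (simp add: field_simps)
      also have "\<dots> \<le> s * lor x c2" using X by (intro mult_right_mono) (auto simp: s_def)
      finally show ?thesis using 1 by (simp add: inside_def)
    qed
    then show "d \<in> {d \<in> Proots M. \<exists>x\<in>M. lor x d = 0 \<and> inside r s x}
      \<union> {d \<in> Proots M. lor d c1 = 0} \<union> {d \<in> Proots M. lor d c2 = 0}" using d x by blast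
  qed
  show False using inf finite_subset[OF sub finite_UnI[OF finite_UnI[OF f1 f2(1)] f2(2)]] by contradiction
qed

theorem good_triple_exists: "good_triple (Proots M)"
proof (cases "finite (Proots M)")
  case True
  then show ?thesis by (rule good_triple_finite)
next
  case inf: False
  have H: "\<bar>lor d e\<bar> \<ge> sqrt 20 \<longleftrightarrow> (lor d e)\<^sup>2 \<ge> 20" for d
    using real_sqrt_le_iff[of 20 "(lor d e)\<^sup>2"] by simp
  show ?thesis
  proof (cases "\<exists>d\<in>Proots M. (lor d e)\<^sup>2 \<ge> 20 \<and> \<not> isolated (\<lambda>d. \<bar>lor d e\<bar>) d")
    case True
    then obtain d where d: "d \<in> Proots M" "(lor d e)\<^sup>2 \<ge> 20" "\<not> isolated (\<lambda>d. \<bar>lor d e\<bar>) d" by blast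
    show ?thesis
    proof (rule good_triple_of_not_isolated[of "sqrt 20" e d])
      fix c assume c: "c \<in> Proots M" "sqrt 20 \<le> \<bar>lor c e\<bar>"
      then have h: "(lor c e)\<^sup>2 \<ge> 20" using H by blast
      then show "0 < lor e e + (lor c e)\<^sup>2 / 2" "(lor c e)\<^sup>2 \<le> 5/2 * (lor e e + (lor c e)\<^sup>2 / 2)"
        using ee by simp_all
      \<comment> \<open>A root through an end of the axis would have squared height 4.\<close>
      have "4 * lor c c1 * lor c c2 \<noteq> 0" using root_frame[OF c(1)] h by simp
      then show "two_nbrs c" using two_nbrs_of_not_end[OF c(1)] by (simp add: lor_commute)
    qed (use d H finite_h in auto)
  next
    case False
    interpret sw: polygon e c2 c1 M p \<epsilon> by (rule polygon_swap)
    show ?thesis using accumulates_at_some_end[OF inf] good_triple_accumulating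
        sw.good_triple_accumulating False by blast
  qed
qed

end

subsection \<open>The constant\<close>

text \<open>Here \<open>c\<close> stands for \<open>cosh (\<eta>/2)\<close>.\<close>
lemma beta_equation_iff:
  fixes c :: real
  assumes "c > 1"
  shows "32 * (c ^ 3 + c ^ 2) - 2 = 8 * c + 10 + 8 / (c - 1) \<longleftrightarrow> 8 * c ^ 4 - 10 * c ^ 2 - c + 1 = 0"
proof -
  have *: "8 / k * k = 8" if "k \<noteq> 0" for k :: real using that by simp
  have "32 * (c ^ 3 + c ^ 2) - 2 = 8 * c + 10 + 8 / (c - 1) \<longleftrightarrow>
      (32 * (c ^ 3 + c ^ 2) - 2) * (c - 1) = (8 * c + 10 + 8 / (c - 1)) * (c - 1)"
    using assms by simp
  also have "(8 * c + 10 + 8 / (c - 1)) * (c - 1) = (8 * c + 10) * (c - 1) + 8"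
    using distrib_right[of "8 * c + 10" "8 / (c - 1)" "c - 1"] *[of "c - 1"] assms by linarith
  also have "(32 * (c ^ 3 + c ^ 2) - 2) * (c - 1) = (8 * c + 10) * (c - 1) + 8 \<longleftrightarrow>
      4 * (8 * c ^ 4 - 10 * c ^ 2 - c + 1) = 0"
    by (simp add: algebra_simps power2_eq_square power3_eq_cube power4_eq_xxxx)
  also have "\<dots> \<longleftrightarrow> 8 * c ^ 4 - 10 * c ^ 2 - c + 1 = 0"
    by (simp only: mult_eq_0_iff) simp
  finally show ?thesis .
qed

text \<open>The difference has the factor \<open>d - c\<close>, and the cofactor is at least 2 * 6 -
  1. This makes the solution of the equation unique.\<close>

lemma quartic_mono:
  fixes c d :: real
  assumes "1 \<le> c" "c < d"
  shows "8 * c ^ 4 - 10 * c ^ 2 - c + 1 < 8 * d ^ 4 - 10 * d ^ 2 - d + 1"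
proof -
  have "c\<^sup>2 \<ge> 1" "d\<^sup>2 \<ge> 1" using assms by simp_all
  from add_mono[OF this] have "8 * (c\<^sup>2 + d\<^sup>2) - 10 \<ge> 6" by simp
  then have "(c + d) * (8 * (c\<^sup>2 + d\<^sup>2) - 10) \<ge> 2 * 6" using assms by (intro mult_mono) linarith+
  then have "(d - c) * ((c + d) * (8 * (c\<^sup>2 + d\<^sup>2) - 10) - 1) > 0" using assms by simp
  moreover have "(d - c) * ((c + d) * (8 * (c\<^sup>2 + d\<^sup>2) - 10) - 1)
      = (8 * d ^ 4 - 10 * d ^ 2 - d + 1) - (8 * c ^ 4 - 10 * c ^ 2 - c + 1)"
    by (simp add: algebra_simps power2_eq_square power4_eq_xxxx)
  ultimately show ?thesis by simp
qed

lemma bound_const_bounds: "62 \<le> bound_const" "bound_const < 83.7706"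
proof -
  define g where "g = (\<lambda>c::real. 8 * c ^ 4 - 10 * c ^ 2 - c + 1)"
  \<comment> \<open>A rational number slightly above the root of \<open>g\<close> beyond 1, close
    enough to give the decimal bound.\<close>
  define u :: real where "u = 112348981 / 100000000"
  have "continuous_on {1..u} g" unfolding g_def by (intro continuous_intros)
  moreover have "g 1 < 0" "g u > 0" by (simp_all add: g_def u_def power2_eq_square power4_eq_xxxx)
  ultimately obtain c where c: "1 \<le> c" "c \<le> u" "g c = 0"
    using IVT'[of g 1 0 u] by (auto simp: u_def)
  have "c \<noteq> 1" using c(3) \<open>g 1 < 0\<close> by auto
  with c have c1: "c > 1" by simp
  have unique: "d = c" if "d > 1" "g d = 0" for d
    using quartic_mono[of c d] quartic_mono[of d c] that c by (cases c d rule: linorder_cases) (auto simp: g_def)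
  let ?E = "\<lambda>\<eta>::real. \<eta> > 0 \<and>
      32 * (cosh (\<eta>/2) ^ 3 + cosh (\<eta>/2) ^ 2) - 2 = 8 * cosh (\<eta>/2) + 10 + 8 / (cosh (\<eta>/2) - 1)"
  have E: "?E \<eta> \<longleftrightarrow> \<eta> > 0 \<and> cosh (\<eta>/2) = c" for \<eta> :: real
  proof -
    have "cosh (\<eta>/2) > 1" if "\<eta> > 0"
      using that cosh_real_nonneg_less_iff[of 0 "\<eta>/2"] by simp
    then show ?thesis using beta_equation_iff[of "cosh (\<eta>/2)"] unique[of "cosh (\<eta>/2)"] c(3)
      by (auto simp: g_def)
  qed
  have "?E beta_const" unfolding beta_const_def
  proof (rule theI)
    have "arcosh c > 0" using c1 by simp
    then show "?E (2 * arcosh c)" unfolding E using c1 by simp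
    fix y assume "?E y"
    then have y: "y > 0" "cosh (y/2) = c" unfolding E by auto
    then have "y / 2 = arcosh c" using arcosh_cosh_real[of "y/2"] by simp
    then show "y = 2 * arcosh c" by simp
  qed
  then have eq: "cosh (beta_const/2) = c" unfolding E by simp
  have b: "bound_const = 32 * (c ^ 3 + c ^ 2) - 2" by (simp add: bound_const_def eq)
  \<comment> \<open>At \<open>c = 1\<close> the expression is exactly 62.\<close>
  have "c ^ 3 \<ge> 1" "c ^ 2 \<ge> 1" using c1 by simp_all
  then show "62 \<le> bound_const" unfolding b by simp
  have "c ^ 3 \<le> u ^ 3" "c ^ 2 \<le> u ^ 2" using c by (auto intro: power_mono)
  then have "bound_const \<le> 32 * (u ^ 3 + u ^ 2) - 2" unfolding b by simp
  also have "\<dots> < 83.7706"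
    by (simp add: u_def power2_eq_square power3_eq_cube)
  finally show "bound_const < 83.7706" .
qed

subsection \<open>The theorem\<close>

text \<open>A connected graph on three vertices has a vertex \<open>m\<close> adjacent to both
  others, and all paths can be led through \<open>m\<close>.\<close>

lemma gram_connected_conn3:
  assumes "conn3 a b c" "a \<noteq> b" "a \<noteq> c" "b \<noteq> c"
  shows "gram_connected {a, b, c}"
proof -
  define R where "R = (\<lambda>u v. u \<in> {a, b, c} \<and> v \<in> {a, b, c} \<and> u \<noteq> v \<and> lor u v \<noteq> 0)"
  have star: "\<forall>x\<in>{a, b, c}. \<forall>y\<in>{a, b, c}. R\<^sup>*\<^sup>* x y"
    if m: "m \<in> {a, b, c}" "\<forall>x\<in>{a, b, c} - {m}. lor m x \<noteq> 0" for m
  proof (intro ballI)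
    have edge: "R m x \<and> R x m" if "x \<in> {a, b, c}" "x \<noteq> m" for x
      using m that lor_commute[of m x] unfolding R_def by auto
    fix x y assume xy: "x \<in> {a, b, c}" "y \<in> {a, b, c}"
    have "R\<^sup>*\<^sup>* x m" "R\<^sup>*\<^sup>* m y"
      using edge[OF xy(1)] edge[OF xy(2)] by blast+
    then show "R\<^sup>*\<^sup>* x y" by (rule rtranclp_trans)
  qed
  consider "lor a b \<noteq> 0" "lor a c \<noteq> 0" | "lor b a \<noteq> 0" "lor b c \<noteq> 0" | "lor c a \<noteq> 0" "lor c b \<noteq> 0"
    using assms(1) unfolding conn3_def by (metis lor_commute)
  then have "\<forall>x\<in>{a, b, c}. \<forall>y\<in>{a, b, c}. R\<^sup>*\<^sup>* x y"
    using star[of a] star[of b] star[of c] by cases auto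
  then show ?thesis unfolding gram_connected_def R_def .
qed

text \<open>The map \<open>\<phi>\<close> recovers the height from the angle or the
  distance.\<close>

lemma finite_heights:
  assumes "finite (angle_dist e ` S)"
  shows "finite ((\<lambda>d. \<bar>lor d e\<bar>) ` S)"
proof -
  define \<phi> where "\<phi> = (\<lambda>v::real + real. case v of Inl x \<Rightarrow> 2 * cos x | Inr x \<Rightarrow> 2 * cosh x)"
  have "\<phi> (angle_dist e d) = \<bar>lor d e\<bar>" for d
    by (auto simp: \<phi>_def angle_dist_def Let_def lor_commute[of e d])
  then have "(\<lambda>d. \<bar>lor d e\<bar>) ` S = \<phi> ` (angle_dist e ` S)" by (simp add: image_image)
  then show ?thesis using assms by simp
qed

lemma convex_lf_polygon_convex:
  assumes "convex_lf_polygon M"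
  shows "M \<subseteq> hypL" "convex M"
proof -
  obtain D where M: "M = hypL \<inter> (\<Inter>d\<in>D. halfplane d)"
    using assms unfolding convex_lf_polygon_def by blast
  show "M \<subseteq> hypL" using M by blast
  show "convex M" unfolding convex_alt
  proof (intro ballI allI impI)
    fix x y :: "real^3" and u :: real
    assume xy: "x \<in> M" "y \<in> M" and u: "0 \<le> u \<and> u \<le> 1"
    have "(1 - u) *\<^sub>R x + u *\<^sub>R y \<in> hypL"
    proof (cases "x = y \<or> u = 0 \<or> u = 1")
      case True
      then show ?thesis using xy M by (auto simp flip: scaleR_add_left)
    next
      case False
      then show ?thesis using segment_in_hypL[of x y u] xy u M hypL_subset_closure by auto
    qed
    moreover have "lor ((1 - u) *\<^sub>R x + u *\<^sub>R y) d \<ge> 0" if "d \<in> D" for d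
      using xy u that unfolding M by (auto simp: halfplane_def lor_simps)
    ultimately show "(1 - u) *\<^sub>R x + u *\<^sub>R y \<in> M" unfolding M by (auto simp: halfplane_def)
  qed
qed

text \<open>A ball relative to \<open>hypL\<close> shrinks to a ball of the plane
  \<open>x$1 = 1\<close>, because the timelike vectors form an open set.\<close>

lemma nonempty_interior_ball:
  assumes "nonempty_interior M" "M \<subseteq> hypL"
  obtains p \<epsilon> where "p \<in> hypL" "\<epsilon> > 0" "\<And>y. y$1 = 1 \<Longrightarrow> dist y p < \<epsilon> \<Longrightarrow> y \<in> M"
proof -
  obtain p \<epsilon> where p: "p \<in> M" "\<epsilon> > 0" "\<And>y. y \<in> hypL \<Longrightarrow> dist y p < \<epsilon> \<Longrightarrow> y \<in> M"
    using assms(1) unfolding nonempty_interior_def by blast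
  have ph: "p \<in> hypL" using p assms by blast
  have "open {x. 0 < lor x x}"
    by (intro open_Collect_less continuous_on_const lor.continuous_on continuous_on_id)
  then obtain \<eta> where \<eta>: "\<eta> > 0" "\<And>y. dist y p < \<eta> \<Longrightarrow> 0 < lor y y"
    using ph unfolding open_dist by (auto simp: hypL_def)
  show ?thesis
    by (rule that[of p "min \<epsilon> \<eta>"]) (use p ph \<eta> in \<open>auto simp: hypL_def\<close>)
qed

theorem theorem8p2p3:
  fixes M :: "(real^3) set" and e :: "real^3"
  assumes "convex_lf_polygon M"
    and "restricted_hyperbolic M e"
  shows "\<exists>d1 d2 d3. d1 \<in> Proots M \<and> d2 \<in> Proots M \<and> d3 \<in> Proots M \<and>
           span {d1, d2, d3} = UNIV \<and> gram_connected {d1, d2, d3} \<and>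
           (\<forall>d\<in>{d1, d2, d3}. \<forall>d'\<in>{d1, d2, d3}. lor d d' \<le> bound_const) \<and>
           bound_const < 83.7706"
proof -
  have e: "lor e e = -2" using assms(2) by (simp add: restricted_hyperbolic_def)
  obtain c1 c2 where "axis_frame e c1 c2" using axis_frame_exists[OF e] by blast
  then interpret axis_frame e c1 c2 .
  obtain p \<epsilon> where p: "p \<in> hypL" "\<epsilon> > 0" "\<And>y. y$1 = 1 \<Longrightarrow> dist y p < \<epsilon> \<Longrightarrow> y \<in> M"
    using nonempty_interior_ball convex_lf_polygon_convex(1)[OF assms(1)] assms(2)
    unfolding restricted_hyperbolic_def by metis
  interpret polygon e c1 c2 M p \<epsilon>
  proof
    show "M \<subseteq> hypL" "convex M" using convex_lf_polygon_convex[OF assms(1)] .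
    show "finite ((\<lambda>d. \<bar>lor d e\<bar>) ` Proots M)"
      using assms(2) finite_heights unfolding restricted_hyperbolic_def by blast
    fix r s :: real assume rs: "0 < r" "r < s" "nonempty_interior (M \<inter> strip r s)"
    have "foot r \<in> hline e" "foot s \<in> hline e" using foot_hline rs by auto
    then show "\<exists>F. finite F \<and> F \<subseteq> hypL_closure \<and> M \<inter> strip r s = convex hull F \<inter> hypL"
      using assms(2) rs strip_eq_orth_strip[OF rs(1,2)] unfolding restricted_hyperbolic_def by metis
  qed (use p in auto)
  obtain a b c where t: "a \<in> Proots M" "b \<in> Proots M" "c \<in> Proots M" "a \<noteq> b" "a \<noteq> c" "b \<noteq> c"
    "conn3 a b c" "lor a b \<le> 62" "lor a c \<le> 62" "lor b c \<le> 62"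
    using good_triple_exists unfolding good_triple_def by blast
  have "span {a, b, c} = UNIV" using span_tri tri_nonzero t by blast
  moreover have "gram_connected {a, b, c}" using gram_connected_conn3 t by blast
  moreover have "\<forall>d\<in>{a, b, c}. \<forall>d'\<in>{a, b, c}. lor d d' \<le> bound_const"
    using t root bound_const_bounds(1) by (auto simp: lor_commute[of b a] lor_commute[of c a] lor_commute[of c b])
  ultimately show ?thesis using t bound_const_bounds(2) by blast
qed

end
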